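(* Let $F:\mathcal S\times\Omega\to\mathcal S$ be a regular area-preserving random twist that is isotopic to the identity. Then there exist an integer $N\ge0$ and regular monotone area-preserving random twists $F_0,\dots,F_N$ such that for each fixed $\omega\in\Omega$ $$F(\cdot,\cdot;\omega)=F_N(\cdot,\cdot;\omega)\circ\cdots\circ F_1(\cdot,\cdot;\omega)\circ F_0(\cdot,\cdot;\omega),$$ where $F_j$ is negative monotone if $j$ is even and $F_j$ is positive monotone if $j$ is odd.
   Context: Setting: $\Omega$ is a separable metric space, $\mathcal F$ its Borel $\sigma$-algebra, $\tau:\mathbb R\times\Omega\to\Omega$ a continuous $\mathbb R$-action, $\tau_a:=\tau(a,\cdot)$, and $\mathbb P$ a probability measure on $(\Omega,\mathcal F)$ with: $\mathbb P(U)>0$ for every nonempty open $U$; $\mathbb P(\tau_aA)=\mathbb P(A)$ for all $a\in\mathbb R$, $A\in\mathcal F$; and $\mathbb P(A)\in\{0,1\}$ whenever $A\in\mathcal F$ and $\tau_aA=A$ for all $a$. $\mathbb E$ is expectation. $\mathcal S=\mathbb R\times[-1,1]$. Let $\bar F=(\bar Q,\bar P):\Omega\times[-1,1]\to\mathcal S$ be measurable and $F(q,p;\omega)=(Q(q,p;\omega),P(q,p;\omega))$ with $Q(q,p;\omega)=q+\bar Q(\tau_q\omega,p)$, $P(q,p;\omega)=\bar P(\tau_q\omega,p)$. $F$ is an area-preserving random twist if for $\mathbb P$-almost all $\omega$: (1) $F(\cdot,\cdot;\omega):\mathcal S\to\mathcal S$ is an area-preserving diffeomorphism; (2) $P(q,\pm1;\omega)=\pm1$;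 (3) $q\mapsto Q(q,\pm1;\omega)$ is increasing and $\pm\bar Q(\omega,\pm1)>0$; (4) $\sup_p\mathbb E[\bar Q^2(\omega,p)+\bar P^2(\omega,p)]<\infty$. It is positive monotone if $p\mapsto\bar Q(\omega,p)$ is increasing with probability one. A negative monotone area-preserving random twist is a map of the same form that is the inverse of a positive monotone one (so $p\mapsto\bar Q(\omega,p)$ is decreasing a.s., (1),(2),(4) hold, $Q(q,\pm1;\omega)$ is increasing in $q$, but $\pm\bar Q(\omega,\pm1)<0$). Monotone means positive or negative monotone. A map of this form is regular if the derivatives of it and of its inverse are uniformly bounded by a constant independent of $\omega$ with probability one. A regular area-preserving random twist $F$ is isotopic to the identity if there is a path $(F^t)_{t\in[0,1]}$ of diffeomorphisms $F^t:\mathcal S\times\Omega\to\mathcal S$ connecting $F$ to the identity such that for each $t$: (a) $F^t(q,p;\omega)=(q+\bar Q^t(\tau_q\omega,p),\bar P^t(\tau_q\omega,p))$; (b) $\frac12\int_{-1}^1\mathbb E\det(\mathrm dF^t)\,\mathrm dp=1$; (c) $\frac{dF^t}{dt}$, $F^t$ and $(F^t)^{-1}$ are almost surely bounded in $C^r$ for sufficiently large $r$. *)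

theory Defs
  imports "HOL-Probability.Probability"
begin

text \<open>
  The sample space is the whole type \<open>'w\<close>; \<open>\<tau> a\<close> is the flow at time \<open>a\<close>.
\<close>

locale ergodic_flow = prob_space M
  for M :: "'w::metric_space measure" and \<tau> :: "real \<Rightarrow> 'w \<Rightarrow> 'w" +
  assumes separable: "separable_space (euclidean :: 'w topology)"
    and sets_M: "sets M = sets borel"
    and flow_continuous: "continuous_on UNIV (\<lambda>(a, \<omega>). \<tau> a \<omega>)"
    and flow_0: "\<tau> 0 \<omega> = \<omega>"
    and flow_add: "\<tau> (a + b) \<omega> = \<tau> a (\<tau> b \<omega>)"
    and full_support: "open U \<Longrightarrow> U \<noteq> {} \<Longrightarrow> measure M U > 0"
    and invariant: "A \<in> sets M \<Longrightarrow> measure M (\<tau> a ` A) = measure M A"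
    and ergodic: "A \<in> sets M \<Longrightarrow> (\<And>a. \<tau> a ` A = A) \<Longrightarrow> measure M A \<in> {0, 1}"

definition strip :: "(real \<times> real) set" where
  "strip = UNIV \<times> {-1..1}"

definition profile :: "'w measure \<Rightarrow> ('w \<times> real \<Rightarrow> real \<times> real) \<Rightarrow> bool" where
  "profile M f \<longleftrightarrow>
     f \<in> M \<Otimes>\<^sub>M restrict_space borel {-1..1} \<rightarrow>\<^sub>M restrict_space borel strip"

text \<open>
  The random map with profile \<open>f = (Q_bar, P_bar)\<close>. All random maps below are represented
  by their profiles; only the values on \<^term>\<open>strip\<close> are meaningful.
\<close>

definition rmap ::
    "(real \<Rightarrow> 'w \<Rightarrow> 'w) \<Rightarrow> ('w \<times> real \<Rightarrow> real \<times> real) \<Rightarrow> 'w \<Rightarrow> real \<times> real \<Rightarrow> real \<times> real" where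
  "rmap \<tau> f \<omega> = (\<lambda>(q, p). (q + fst (f (\<tau> q \<omega>, p)), snd (f (\<tau> q \<omega>, p))))"

text \<open>
  Derivatives are taken within the closed strip, so they are one-sided in \<open>p\<close> on the boundary
  (and still unique there).
\<close>

definition C1_strip :: "(real \<times> real \<Rightarrow> real \<times> real) \<Rightarrow> bool" where
  "C1_strip g \<longleftrightarrow>
     (\<exists>g' :: real \<times> real \<Rightarrow> (real \<times> real) \<Rightarrow>\<^sub>L (real \<times> real).
        (\<forall>x\<in>strip. (g has_derivative blinfun_apply (g' x)) (at x within strip)) \<and>
        continuous_on strip g')"

definition deriv_bounded :: "real \<Rightarrow> (real \<times> real \<Rightarrow> real \<times> real) \<Rightarrow> bool" where
  "deriv_bounded K g \<longleftrightarrow>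
     (\<forall>x\<in>strip. \<exists>D. (g has_derivative D) (at x within strip) \<and> onorm D \<le> K)"

text \<open>
  \<open>Cr_bounded r K g\<close>: \<open>g\<close> is of class \<open>C\<^sup>r\<close> on the strip and all its partial derivatives of
  order at most \<open>r\<close> (including \<open>g\<close> itself) are bounded by \<open>K\<close>. In the step, \<open>g1\<close> and \<open>g2\<close> are
  the partial derivatives with respect to \<open>q\<close> and \<open>p\<close>.
\<close>

primrec Cr_bounded :: "nat \<Rightarrow> real \<Rightarrow> (real \<times> real \<Rightarrow> real \<times> real) \<Rightarrow> bool" where
  "Cr_bounded 0 K g \<longleftrightarrow> continuous_on strip g \<and> (\<forall>x\<in>strip. norm (g x) \<le> K)"
| "Cr_bounded (Suc r) K g \<longleftrightarrow>
     (\<forall>x\<in>strip. norm (g x) \<le> K) \<and>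
     (\<exists>g1 g2.
        (\<forall>x\<in>strip. (g has_derivative (\<lambda>(u, v). u *\<^sub>R g1 x + v *\<^sub>R g2 x)) (at x within strip)) \<and>
        Cr_bounded r K g1 \<and> Cr_bounded r K g2)"

definition diffeo_strip :: "(real \<times> real \<Rightarrow> real \<times> real) \<Rightarrow> bool" where
  "diffeo_strip g \<longleftrightarrow> bij_betw g strip strip \<and> C1_strip g \<and> C1_strip (inv_into strip g)"

definition area_preserving :: "(real \<times> real \<Rightarrow> real \<times> real) \<Rightarrow> bool" where
  "area_preserving g \<longleftrightarrow>
     (\<forall>A\<in>sets borel. A \<subseteq> strip \<longrightarrow> emeasure lborel (g ` A) = emeasure lborel A)"

definition jacobian :: "(real \<times> real \<Rightarrow> real \<times> real) \<Rightarrow> real \<times> real \<Rightarrow> real" where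
  "jacobian g x =
     (let D = frechet_derivative g (at x within strip) in
      det (vector [vector [fst (D (1, 0)), fst (D (0, 1))],
                   vector [snd (D (1, 0)), snd (D (0, 1))]] :: real^2^2))"

definition ap_random_twist ::
    "'w measure \<Rightarrow> (real \<Rightarrow> 'w \<Rightarrow> 'w) \<Rightarrow> ('w \<times> real \<Rightarrow> real \<times> real) \<Rightarrow> bool" where
  "ap_random_twist M \<tau> f \<longleftrightarrow>
     profile M f \<and>
     (AE \<omega> in M.
        diffeo_strip (rmap \<tau> f \<omega>) \<and> area_preserving (rmap \<tau> f \<omega>) \<and>
        (\<forall>q. snd (rmap \<tau> f \<omega> (q, 1)) = 1 \<and> snd (rmap \<tau> f \<omega> (q, -1)) = -1) \<and>
        strict_mono (\<lambda>q. fst (rmap \<tau> f \<omega> (q, 1))) \<and>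
        strict_mono (\<lambda>q. fst (rmap \<tau> f \<omega> (q, -1))) \<and>
        fst (f (\<omega>, 1)) > 0 \<and> fst (f (\<omega>, -1)) < 0) \<and>
     (SUP p\<in>{-1..1}. \<integral>\<^sup>+ \<omega>. ennreal ((fst (f (\<omega>, p)))\<^sup>2 + (snd (f (\<omega>, p)))\<^sup>2) \<partial>M) < \<infinity>"

definition positive_monotone ::
    "'w measure \<Rightarrow> (real \<Rightarrow> 'w \<Rightarrow> 'w) \<Rightarrow> ('w \<times> real \<Rightarrow> real \<times> real) \<Rightarrow> bool" where
  "positive_monotone M \<tau> f \<longleftrightarrow>
     ap_random_twist M \<tau> f \<and>
     (AE \<omega> in M. strict_mono_on {-1..1} (\<lambda>p. fst (f (\<omega>, p))))"

definition negative_monotone ::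
    "'w measure \<Rightarrow> (real \<Rightarrow> 'w \<Rightarrow> 'w) \<Rightarrow> ('w \<times> real \<Rightarrow> real \<times> real) \<Rightarrow> bool" where
  "negative_monotone M \<tau> f \<longleftrightarrow>
     profile M f \<and>
     (\<exists>h. positive_monotone M \<tau> h \<and>
        (AE \<omega> in M. \<forall>x\<in>strip.
           rmap \<tau> f \<omega> (rmap \<tau> h \<omega> x) = x \<and> rmap \<tau> h \<omega> (rmap \<tau> f \<omega> x) = x))"

definition regular_rmap ::
    "'w measure \<Rightarrow> (real \<Rightarrow> 'w \<Rightarrow> 'w) \<Rightarrow> ('w \<times> real \<Rightarrow> real \<times> real) \<Rightarrow> bool" where
  "regular_rmap M \<tau> f \<longleftrightarrow>
     (\<exists>K. AE \<omega> in M.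
        deriv_bounded K (rmap \<tau> f \<omega>) \<and> deriv_bounded K (inv_into strip (rmap \<tau> f \<omega>)))"

text \<open>
  An isotopy is given by its profiles \<open>ft t\<close>. Three conventions:
  boundedness of a map \<open>g\<close> of the (unbounded) strip in \<open>C\<^sup>r\<close> refers to its displacement \<open>g x - x\<close>,
  with a bound uniform in \<open>t\<close> and \<open>\<omega>\<close>;
  the expected Jacobian is evaluated at \<open>q = 0\<close>, its value being independent of \<open>q\<close> by invariance;
  and this expectation uses the completion of \<open>M\<close>, because the Jacobian is determined only for
  almost every \<open>\<omega>\<close> and may fail to be Borel on the exceptional null set.
\<close>

definition isotopic_to_id ::
    "nat \<Rightarrow> 'w measure \<Rightarrow> (real \<Rightarrow> 'w \<Rightarrow> 'w) \<Rightarrow> ('w \<times> real \<Rightarrow> real \<times> real) \<Rightarrow> bool" where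
  "isotopic_to_id r M \<tau> f \<longleftrightarrow>
     (\<exists>ft :: real \<Rightarrow> 'w \<times> real \<Rightarrow> real \<times> real.
        (\<forall>t\<in>{0..1}. profile M (ft t)) \<and>
        (AE \<omega> in M. \<forall>x\<in>strip. rmap \<tau> (ft 0) \<omega> x = x \<and> rmap \<tau> (ft 1) \<omega> x = rmap \<tau> f \<omega> x) \<and>
        (AE \<omega> in M. \<forall>t\<in>{0..1}. diffeo_strip (rmap \<tau> (ft t) \<omega>)) \<and>
        (\<forall>t\<in>{0..1}.
           1 / 2 * (LBINT p:{-1..1}.
             (\<integral>\<omega>. jacobian (rmap \<tau> (ft t) \<omega>) (0, p) \<partial>completion M)) = 1) \<and>
        (\<exists>K. AE \<omega> in M. \<forall>t\<in>{0..1}.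
           Cr_bounded r K (\<lambda>x. rmap \<tau> (ft t) \<omega> x - x) \<and>
           Cr_bounded r K (\<lambda>x. inv_into strip (rmap \<tau> (ft t) \<omega>) x - x) \<and>
           (\<exists>v. (\<forall>x\<in>strip.
                   ((\<lambda>s. rmap \<tau> (ft s) \<omega> x) has_vector_derivative v x) (at t within {0..1})) \<and>
                Cr_bounded r K v)))"

end

theory Submission
  imports Defs
begin

text \<open>
  Let \<open>F\<^sup>t\<close> be the isotopy and \<open>\<rho>\<^sup>t\<close> its Jacobian determinant. The maps \<open>F\<^sup>t\<close> need not preserve the
  area, but the triangular map
  \<open>T\<^sup>t(q, p) = (q + c(q), 2 R(q, p) / R(q, 1) - 1)\<close>, \<open>R(q, p) = \<integral> \<rho>\<^sup>t(q, s) ds\<close> over \<open>[-1, p]\<close>,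
  has the same Jacobian determinant as soon as \<open>1 + c' = R(\<cdot>, 1) / 2\<close>. Such a \<open>c\<close> that is bounded and
  stationary is half the signed area between the image under \<open>F\<^sup>t\<close> of a vertical segment and that
  segment; so no cohomological equation has to be solved. Hence \<open>A\<^sup>t = F\<^sup>t \<circ> (T\<^sup>t)\<inverse>\<close> is a path of
  area-preserving maps from the identity, \<open>F = A\<^sup>1 \<circ> T\<^sup>1\<close>, and \<open>A\<^sup>1\<close> is a product of factors
  \<open>A\<^sup>s \<circ> (A\<^sup>t)\<inverse>\<close> uniformly \<open>C\<^sup>1\<close>-close to the identity. If \<open>\<psi>\<close> is \<open>T\<^sup>1\<close> or one of these factors, then
  \<open>\<psi> = (\<psi> \<circ> \<phi>) \<circ> \<phi>\<inverse>\<close> with the shear \<open>\<phi>(q, p) = (q + k p, p)\<close>, and \<open>\<psi> \<circ> \<phi>\<close> is a positive monotone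
  twist for large \<open>k\<close>.
\<close>

section \<open>Calculus on the strip\<close>

text \<open>The hypotheses on the isotopy hold for almost every \<omega>, the conclusion for every
  \<omega>. So a flow-invariant set \<open>G\<close> of full measure is constructed on which they
  hold everywhere; outside it the isotopy is replaced by the identity path, which keeps
  measurability, equivariance and all constants. The given map on these orbits is hidden in the
  first factor, whose monotonicity is an almost sure property. Regularity asks for constants
  independent of \<omega>, so estimates are made for whole indexed families. Three derivatives are
  consumed: the Jacobian matrix of the triangular map contains the q-derivative of a density, hence
  second derivatives of the isotopy, and these must be Lipschitz for the increments of the
  area-preserving path to be C1-close to the identity. Composition with a large shear becomes
  monotone once the upper left Jacobian entry has a positive lower bound and the remaining data are
  bounded. The triangular map qualifies without being close to the identity: its entry is half a
  vertical integral of the density.\<close>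

lemma convex_strip: "convex strip"
  unfolding strip_def by (intro convex_Times) auto

lemma closed_strip: "closed strip"
  unfolding strip_def by (intro closed_Times) auto

lemma strip_iff: "(q, p) \<in> strip \<longleftrightarrow> -1 \<le> p \<and> p \<le> 1"
  by (auto simp: strip_def)

lemma shift_mem_strip [simp]: "x + (a, 0) \<in> strip \<longleftrightarrow> x \<in> strip"
  by (cases x) (auto simp: strip_def)

text \<open>
  The partial derivatives are defined by one fixed sequence of difference quotients inside the
  strip: this makes them measurable in parameters and compatible with translations in \<open>q\<close>.
\<close>

definition dq :: "(real \<times> real \<Rightarrow> 'b::real_normed_vector) \<Rightarrow> real \<times> real \<Rightarrow> 'b" where
  "dq g x = lim (\<lambda>n. real (Suc n) *\<^sub>R (g (x + (1 / real (Suc n), 0)) - g x))"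

text \<open>The sign points to the farther edge, so a vertical step of length at most 1 in that
  direction stays in the strip.\<close>

definition inward :: "real \<Rightarrow> real" where
  "inward p = (if p \<le> 0 then 1 else -1)"

definition dp :: "(real \<times> real \<Rightarrow> 'b::real_normed_vector) \<Rightarrow> real \<times> real \<Rightarrow> 'b" where
  "dp g x = lim (\<lambda>n. (inward (snd x) * real (Suc n)) *\<^sub>R
      (g (x + (0, inward (snd x) / real (Suc n))) - g x))"

lemma inward_mem_strip:
  assumes "x \<in> strip"
  shows "x + (0, inward (snd x) / real (Suc n)) \<in> strip"
proof -
  obtain q p where x: "x = (q, p)" by (cases x)
  define h where "h = 1 / real (Suc n)"
  have "h \<le> 1" "0 \<le> h" by (auto simp: h_def)
  moreover have "inward p / real (Suc n) = (if p \<le> 0 then h else - h)"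
    by (auto simp: inward_def h_def)
  ultimately show ?thesis
    using assms unfolding x by (simp add: strip_iff)
qed

lemma has_derivative_imp_diffquot:
  fixes g :: "'a::real_normed_vector \<Rightarrow> 'b::real_normed_vector"
  assumes D: "(g has_derivative D) (at x within S)"
    and S: "\<And>n. x + h n *\<^sub>R u \<in> S" and h: "h \<longlonglongrightarrow> 0" "\<And>n. h n \<noteq> (0::real)"
  shows "(\<lambda>n. (1 / h n) *\<^sub>R (g (x + h n *\<^sub>R u) - g x)) \<longlonglongrightarrow> D u"
proof (cases "u = 0")
  case True
  then show ?thesis
    using D by (simp add: linear_0 has_derivative_bounded_linear bounded_linear.linear)
next
  case False
  interpret bounded_linear D using D by (rule has_derivative_bounded_linear)
  have f1: "((\<lambda>y. norm (g y - g x - D (y - x)) / norm (y - x)) \<longlongrightarrow> 0) (at x within S)"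
    using D unfolding has_derivative_iff_norm by blast
  have f2: "filterlim (\<lambda>n. x + h n *\<^sub>R u) (at x within S) sequentially"
    unfolding filterlim_at
  proof (intro conjI)
    show "\<forall>\<^sub>F n in sequentially. x + h n *\<^sub>R u \<in> S \<and> x + h n *\<^sub>R u \<noteq> x"
      using S h False by auto
    have "(\<lambda>n. x + h n *\<^sub>R u) \<longlonglongrightarrow> x + 0 *\<^sub>R u" by (intro tendsto_intros h)
    then show "(\<lambda>n. x + h n *\<^sub>R u) \<longlonglongrightarrow> x" by simp
  qed
  have "(\<lambda>n. norm (g (x + h n *\<^sub>R u) - g x - D (h n *\<^sub>R u)) / norm (h n *\<^sub>R u)) \<longlonglongrightarrow> 0"
    using filterlim_compose[OF f1 f2] unfolding add_diff_cancel_left' by simp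
  then have "(\<lambda>n. norm u * (norm (g (x + h n *\<^sub>R u) - g x - D (h n *\<^sub>R u)) / norm (h n *\<^sub>R u))) \<longlonglongrightarrow> norm u * 0"
    by (intro tendsto_intros)
  moreover have "norm u * (norm (g (x + h n *\<^sub>R u) - g x - D (h n *\<^sub>R u)) / norm (h n *\<^sub>R u))
      = norm ((1 / h n) *\<^sub>R (g (x + h n *\<^sub>R u) - g x) - D u)" for n
  proof -
    have "(1 / h n) *\<^sub>R (g (x + h n *\<^sub>R u) - g x) - D u
        = (1 / h n) *\<^sub>R (g (x + h n *\<^sub>R u) - g x - D (h n *\<^sub>R u))"
      using h(2)[of n] by (simp add: scale algebra_simps)
    then show ?thesis using False h(2)[of n] by simp
  qed
  ultimately show ?thesis by (simp add: tendsto_norm_zero_iff LIM_zero_cancel)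
qed

lemma tendsto_inverse_Suc: "(\<lambda>n. c / real (Suc n)) \<longlonglongrightarrow> 0"
  using tendsto_mult[OF tendsto_const[of c] LIMSEQ_inverse_real_of_nat] by (simp add: field_simps)

text \<open>Both sequences of steps stay in the strip, so every derivative within it, one-sided on
  the edges, is recovered by \<open>dq\<close> and \<open>dp\<close>. Existentially given partial
  derivatives can then be replaced by these canonical ones.\<close>

lemma
  assumes D: "(g has_derivative D) (at x within strip)" and x: "x \<in> strip"
  shows diffquot_q: "(\<lambda>n. real (Suc n) *\<^sub>R (g (x + (1 / real (Suc n), 0)) - g x)) \<longlonglongrightarrow> D (1, 0)"
    and diffquot_p: "(\<lambda>n. (inward (snd x) * real (Suc n)) *\<^sub>R
      (g (x + (0, inward (snd x) / real (Suc n))) - g x)) \<longlonglongrightarrow> D (0, 1)"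
    and dq_eq: "dq g x = D (1, 0)" and dp_eq: "dp g x = D (0, 1)"
proof -
  show 1: "(\<lambda>n. real (Suc n) *\<^sub>R (g (x + (1 / real (Suc n), 0)) - g x)) \<longlonglongrightarrow> D (1, 0)"
    using has_derivative_imp_diffquot[OF D, of "\<lambda>n. 1 / real (Suc n)" "(1, 0)"] x
      tendsto_inverse_Suc[of 1] by simp
  have i: "1 / inward p = inward p" "inward p \<noteq> 0" for p by (auto simp: inward_def)
  have "(\<lambda>n. (1 / (inward (snd x) / real (Suc n))) *\<^sub>R
      (g (x + (inward (snd x) / real (Suc n)) *\<^sub>R (0, 1)) - g x)) \<longlonglongrightarrow> D (0, 1)"
    by (rule has_derivative_imp_diffquot[OF D])
      (use inward_mem_strip[OF x] tendsto_inverse_Suc i in auto)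
  moreover have "1 / (inward (snd x) / real (Suc n)) = inward (snd x) * real (Suc n)" for n
    by (simp add: inward_def)
  ultimately show 2: "(\<lambda>n. (inward (snd x) * real (Suc n)) *\<^sub>R
      (g (x + (0, inward (snd x) / real (Suc n))) - g x)) \<longlonglongrightarrow> D (0, 1)"
    by (simp add: scaleR_Pair)
  show "dq g x = D (1, 0)" unfolding dq_def using 1 by (rule limI)
  show "dp g x = D (0, 1)" unfolding dp_def using 2 by (rule limI)
qed

definition pdiff :: "(real \<times> real \<Rightarrow> 'b::real_normed_vector) \<Rightarrow> bool" where
  "pdiff g \<longleftrightarrow> (\<forall>x\<in>strip. (g has_derivative (\<lambda>(u, v). u *\<^sub>R dq g x + v *\<^sub>R dp g x)) (at x within strip))"

lemma pdiffD: "pdiff g \<Longrightarrow> x \<in> strip \<Longrightarrow>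
    (g has_derivative (\<lambda>(u, v). u *\<^sub>R dq g x + v *\<^sub>R dp g x)) (at x within strip)"
  by (auto simp: pdiff_def)

lemma Cr_bounded_cong:
  assumes "Cr_bounded r K f" "\<And>x. x \<in> strip \<Longrightarrow> f x = g x"
  shows "Cr_bounded r K g"
proof (cases r)
  case 0
  then show ?thesis using assms by (auto cong: continuous_on_cong)
next
  case (Suc r')
  have *: "(g has_derivative D) (at x within strip)" if "(f has_derivative D) (at x within strip)" "x \<in> strip" for x D
    using has_derivative_transform[OF that(2) _ that(1)] assms(2) by metis
  obtain g1 g2 where g: "\<And>x. x \<in> strip \<Longrightarrow> (f has_derivative (\<lambda>(u, v). u *\<^sub>R g1 x + v *\<^sub>R g2 x)) (at x within strip)"
    "Cr_bounded r' K g1" "Cr_bounded r' K g2" "\<And>x. x \<in> strip \<Longrightarrow> norm (f x) \<le> K"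
    using assms(1) unfolding Suc by auto
  have "\<forall>x\<in>strip. (g has_derivative (\<lambda>(u, v). u *\<^sub>R g1 x + v *\<^sub>R g2 x)) (at x within strip)"
    using *[OF g(1)] by blast
  moreover have "\<forall>x\<in>strip. norm (g x) \<le> K" using g(4) assms(2) by simp
  ultimately show ?thesis using g(2,3) unfolding Suc Cr_bounded.simps by blast
qed

lemma Cr_bounded_norm: "Cr_bounded r K g \<Longrightarrow> x \<in> strip \<Longrightarrow> norm (g x) \<le> K"
  by (cases r) auto

lemma Cr_bounded_Suc_D:
  assumes "Cr_bounded (Suc r) K g"
  shows "pdiff g" "Cr_bounded r K (dq g)" "Cr_bounded r K (dp g)"
proof -
  obtain g1 g2 where g: "\<And>x. x \<in> strip \<Longrightarrow> (g has_derivative (\<lambda>(u, v). u *\<^sub>R g1 x + v *\<^sub>R g2 x)) (at x within strip)"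
    "Cr_bounded r K g1" "Cr_bounded r K g2" using assms by auto
  have e: "dq g x = g1 x" "dp g x = g2 x" if "x \<in> strip" for x
    using dq_eq[OF g(1)[OF that] that] dp_eq[OF g(1)[OF that] that] by auto
  then show "pdiff g" using g by (auto simp: pdiff_def)
  show "Cr_bounded r K (dq g)" by (rule Cr_bounded_cong[OF g(2)]) (simp add: e)
  show "Cr_bounded r K (dp g)" by (rule Cr_bounded_cong[OF g(3)]) (simp add: e)
qed

lemma pdiff_continuous: "pdiff g \<Longrightarrow> continuous_on strip g"
  by (rule has_derivative_continuous_on) (rule pdiffD)

lemma Cr_bounded_continuous: "Cr_bounded r K g \<Longrightarrow> continuous_on strip g"
  by (cases r) (simp, metis Cr_bounded_Suc_D(1) pdiff_continuous)

declare Cr_bounded.simps [simp del]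

lemma Cr_bounded_Suc_le: "Cr_bounded (Suc r) K g \<Longrightarrow> Cr_bounded r K g"
proof (induction r arbitrary: g)
  case 0
  then show ?case
    using Cr_bounded_continuous[OF 0] Cr_bounded_norm[OF 0] by (simp add: Cr_bounded.simps(1))
next
  case (Suc r)
  note D = Cr_bounded_Suc_D[OF Suc.prems]
  have "\<forall>x\<in>strip. norm (g x) \<le> K" using Cr_bounded_norm[OF Suc.prems] by blast
  then show ?case
    unfolding Cr_bounded.simps(2)
    using pdiffD[OF D(1)] Suc.IH[OF D(2)] Suc.IH[OF D(3)] by blast
qed

lemma Cr_bounded_mono: "m \<le> n \<Longrightarrow> Cr_bounded n K g \<Longrightarrow> Cr_bounded m K g"
  by (induction n rule: dec_induct) (auto dest: Cr_bounded_Suc_le)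

lemma pdiff_shift:
  assumes "pdiff g" "x \<in> strip"
  shows "((\<lambda>y. g (y + (a, 0))) has_derivative
      (\<lambda>(u, v). u *\<^sub>R dq g (x + (a, 0)) + v *\<^sub>R dp g (x + (a, 0)))) (at x within strip)"
proof -
  have "((\<lambda>y. y + (a, 0)) has_derivative (\<lambda>h. h)) (at x within strip)"
    by (auto intro!: derivative_eq_intros)
  moreover have "(\<lambda>y. y + (a, 0)) ` strip \<subseteq> strip" by (auto simp: strip_iff)
  ultimately show ?thesis using has_derivative_in_compose2[OF pdiffD[OF assms(1)]] assms(2) by blast
qed

text \<open>Mean value inequality on the convex strip; the factor 2 comes from bounding the
  derivative by the sum of the two partials.\<close>

lemma pdiff_lipschitz:
  assumes "pdiff g" and K: "\<And>x. x \<in> strip \<Longrightarrow> norm (dq g x) \<le> K" "\<And>x. x \<in> strip \<Longrightarrow> norm (dp g x) \<le> K"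
    and xy: "x \<in> strip" "y \<in> strip"
  shows "norm (g x - g y) \<le> 2 * K * norm (x - y)"
proof (rule differentiable_bound[OF convex_strip pdiffD[OF assms(1)] _ xy])
  fix z assume z: "z \<in> strip"
  have K0: "K \<ge> 0" using K(1)[OF z] norm_ge_zero order_trans by blast
  show "onorm (\<lambda>(u, v). u *\<^sub>R dq g z + v *\<^sub>R dp g z) \<le> 2 * K"
  proof (rule onorm_bound)
    fix w :: "real \<times> real"
    obtain u v where w: "w = (u, v)" by (cases w)
    have "norm (u *\<^sub>R dq g z + v *\<^sub>R dp g z) \<le> \<bar>u\<bar> * norm (dq g z) + \<bar>v\<bar> * norm (dp g z)"
      by (metis norm_scaleR norm_triangle_ineq)
    also have "\<dots> \<le> norm w * K + norm w * K"
      using norm_fst_le[of u v] norm_snd_le[of v u] K[OF z] w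
      by (intro add_mono mult_mono) auto
    finally show "norm (case w of (u, v) \<Rightarrow> u *\<^sub>R dq g z + v *\<^sub>R dp g z) \<le> 2 * K * norm w"
      by (simp add: w algebra_simps)
  qed (use K0 in auto)
qed

text \<open>Converse of the mean value inequality: the difference quotients that converge to the
  partials are bounded by \<open>C\<close>. It turns Lipschitz estimates of time differences into
  estimates of their derivatives.\<close>

lemma lipschitz_imp_partials_le:
  assumes D: "(w has_derivative D) (at x within strip)" and x: "x \<in> strip"
    and L: "\<And>y. y \<in> strip \<Longrightarrow> norm (w y - w x) \<le> C * norm (y - x)"
  shows "norm (D (1, 0)) \<le> C" "norm (D (0, 1)) \<le> C"
proof -
  have 1: "norm (real (Suc n) *\<^sub>R (w (x + (1 / real (Suc n), 0)) - w x)) \<le> C" for n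
  proof -
    have "norm (w (x + (1 / real (Suc n), 0)) - w x) \<le> C * (1 / real (Suc n))"
      using L[of "x + (1 / real (Suc n), 0)"] x by (simp add: norm_Pair del: of_nat_Suc)
    then show ?thesis by (simp add: pos_le_divide_eq mult.commute del: of_nat_Suc)
  qed
  show "norm (D (1, 0)) \<le> C"
    using tendsto_norm[OF diffquot_q[OF D x]] 1 by (rule LIMSEQ_le_const2[OF _ exI, rule_format])
  have "\<bar>inward p\<bar> = 1" for p by (auto simp: inward_def)
  then have 2: "norm ((inward (snd x) * real (Suc n)) *\<^sub>R
      (w (x + (0, inward (snd x) / real (Suc n))) - w x)) \<le> C" for n
  proof -
    have "norm (w (x + (0, inward (snd x) / real (Suc n))) - w x) \<le> C * (1 / real (Suc n))"
      using L[OF inward_mem_strip[OF x, of n]] \<open>\<And>p. \<bar>inward p\<bar> = 1\<close>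
      by (simp add: norm_Pair del: of_nat_Suc)
    then show ?thesis using \<open>\<And>p. \<bar>inward p\<bar> = 1\<close>
      by (simp add: pos_le_divide_eq mult.commute abs_mult del: of_nat_Suc)
  qed
  show "norm (D (0, 1)) \<le> C"
    using tendsto_norm[OF diffquot_p[OF D x]] 2 by (rule LIMSEQ_le_const2[OF _ exI, rule_format])
qed

section \<open>Lipschitz dependence of spatial derivatives on time\<close>

lemma has_vector_derivative_bound:
  fixes g :: "real \<Rightarrow> 'b::real_normed_vector"
  assumes "\<And>t. t \<in> {a..b} \<Longrightarrow> (g has_vector_derivative g' t) (at t within {a..b})"
    and "\<And>t. t \<in> {a..b} \<Longrightarrow> norm (g' t) \<le> C" and st: "s \<in> {a..b}" "t \<in> {a..b}"
  shows "norm (g s - g t) \<le> C * \<bar>s - t\<bar>"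
proof -
  have "onorm (\<lambda>h. h *\<^sub>R g' u) \<le> C" if "u \<in> {a..b}" for u
    using assms(2)[OF that] order_trans[OF norm_ge_zero assms(2)[OF that]]
    by (intro onorm_bound) (auto simp: mult.commute[of C] intro: mult_left_mono)
  from differentiable_bound[OF convex_closed_interval assms(1)[unfolded has_vector_derivative_def] this st]
  show ?thesis by (simp add: real_norm_def)
qed

text \<open>
  The time derivative and the spatial derivatives cannot be interchanged, since the velocity need
  not be continuous in time; Lipschitz bounds in time for the derivatives of \<open>e\<close> are therefore
  obtained by applying the mean value theorem in time to first and second differences of \<open>e\<close>.
\<close>

locale Cr_path =
  fixes e v :: "real \<Rightarrow> real \<times> real \<Rightarrow> real \<times> real" and K :: real
  assumes vel: "\<And>t x. t \<in> {0..1} \<Longrightarrow> x \<in> strip \<Longrightarrow>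
      ((\<lambda>s. e s x) has_vector_derivative v t x) (at t within {0..1})"
    and e_Cr: "\<And>t. t \<in> {0..1} \<Longrightarrow> Cr_bounded 3 K (e t)"
    and v_Cr: "\<And>t. t \<in> {0..1} \<Longrightarrow> Cr_bounded 2 K (v t)"
begin

lemma e_D:
  assumes "t \<in> {0..1}"
  shows "pdiff (e t)" "pdiff (dq (e t))" "pdiff (dp (e t))"
    "pdiff (dq (dq (e t)))" "pdiff (dq (dp (e t)))"
    and "x \<in> strip \<Longrightarrow> norm (e t x) \<le> K" "x \<in> strip \<Longrightarrow> norm (dq (e t) x) \<le> K"
    "x \<in> strip \<Longrightarrow> norm (dp (e t) x) \<le> K" "x \<in> strip \<Longrightarrow> norm (dq (dq (e t)) x) \<le> K"
    "x \<in> strip \<Longrightarrow> norm (dq (dp (e t)) x) \<le> K"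
    "x \<in> strip \<Longrightarrow> norm (dp (dq (e t)) x) \<le> K" "x \<in> strip \<Longrightarrow> norm (dp (dp (e t)) x) \<le> K"
    "x \<in> strip \<Longrightarrow> norm (dq (dq (dq (e t))) x) \<le> K" "x \<in> strip \<Longrightarrow> norm (dp (dq (dq (e t))) x) \<le> K"
    "x \<in> strip \<Longrightarrow> norm (dq (dq (dp (e t))) x) \<le> K" "x \<in> strip \<Longrightarrow> norm (dp (dq (dp (e t))) x) \<le> K"
proof -
  note C = e_Cr[OF assms, unfolded numeral_3_eq_3]
  note C1 = Cr_bounded_Suc_D[OF C]
  note C2 = Cr_bounded_Suc_D[OF C1(2)] Cr_bounded_Suc_D[OF C1(3)]
  note C3 = Cr_bounded_Suc_D[OF C2(2)] Cr_bounded_Suc_D[OF C2(5)]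
  show "pdiff (e t)" "pdiff (dq (e t))" "pdiff (dp (e t))"
    "pdiff (dq (dq (e t)))" "pdiff (dq (dp (e t)))" by (fact C1 C2 C3)+
  show "x \<in> strip \<Longrightarrow> norm (e t x) \<le> K" "x \<in> strip \<Longrightarrow> norm (dq (e t) x) \<le> K"
    "x \<in> strip \<Longrightarrow> norm (dp (e t) x) \<le> K" "x \<in> strip \<Longrightarrow> norm (dq (dq (e t)) x) \<le> K"
    "x \<in> strip \<Longrightarrow> norm (dq (dp (e t)) x) \<le> K"
    "x \<in> strip \<Longrightarrow> norm (dp (dq (e t)) x) \<le> K" "x \<in> strip \<Longrightarrow> norm (dp (dp (e t)) x) \<le> K"
    "x \<in> strip \<Longrightarrow> norm (dq (dq (dq (e t))) x) \<le> K" "x \<in> strip \<Longrightarrow> norm (dp (dq (dq (e t))) x) \<le> K"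
    "x \<in> strip \<Longrightarrow> norm (dq (dq (dp (e t))) x) \<le> K" "x \<in> strip \<Longrightarrow> norm (dp (dq (dp (e t))) x) \<le> K"
    by (rule Cr_bounded_norm, rule C C1 C2 C3, assumption)+
qed

lemma v_D:
  assumes "t \<in> {0..1}"
  shows "pdiff (v t)" "pdiff (dq (v t))" "pdiff (dp (v t))"
    and "x \<in> strip \<Longrightarrow> norm (v t x) \<le> K" "x \<in> strip \<Longrightarrow> norm (dq (v t) x) \<le> K"
    "x \<in> strip \<Longrightarrow> norm (dp (v t) x) \<le> K" "x \<in> strip \<Longrightarrow> norm (dq (dq (v t)) x) \<le> K"
    "x \<in> strip \<Longrightarrow> norm (dq (dp (v t)) x) \<le> K"
    "x \<in> strip \<Longrightarrow> norm (dp (dq (v t)) x) \<le> K" "x \<in> strip \<Longrightarrow> norm (dp (dp (v t)) x) \<le> K"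
proof -
  note C = v_Cr[OF assms, unfolded numeral_2_eq_2]
  note C1 = Cr_bounded_Suc_D[OF C]
  note C2 = Cr_bounded_Suc_D[OF C1(2)] Cr_bounded_Suc_D[OF C1(3)]
  show "pdiff (v t)" "pdiff (dq (v t))" "pdiff (dp (v t))" by (fact C1 C2)+
  show "x \<in> strip \<Longrightarrow> norm (v t x) \<le> K" "x \<in> strip \<Longrightarrow> norm (dq (v t) x) \<le> K"
    "x \<in> strip \<Longrightarrow> norm (dp (v t) x) \<le> K" "x \<in> strip \<Longrightarrow> norm (dq (dq (v t)) x) \<le> K"
    "x \<in> strip \<Longrightarrow> norm (dq (dp (v t)) x) \<le> K"
    "x \<in> strip \<Longrightarrow> norm (dp (dq (v t)) x) \<le> K" "x \<in> strip \<Longrightarrow> norm (dp (dp (v t)) x) \<le> K"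
    by (rule Cr_bounded_norm, rule C C1 C2, assumption)+
qed

context
  fixes s t :: real assumes st: "s \<in> {0..1}" "t \<in> {0..1}"
begin

lemma time_lip_0: "x \<in> strip \<Longrightarrow> norm (e s x - e t x) \<le> K * \<bar>s - t\<bar>"
  using has_vector_derivative_bound[of 0 1 "\<lambda>s. e s x" "\<lambda>s. v s x" K s t] vel v_D(4) st by auto

lemma time_lip_1:
  assumes x: "x \<in> strip" and y: "y \<in> strip"
  shows "norm ((e s y - e t y) - (e s x - e t x)) \<le> 2 * K * \<bar>s - t\<bar> * norm (y - x)"
proof -
  have "norm ((e s y - e s x) - (e t y - e t x)) \<le> (2 * K * norm (y - x)) * \<bar>s - t\<bar>"
    by (rule has_vector_derivative_bound[where g = "\<lambda>s. e s y - e s x" and g' = "\<lambda>s. v s y - v s x", OF _ _ st])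
      (intro has_vector_derivative_diff vel x y pdiff_lipschitz v_D; assumption)+
  then show ?thesis by (simp add: algebra_simps)
qed

text \<open>A mixed difference, twice in space and once in time. It costs two derivatives of the
  velocity: the shift by \<open>a\<close> uses the Lipschitz bound of its first partials, the
  passage from \<open>x\<close> to \<open>y\<close> the mean value inequality for the shifted
  difference. The factor 8 is generous.\<close>

lemma time_lip_shift:
  fixes a :: real
  assumes x: "x \<in> strip" and y: "y \<in> strip"
  defines "w \<equiv> \<lambda>f (y :: real \<times> real). f (y + (a, 0)) - f y :: real \<times> real"
  shows "norm ((w (e s) y - w (e t) y) - (w (e s) x - w (e t) x)) \<le> 8 * K * \<bar>a\<bar> * \<bar>s - t\<bar> * norm (y - x)"
proof -
  have w_lip: "norm (w (v r) y - w (v r) x) \<le> 8 * K * \<bar>a\<bar> * norm (y - x)" if r: "r \<in> {0..1}" for r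
  proof -
    have d: "(w (v r) has_derivative (\<lambda>(h, k). h *\<^sub>R (w (dq (v r)) z) + k *\<^sub>R (w (dp (v r)) z))) (at z within strip)"
      if "z \<in> strip" for z
    proof -
      have "(w (v r) has_derivative
          (\<lambda>h. (\<lambda>(u, v'). u *\<^sub>R dq (v r) (z + (a, 0)) + v' *\<^sub>R dp (v r) (z + (a, 0))) h
            - (\<lambda>(u, v'). u *\<^sub>R dq (v r) z + v' *\<^sub>R dp (v r) z) h)) (at z within strip)"
        unfolding w_def using pdiff_shift[OF v_D(1)[OF r] that] pdiffD[OF v_D(1)[OF r] that]
        by (rule has_derivative_diff)
      then show ?thesis by (rule has_derivative_eq_rhs) (auto simp: w_def algebra_simps)
    qed
    have p: "pdiff (w (v r))" "z \<in> strip \<Longrightarrow> dq (w (v r)) z = w (dq (v r)) z"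
      "z \<in> strip \<Longrightarrow> dp (w (v r)) z = w (dp (v r)) z" for z
      using dq_eq[OF d] dp_eq[OF d] d by (simp_all add: pdiff_def)
    have b: "norm (w (dq (v r)) z) \<le> 4 * K * \<bar>a\<bar>" "norm (w (dp (v r)) z) \<le> 4 * K * \<bar>a\<bar>" if "z \<in> strip" for z
    proof -
      have "norm (w (dq (v r)) z) \<le> 2 * K * \<bar>a\<bar>" "norm (w (dp (v r)) z) \<le> 2 * K * \<bar>a\<bar>"
        using pdiff_lipschitz[OF v_D(2)[OF r], of K "z + (a, 0)" z] pdiff_lipschitz[OF v_D(3)[OF r], of K "z + (a, 0)" z]
          v_D[OF r] that by (auto simp: w_def norm_Pair)
      moreover have "0 \<le> K * \<bar>a\<bar>"
        using order_trans[OF norm_ge_zero v_D(4)[OF r that]] by simp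
      ultimately show "norm (w (dq (v r)) z) \<le> 4 * K * \<bar>a\<bar>" "norm (w (dp (v r)) z) \<le> 4 * K * \<bar>a\<bar>"
        by linarith+
    qed
    show ?thesis
      using pdiff_lipschitz[OF p(1), of "4 * K * \<bar>a\<bar>" y x] p(2,3) b x y by simp
  qed
  have "norm ((w (e s) y - w (e s) x) - (w (e t) y - w (e t) x)) \<le> (8 * K * \<bar>a\<bar> * norm (y - x)) * \<bar>s - t\<bar>"
    by (rule has_vector_derivative_bound[where g = "\<lambda>s. w (e s) y - w (e s) x" and g' = "\<lambda>s. w (v s) y - w (v s) x", OF _ _ st])
      (unfold w_def, intro has_vector_derivative_diff vel x y, simp_all add: x y w_lip[unfolded w_def])
  then show ?thesis by (simp add: algebra_simps)
qed

lemma time_lip_d1: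
  assumes x: "x \<in> strip"
  shows "norm (dq (e s) x - dq (e t) x) \<le> 2 * K * \<bar>s - t\<bar>" "norm (dp (e s) x - dp (e t) x) \<le> 2 * K * \<bar>s - t\<bar>"
  using lipschitz_imp_partials_le[OF has_derivative_diff[OF pdiffD[OF e_D(1)[OF st(1)] x] pdiffD[OF e_D(1)[OF st(2)] x]] x
      time_lip_1[OF x]] by auto

lemma time_lip_d1_shift:
  assumes x: "x \<in> strip" and g: "g = dq \<or> g = dp"
  shows "norm ((g (e s) (x + (a, 0)) - g (e t) (x + (a, 0))) - (g (e s) x - g (e t) x)) \<le> 8 * K * \<bar>a\<bar> * \<bar>s - t\<bar>"
proof -
  note D = has_derivative_diff[OF
      has_derivative_diff[OF pdiff_shift[OF e_D(1)[OF st(1)] x, of a] pdiffD[OF e_D(1)[OF st(1)] x]]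
      has_derivative_diff[OF pdiff_shift[OF e_D(1)[OF st(2)] x, of a] pdiffD[OF e_D(1)[OF st(2)] x]]]
  show ?thesis
    using lipschitz_imp_partials_le[OF D x time_lip_shift[OF x]] g by (auto simp: algebra_simps)
qed

text \<open>The bound for shifts, divided by a = 1 / (n + 1), survives the limit. Only q-derivatives
  of the first partials are treated: these are the second derivatives that occur in
  \<open>densq\<close>.\<close>

lemma time_lip_d2:
  assumes x: "x \<in> strip"
  shows "norm (dq (dq (e s)) x - dq (dq (e t)) x) \<le> 8 * K * \<bar>s - t\<bar>"
    "norm (dq (dp (e s)) x - dq (dp (e t)) x) \<le> 8 * K * \<bar>s - t\<bar>"
proof -
  have *: "norm (dq (g (e s)) x - dq (g (e t)) x) \<le> 8 * K * \<bar>s - t\<bar>"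
    if g: "g = dq \<or> g = dp" and p: "pdiff (g (e s))" "pdiff (g (e t))" for g
  proof -
    define w where "w = (\<lambda>y. g (e s) y - g (e t) y)"
    have D: "(w has_derivative (\<lambda>h. (\<lambda>(u, v'). u *\<^sub>R dq (g (e s)) x + v' *\<^sub>R dp (g (e s)) x) h
            - (\<lambda>(u, v'). u *\<^sub>R dq (g (e t)) x + v' *\<^sub>R dp (g (e t)) x) h)) (at x within strip)"
      unfolding w_def using p x by (intro has_derivative_diff pdiffD)
    have "norm (real (Suc n) *\<^sub>R (w (x + (1 / real (Suc n), 0)) - w x)) \<le> 8 * K * \<bar>s - t\<bar>" for n
    proof -
      have "norm (w (x + (1 / real (Suc n), 0)) - w x) \<le> 8 * K * \<bar>s - t\<bar> * (1 / real (Suc n))"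
        using time_lip_d1_shift[OF x g, of "1 / real (Suc n)"] by (simp add: w_def del: of_nat_Suc)
      then show ?thesis by (simp add: pos_le_divide_eq mult.commute del: of_nat_Suc)
    qed
    then have "norm (dq (g (e s)) x - dq (g (e t)) x) \<le> 8 * K * \<bar>s - t\<bar>"
      using tendsto_norm[OF diffquot_q[OF D x]] by (intro LIMSEQ_le_const2) auto
    then show ?thesis .
  qed
  show "norm (dq (dq (e s)) x - dq (dq (e t)) x) \<le> 8 * K * \<bar>s - t\<bar>"
    "norm (dq (dp (e s)) x - dq (dp (e t)) x) \<le> 8 * K * \<bar>s - t\<bar>"
    using *[of dq] *[of dp] e_D(2,3) st by auto
qed

end
end

section \<open>Bounded Lipschitz families\<close>

text \<open>One constant bounds the functions and their joint Lipschitz constant in time and space,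
  for all indices together; the index will be \<omega>. Positivity of \<open>C\<close> spares sign
  conditions in products.\<close>

definition BLC :: "real \<Rightarrow> ('i \<Rightarrow> real \<Rightarrow> real \<times> real \<Rightarrow> real) \<Rightarrow> bool" where
  "BLC C f \<longleftrightarrow> C > 0 \<and> (\<forall>i. \<forall>t\<in>{0..1}. \<forall>x\<in>strip. \<bar>f i t x\<bar> \<le> C \<and>
     (\<forall>s\<in>{0..1}. \<forall>y\<in>strip. \<bar>f i t x - f i s y\<bar> \<le> C * (\<bar>t - s\<bar> + norm (x - y))))"

lemma BLC_D:
  assumes "BLC C f"
  shows "C > 0" "\<And>i t x. t \<in> {0..1} \<Longrightarrow> x \<in> strip \<Longrightarrow> \<bar>f i t x\<bar> \<le> C"
    "\<And>i t x s y. t \<in> {0..1} \<Longrightarrow> x \<in> strip \<Longrightarrow> s \<in> {0..1} \<Longrightarrow> y \<in> strip \<Longrightarrow>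
      \<bar>f i t x - f i s y\<bar> \<le> C * (\<bar>t - s\<bar> + norm (x - y))"
  using assms unfolding BLC_def by blast+

definition BL :: "('i \<Rightarrow> real \<Rightarrow> real \<times> real \<Rightarrow> real) \<Rightarrow> bool" where
  "BL f \<longleftrightarrow> (\<exists>C. BLC C f)"

lemma BL_I:
  fixes f :: "'i \<Rightarrow> real \<Rightarrow> real \<times> real \<Rightarrow> real"
  assumes "\<And>i t x. t \<in> {0..1} \<Longrightarrow> x \<in> strip \<Longrightarrow> \<bar>f i t x\<bar> \<le> A"
    "\<And>i t x s y. t \<in> {0..1} \<Longrightarrow> x \<in> strip \<Longrightarrow> s \<in> {0..1} \<Longrightarrow> y \<in> strip \<Longrightarrow>
      \<bar>f i t x - f i s y\<bar> \<le> B * (\<bar>t - s\<bar> + norm (x - y))"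
  shows "BL f"
  unfolding BL_def BLC_def
proof (intro exI[of _ "max 1 (max A B)"] allI ballI conjI)
  fix i :: 'i and t s :: real and x y :: "real \<times> real"
  assume *: "t \<in> {0..1}" "x \<in> strip"
  show "\<bar>f i t x\<bar> \<le> max 1 (max A B)" using assms(1)[OF *, of i] by linarith
  assume **: "s \<in> {0..1}" "y \<in> strip"
  have "\<bar>f i t x - f i s y\<bar> \<le> B * (\<bar>t - s\<bar> + norm (x - y))" by (rule assms(2)[OF * **])
  also have "\<dots> \<le> max 1 (max A B) * (\<bar>t - s\<bar> + norm (x - y))" by (intro mult_right_mono) auto
  finally show "\<bar>f i t x - f i s y\<bar> \<le> max 1 (max A B) * (\<bar>t - s\<bar> + norm (x - y))" .
qed simp

lemma BL_cong:
  assumes "BL f" "\<And>i t x. t \<in> {0..1} \<Longrightarrow> x \<in> strip \<Longrightarrow> f i t x = g i t x"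
  shows "BL g"
  using assms unfolding BL_def BLC_def by metis

lemma BL_const: "BL (\<lambda>i t x. c)"
  by (rule BL_I[where A = "\<bar>c\<bar>" and B = 0]) auto

lemma BL_add:
  assumes "BL f" "BL g"
  shows "BL (\<lambda>i t x. f i t x + g i t x)"
proof -
  obtain C D where "BLC C f" "BLC D g" using assms by (auto simp: BL_def)
  note C = BLC_D(2,3)[OF this(1)] and D = BLC_D(2,3)[OF this(2)]
  show ?thesis
  proof (rule BL_I[where A = "C + D" and B = "C + D"])
    fix i t and s :: real and x y assume *: "t \<in> {0..1::real}" "x \<in> strip"
    show "\<bar>f i t x + g i t x\<bar> \<le> C + D" using C(1)[OF *, of i] D(1)[OF *, of i] by linarith
    assume **: "s \<in> {0..1}" "y \<in> strip"
    show "\<bar>f i t x + g i t x - (f i s y + g i s y)\<bar> \<le> (C + D) * (\<bar>t - s\<bar> + norm (x - y))"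
      using C(2)[OF * **, of i] D(2)[OF * **, of i] unfolding distrib_right[of C D] by linarith
  qed
qed

lemma BL_mult:
  assumes "BL f" "BL g"
  shows "BL (\<lambda>i t x. f i t x * g i t x)"
proof -
  obtain C where "BLC C f" using assms(1) by (auto simp: BL_def)
  note C = BLC_D[OF this]
  obtain D where "BLC D g" using assms(2) by (auto simp: BL_def)
  note D = BLC_D[OF this]
  show ?thesis
  proof (rule BL_I[where A = "C * D" and B = "2 * C * D"])
    fix i t and s :: real and x y assume *: "t \<in> {0..1::real}" "x \<in> strip"
    show "\<bar>f i t x * g i t x\<bar> \<le> C * D" 
      using C(1) C(2)[OF *, of i] D(2)[OF *, of i] by (simp add: abs_mult mult_mono)
    assume **: "s \<in> {0..1}" "y \<in> strip"
    have "\<bar>f i t x * g i t x - f i s y * g i s y\<bar> = \<bar>f i t x * (g i t x - g i s y) + (f i t x - f i s y) * g i s y\<bar>"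
      by (simp add: algebra_simps)
    also have "\<dots> \<le> \<bar>f i t x\<bar> * \<bar>g i t x - g i s y\<bar> + \<bar>f i t x - f i s y\<bar> * \<bar>g i s y\<bar>"
      by (metis abs_mult abs_triangle_ineq)
    also have "\<dots> \<le> C * (D * (\<bar>t - s\<bar> + norm (x - y))) + (C * (\<bar>t - s\<bar> + norm (x - y))) * D"
      using C(1) D(1) C(2)[OF *, of i] D(2)[OF **, of i] C(3)[OF * **, of i] D(3)[OF * **, of i]
      by (intro add_mono mult_mono) auto
    finally show "\<bar>f i t x * g i t x - f i s y * g i s y\<bar> \<le> 2 * C * D * (\<bar>t - s\<bar> + norm (x - y))"
      by (simp add: algebra_simps)
  qed
qed

lemma BL_diff: "BL f \<Longrightarrow> BL g \<Longrightarrow> BL (\<lambda>i t x. f i t x - g i t x)"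
  using BL_add[OF _ BL_mult[OF BL_const[of "-1"]], of f g] by simp

lemma BL_inverse:
  assumes "BL f" and d: "d > 0" "\<And>i t x. t \<in> {0..1} \<Longrightarrow> x \<in> strip \<Longrightarrow> d \<le> f i t x"
  shows "BL (\<lambda>i t x. inverse (f i t x))"
proof -
  obtain C where "BLC C f" using assms(1) by (auto simp: BL_def)
  note C = BLC_D[OF this]
  show ?thesis
  proof (rule BL_I[where A = "1 / d" and B = "C / (d * d)"])
    fix i t and s :: real and x y assume *: "t \<in> {0..1::real}" "x \<in> strip"
    note f1 = d(2)[OF *, of i]
    show "\<bar>inverse (f i t x)\<bar> \<le> 1 / d" using d(1) f1 by (simp add: divide_simps)
    assume **: "s \<in> {0..1}" "y \<in> strip"
    note f2 = d(2)[OF **, of i]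
    have "\<bar>inverse (f i t x) - inverse (f i s y)\<bar> = \<bar>f i t x - f i s y\<bar> / (f i t x * f i s y)"
      using d(1) f1 f2 by (simp add: field_simps abs_if)
    also have "\<dots> \<le> (C * (\<bar>t - s\<bar> + norm (x - y))) / (d * d)"
      using d(1) f1 f2 C(1) by (intro frac_le mult_mono C(3)[OF * **]) auto
    finally show "\<bar>inverse (f i t x) - inverse (f i s y)\<bar> \<le> C / (d * d) * (\<bar>t - s\<bar> + norm (x - y))"
      by simp
  qed
qed

lemma BL_divide:
  assumes "BL g" "BL f" "d > 0" "\<And>i t x. t \<in> {0..1} \<Longrightarrow> x \<in> strip \<Longrightarrow> d \<le> f i t x"
  shows "BL (\<lambda>i t x. g i t x / f i t x)"
  using BL_mult[OF assms(1) BL_inverse[OF assms(2-4)]] by (simp add: field_simps)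

lemma BL_top:
  assumes "BL f"
  shows "BL (\<lambda>i t x. f i t (fst x, 1))"
proof -
  obtain C where "BLC C f" using assms(1) by (auto simp: BL_def)
  note C = BLC_D[OF this]
  show ?thesis
  proof (rule BL_I[where A = C and B = C])
    fix i t and s :: real and x y :: "real \<times> real" assume *: "t \<in> {0..1::real}" 
    have m: "(fst z, 1) \<in> strip" for z :: "real \<times> real" by (simp add: strip_iff)
    show "\<bar>f i t (fst x, 1)\<bar> \<le> C" by (rule C(2)[OF * m])
    assume **: "s \<in> {0..1}"
    have "\<bar>f i t (fst x, 1) - f i s (fst y, 1)\<bar> \<le> C * (\<bar>t - s\<bar> + norm ((fst x, 1) - (fst y, 1::real)))"
      by (rule C(3)[OF * m ** m])
    also have "\<dots> \<le> C * (\<bar>t - s\<bar> + norm (x - y))"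
    proof -
      have "norm (fst (x - y)) \<le> norm (x - y)" by (metis norm_fst_le prod.collapse)
      then show ?thesis using C(1) by (simp add: norm_Pair)
    qed
    finally show "\<bar>f i t (fst x, 1) - f i s (fst y, 1)\<bar> \<le> C * (\<bar>t - s\<bar> + norm (x - y))" .
  qed
qed

lemma BL_continuous:
  assumes "BL f" "t \<in> {0..1}"
  shows "continuous_on strip (f i t)"
proof -
  obtain C where "BLC C f" using assms(1) by (auto simp: BL_def)
  note C = BLC_D[OF this]
  have "C-lipschitz_on strip (f i t)"
    using C(1) C(3)[of t _ t] assms(2) by (intro lipschitz_onI) (auto simp: dist_norm)
  then show ?thesis by (rule lipschitz_on_continuous_on)
qed

lemma BL_line:
  assumes "BL f" "t \<in> {0..1}"
  shows "continuous_on {-1..1} (\<lambda>p. f i t (q, p))"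
  by (rule continuous_on_compose2[OF BL_continuous[OF assms]])
    (auto intro!: continuous_intros simp: strip_iff)

lemma BL_line_integrable:
  assumes "BL f" "t \<in> {0..1}" "{a..b} \<subseteq> {-1..1}"
  shows "(\<lambda>p. f i t (q, p)) integrable_on {a..b}"
  using continuous_on_subset[OF BL_line[OF assms(1,2)] assms(3)] by (rule integrable_continuous_real)

lemma integral_bound_real:
  fixes g :: "real \<Rightarrow> real"
  assumes "g integrable_on {a..b}" "a \<le> b" "\<And>x. x \<in> {a..b} \<Longrightarrow> \<bar>g x\<bar> \<le> B"
  shows "\<bar>integral {a..b} g\<bar> \<le> B * (b - a)"
proof -
  have "norm (integral {a..b} g) \<le> integral {a..b} (\<lambda>_. B)"
    by (rule integral_norm_bound_integral[OF assms(1)]) (use assms(3) in auto)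
  then show ?thesis using assms(2) by (simp add: mult.commute)
qed

definition vint :: "(real \<times> real \<Rightarrow> real) \<Rightarrow> real \<times> real \<Rightarrow> real" where
  "vint g x = integral {-1..snd x} (\<lambda>s. g (fst x, s))"

text \<open>A vertical move costs the integral over the gap; a change of time or of q costs the
  Lipschitz constant integrated over a length of at most 2. Together this gives the factor
  3.\<close>

lemma BL_vint:
  assumes "BL f"
  shows "BL (\<lambda>i t. vint (f i t))"
proof -
  obtain C where "BLC C f" using assms(1) by (auto simp: BL_def)
  note C = BLC_D[OF this]
  have bnd: "\<bar>integral {a..b} (\<lambda>r. f i t (q, r))\<bar> \<le> C * (b - a)"
    if "t \<in> {0..1}" "-1 \<le> a" "a \<le> b" "b \<le> 1" for i t q a b
    using that by (intro integral_bound_real BL_line_integrable assms C(2)) (auto simp: strip_iff)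
  have vertical: "\<bar>vint (f i t) (q, p) - vint (f i t) (q, p')\<bar> \<le> C * (p - p')"
    if t: "t \<in> {0..1}" and p: "-1 \<le> p'" "p' \<le> p" "p \<le> 1" for i t q p p'
  proof -
    have "vint (f i t) (q, p) = vint (f i t) (q, p') + integral {p'..p} (\<lambda>r. f i t (q, r))"
      unfolding vint_def fst_conv snd_conv using p
      by (subst Henstock_Kurzweil_Integration.integral_combine) (auto intro!: BL_line_integrable[OF assms t])
    then show ?thesis using bnd[OF t p] by simp
  qed
  show ?thesis
  proof (rule BL_I[where A = "2 * C" and B = "3 * C"])
    fix i t and s :: real and x y :: "real \<times> real" assume *: "t \<in> {0..1::real}" "x \<in> strip" 
    obtain q p where x: "x = (q, p)" by (cases x)
    have p: "-1 \<le> p" "p \<le> 1" using * by (auto simp: x strip_iff)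
    have "\<bar>vint (f i t) x\<bar> \<le> C * (p - -1)" unfolding vint_def x using p * bnd[of t "-1" p] by simp
    also have "\<dots> \<le> C * 2" using C(1) p by (intro mult_left_mono) auto
    finally show "\<bar>vint (f i t) x\<bar> \<le> 2 * C" by simp
    assume **: "s \<in> {0..1}" "y \<in> strip"
    obtain q' p' where y: "y = (q', p')" by (cases y)
    have p': "-1 \<le> p'" "p' \<le> 1" using ** by (auto simp: y strip_iff)
    let ?N = "\<bar>t - s\<bar> + norm (x - y)"
    have n: "\<bar>q - q'\<bar> \<le> norm (x - y)" "\<bar>p - p'\<bar> \<le> norm (x - y)"
      using norm_fst_le[of "q - q'" "p - p'"] norm_snd_le[of "p - p'" "q - q'"] by (auto simp: x y)
    have 1: "\<bar>vint (f i t) (q, p) - vint (f i t) (q, p')\<bar> \<le> C * norm (x - y)"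
    proof -
      have "\<bar>vint (f i t) (q, p) - vint (f i t) (q, p')\<bar> \<le> C * \<bar>p - p'\<bar>"
      proof (cases "p' \<le> p")
        case True
        then show ?thesis using vertical[OF *(1), of p' p i q] p p' by simp
      next
        case False
        then show ?thesis using vertical[OF *(1), of p p' i q] p p' by (simp add: abs_minus_commute)
      qed
      also have "\<dots> \<le> C * norm (x - y)" using n C(1) by (intro mult_left_mono) auto
      finally show ?thesis .
    qed
    have "vint (f i t) (q, p') - vint (f i s) (q', p') = integral {-1..p'} (\<lambda>r. f i t (q, r) - f i s (q', r))"
      unfolding vint_def using p' by (subst integral_diff) (auto intro!: BL_line_integrable assms * **)
    also have "\<bar>\<dots>\<bar> \<le> C * ?N * (p' - -1)"
    proof (rule integral_bound_real)
      fix r assume "r \<in> {-1..p'}"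
      then have "\<bar>f i t (q, r) - f i s (q', r)\<bar> \<le> C * (\<bar>t - s\<bar> + norm ((q, r) - (q', r)))"
        using p' * ** by (intro C(3)) (auto simp: strip_iff)
      also have "\<dots> \<le> C * ?N" using n C(1) by (simp add: norm_Pair)
      finally show "\<bar>f i t (q, r) - f i s (q', r)\<bar> \<le> C * ?N" .
    qed (use p' in \<open>auto intro!: integrable_diff BL_line_integrable assms * **\<close>)
    also have "\<dots> \<le> C * ?N * 2" using p' C(1) by (intro mult_left_mono mult_nonneg_nonneg) auto
    finally have 2: "\<bar>vint (f i t) (q, p') - vint (f i s) (q', p')\<bar> \<le> 2 * C * ?N" by simp
    have "C * norm (x - y) \<le> C * ?N" using C(1) by simp
    then show "\<bar>vint (f i t) x - vint (f i s) y\<bar> \<le> 3 * C * ?N"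
      using 1 2 unfolding x y by linarith
  qed
qed

section \<open>Uniform families of diffeomorphisms\<close>

text \<open>Entries are listed row by row. Quadruples fit the plane
  \<open>real \<times> real\<close> and make continuity and norm estimates entrywise.\<close>

type_synonym mat2 = "real \<times> real \<times> real \<times> real"

definition mapp :: "mat2 \<Rightarrow> real \<times> real \<Rightarrow> real \<times> real" where
  "mapp = (\<lambda>(a, b, c, d) (u, v). (a * u + b * v, c * u + d * v))"

definition mmul :: "mat2 \<Rightarrow> mat2 \<Rightarrow> mat2" where
  "mmul = (\<lambda>(a, b, c, d) (a', b', c', d'). (a * a' + b * c', a * b' + b * d', c * a' + d * c', c * b' + d * d'))"

definition mdet :: "mat2 \<Rightarrow> real" where
  "mdet = (\<lambda>(a, b, c, d). a * d - b * c)"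

definition minv :: "mat2 \<Rightarrow> mat2" where
  "minv = (\<lambda>(a, b, c, d). let e = a * d - b * c in (d / e, - b / e, - c / e, a / e))"

lemma mapp_mmul: "mapp (mmul A B) x = mapp A (mapp B x)"
  by (cases A; cases B; cases x) (simp add: mapp_def mmul_def algebra_simps)

lemma mdet_mmul: "mdet (mmul A B) = mdet A * mdet B"
  by (cases A; cases B) (simp add: mdet_def mmul_def algebra_simps)

lemma mmul_minv:
  assumes "mdet A \<noteq> 0"
  shows "mmul (minv A) A = (1, 0, 0, 1)" "mmul A (minv A) = (1, 0, 0, 1)" "mdet (minv A) = 1 / mdet A"
proof -
  obtain a b c d where A: "A = (a, b, c, d)" by (cases A)
  define e where "e = a * d - b * c"
  have e: "e \<noteq> 0" using assms by (simp add: A mdet_def e_def)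
  have "minv A = (d / e, - b / e, - c / e, a / e)" by (simp add: minv_def A e_def Let_def)
  moreover have "d * a - b * c = e" "a * d - b * c = e" by (simp_all add: e_def)
  ultimately show "mmul (minv A) A = (1, 0, 0, 1)" "mmul A (minv A) = (1, 0, 0, 1)" "mdet (minv A) = 1 / mdet A"
    using e by (simp_all add: A mmul_def mdet_def divide_simps) (simp_all add: algebra_simps)
qed

lemma mapp_one: "mapp (1, 0, 0, 1) x = x"
  by (cases x) (simp add: mapp_def)

lemma mat2_norm:
  fixes a b c d :: real
  shows "\<bar>a\<bar> \<le> norm (a, b, c, d)" "\<bar>b\<bar> \<le> norm (a, b, c, d)" "\<bar>c\<bar> \<le> norm (a, b, c, d)"
    "\<bar>d\<bar> \<le> norm (a, b, c, d)" "norm (a, b, c, d) \<le> \<bar>a\<bar> + \<bar>b\<bar> + \<bar>c\<bar> + \<bar>d\<bar>"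
proof -
  have 1: "\<bar>a\<bar> \<le> norm (a, y)" "norm y \<le> norm (a, y)" "norm (a, y) \<le> \<bar>a\<bar> + norm y" for a :: real and y :: "'z::real_normed_vector"
    using norm_fst_le[of a y] norm_snd_le[of y a] norm_Pair_le[of a y] by auto
  show "\<bar>a\<bar> \<le> norm (a, b, c, d)" by (rule 1)
  show "\<bar>b\<bar> \<le> norm (a, b, c, d)" using 1(2)[of "(b, c, d)" a] 1(1)[of b "(c, d)"] by linarith
  show "\<bar>c\<bar> \<le> norm (a, b, c, d)" using 1(2)[of "(b, c, d)" a] 1(2)[of "(c, d)" b] 1(1)[of c d] by linarith
  show "\<bar>d\<bar> \<le> norm (a, b, c, d)" using 1(2)[of "(b, c, d)" a] 1(2)[of "(c, d)" b] 1(2)[of d c] by simp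
  show "norm (a, b, c, d) \<le> \<bar>a\<bar> + \<bar>b\<bar> + \<bar>c\<bar> + \<bar>d\<bar>"
    using 1(3)[of a "(b, c, d)"] 1(3)[of b "(c, d)"] 1(3)[of c d] by simp
qed

lemma norm_mapp_le: "norm (mapp A x) \<le> 4 * norm A * norm x"
proof -
  obtain a b c d where A: "A = (a, b, c, d)" by (cases A)
  obtain u v where x: "x = (u, v)" by (cases x)
  have uv: "\<bar>u\<bar> \<le> norm x" "\<bar>v\<bar> \<le> norm x" using norm_fst_le[of u v] norm_snd_le[of v u] by (auto simp: x)
  have *: "\<bar>s * w\<bar> \<le> norm A * norm x" if "\<bar>s\<bar> \<le> norm A" "\<bar>w\<bar> \<le> norm x" for s w
    using that by (simp add: abs_mult mult_mono)
  note m = mat2_norm(1-4)[where a = a and b = b and c = c and d = d, folded A]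
  have "norm (mapp A x) \<le> \<bar>a * u + b * v\<bar> + \<bar>c * u + d * v\<bar>"
    using norm_Pair_le[of "a * u + b * v" "c * u + d * v"] by (simp add: mapp_def A x)
  then show ?thesis using *[OF m(1) uv(1)] *[OF m(2) uv(2)] *[OF m(3) uv(1)] *[OF m(4) uv(2)] by linarith
qed

lemma norm_mmul_le: "norm (mmul A B) \<le> 8 * norm A * norm B"
proof -
  obtain a b c d where A: "A = (a, b, c, d)" by (cases A)
  obtain a' b' c' d' where B: "B = (a', b', c', d')" by (cases B)
  have *: "\<bar>s * w + s' * w'\<bar> \<le> 2 * (norm A * norm B)"
    if "\<bar>s\<bar> \<le> norm A" "\<bar>w\<bar> \<le> norm B" "\<bar>s'\<bar> \<le> norm A" "\<bar>w'\<bar> \<le> norm B" for s w s' w'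
    unfolding mult_2 by (rule order_trans[OF abs_triangle_ineq]) (intro add_mono, use that in \<open>simp_all add: abs_mult mult_mono\<close>)
  note m = mat2_norm(1-4)[where a = a and b = b and c = c and d = d, folded A] and n = mat2_norm(1-4)[where a = a' and b = b' and c = c' and d = d', folded B]
  have "norm (mmul A B) \<le> \<bar>a * a' + b * c'\<bar> + \<bar>a * b' + b * d'\<bar> + \<bar>c * a' + d * c'\<bar> + \<bar>c * b' + d * d'\<bar>"
    using mat2_norm(5) by (simp add: mmul_def A B)
  also have "\<dots> \<le> 2 * (norm A * norm B) + 2 * (norm A * norm B) + 2 * (norm A * norm B) + 2 * (norm A * norm B)"
    by (intro add_mono * m n)
  finally show ?thesis by simp
qed

lemma abs_mdet_le: "\<bar>mdet A\<bar> \<le> 2 * norm A * norm A"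
proof -
  obtain a b c d where A: "A = (a, b, c, d)" by (cases A)
  have *: "\<bar>s * w\<bar> \<le> norm A * norm A" if "\<bar>s\<bar> \<le> norm A" "\<bar>w\<bar> \<le> norm A" for s w
    using that by (simp add: abs_mult mult_mono)
  note m = mat2_norm(1-4)[where a = a and b = b and c = c and d = d, folded A]
  have "mdet A = a * d - b * c" by (simp add: mdet_def A)
  then show ?thesis using *[OF m(1) m(4)] *[OF m(2) m(3)] by linarith
qed

lemma norm_minv_le:
  assumes "e > 0" "e \<le> mdet A" "norm A \<le> K"
  shows "norm (minv A) \<le> 4 * K / e"
proof -
  obtain a b c d where A: "A = (a, b, c, d)" by (cases A)
  have *: "\<bar>s / mdet A\<bar> \<le> K / e" if "\<bar>s\<bar> \<le> norm A" for s
    using that assms by (simp add: frac_le)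
  note m = mat2_norm(1-4)[where a = a and b = b and c = c and d = d, folded A]
  have "minv A = (d / mdet A, - b / mdet A, - c / mdet A, a / mdet A)"
    by (simp add: minv_def A mdet_def Let_def)
  then have "norm (minv A) \<le> \<bar>d / mdet A\<bar> + \<bar>- b / mdet A\<bar> + \<bar>- c / mdet A\<bar> + \<bar>a / mdet A\<bar>"
    using mat2_norm(5) by metis
  then show ?thesis using *[OF m(4)] *[OF m(2)] *[OF m(3)] *[OF m(1)] by simp
qed

lemma bounded_linear_mapp: "bounded_linear (mapp A)"
proof (rule bounded_linear_intro)
  show "mapp A (x + y) = mapp A x + mapp A y" for x y
    by (cases A; cases x; cases y) (simp add: mapp_def algebra_simps)
  show "mapp A (r *\<^sub>R x) = r *\<^sub>R mapp A x" for r x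
    by (cases A; cases x) (simp add: mapp_def algebra_simps)
  show "norm (mapp A x) \<le> norm x * (4 * norm A)" for x
    using norm_mapp_le[of A x] by (simp add: mult.commute)
qed

lemma continuous_on_mmul:
  assumes "continuous_on S A" "continuous_on S B"
  shows "continuous_on S (\<lambda>x. mmul (A x) (B x))"
  unfolding mmul_def case_prod_beta using assms by (intro continuous_intros)

lemma continuous_on_minv:
  assumes "continuous_on S A" "\<And>x. x \<in> S \<Longrightarrow> mdet (A x) \<noteq> 0"
  shows "continuous_on S (\<lambda>x. minv (A x))"
  unfolding minv_def case_prod_beta Let_def
  using assms by (intro continuous_intros) (auto simp: mdet_def case_prod_beta)

text \<open>\<open>D'\<close> applied to the remainder of \<open>g\<close> at \<open>h y\<close> is,
  up to sign, the remainder of \<open>h\<close>. The Lipschitz bound both forces \<open>h z\<close>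
  towards \<open>h y\<close> and compares the two increments, so this remainder is small relative to
  z - y, at boundary points as well.\<close>

lemma has_derivative_inverse_lipschitz:
  fixes g :: "'a::real_normed_vector \<Rightarrow> 'b::real_normed_vector"
  assumes D: "(g has_derivative D) (at (h y) within S)"
    and D': "bounded_linear D'" "\<And>v. D' (D v) = v"
    and h: "\<And>z. z \<in> T \<Longrightarrow> h z \<in> S" "\<And>z. z \<in> T \<Longrightarrow> g (h z) = z"
    and L: "\<And>z. z \<in> T \<Longrightarrow> norm (h z - h y) \<le> L * norm (z - y)" and y: "y \<in> T"
  shows "(h has_derivative D') (at y within T)"
proof -
  interpret D: bounded_linear D using D by (rule has_derivative_bounded_linear)
  interpret D': bounded_linear D' by (rule D'(1))
  obtain B where B: "B > 0" "\<And>x. norm (D' x) \<le> norm x * B" using D'.pos_bounded by blast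
  let ?r = "\<lambda>x. norm (g x - g (h y) - D (x - h y)) / norm (x - h y)"
  have r: "(?r \<longlongrightarrow> 0) (at (h y) within S)" using D unfolding has_derivative_iff_norm by blast
  have ne: "h z \<noteq> h y" if "z \<in> T" "z \<noteq> y" for z using that h(2) y by metis
  have "(h \<longlongrightarrow> h y) (at y within T)"
  proof (rule LIM_zero_cancel, rule Lim_null_comparison)
    show "\<forall>\<^sub>F z in at y within T. norm (h z - h y) \<le> L * norm (z - y)"
      unfolding eventually_at_filter using L by (auto intro!: always_eventually)
    have "((\<lambda>z. L * norm (z - y)) \<longlongrightarrow> L * norm (y - y)) (at y within T)"
      by (intro tendsto_intros)
    then show "((\<lambda>z. L * norm (z - y)) \<longlongrightarrow> 0) (at y within T)" by simp
  qed
  moreover have "\<forall>\<^sub>F z in at y within T. h z \<in> S \<and> h z \<noteq> h y"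
    unfolding eventually_at_filter using h ne by (auto intro!: always_eventually)
  ultimately have "filterlim h (at (h y) within S) (at y within T)"
    unfolding filterlim_at by blast
  from filterlim_compose[OF r this]
  have r': "((\<lambda>z. B * L * ?r (h z)) \<longlongrightarrow> B * L * 0) (at y within T)" by (intro tendsto_intros)
  show ?thesis
  proof (rule has_derivativeI_sandwich[of 1])
    show "((\<lambda>z. B * L * ?r (h z)) \<longlongrightarrow> 0) (at y within T)" using r' by simp
    fix z assume z: "z \<in> T" "z \<noteq> y"
    have "h z - h y - D' (z - y) = - D' (g (h z) - g (h y) - D (h z - h y))"
      using h(2)[OF z(1)] h(2)[OF y] by (simp add: D'.diff D'(2) D.diff)
    then have "norm (h z - h y - D' (z - y)) \<le> norm (g (h z) - g (h y) - D (h z - h y)) * B"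
      using B(2) by simp
    also have "\<dots> = B * ?r (h z) * norm (h z - h y)" using ne[OF z] by simp
    also have "\<dots> \<le> B * ?r (h z) * (L * norm (z - y))"
      using B(1) by (intro mult_left_mono L z) auto
    finally show "norm (h z - h y - D' (z - y)) / norm (z - y) \<le> B * L * ?r (h z)"
      using z by (simp add: pos_divide_le_eq algebra_simps)
  qed (use D'(1) in auto)
qed

text \<open>
  The Lipschitz bound for the inverses saves an inverse function theorem on the boundary.
\<close>

definition UD :: "('i \<Rightarrow> real \<times> real \<Rightarrow> real \<times> real) \<Rightarrow> ('i \<Rightarrow> real \<times> real \<Rightarrow> mat2) \<Rightarrow> bool" where
  "UD g J \<longleftrightarrow>
     (\<forall>i. bij_betw (g i) strip strip \<and> 
        (\<forall>x\<in>strip. (snd (g i x) = 1 \<longleftrightarrow> snd x = 1) \<and> (snd (g i x) = -1 \<longleftrightarrow> snd x = -1)) \<and>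
        continuous_on strip (J i) \<and>
        (\<forall>x\<in>strip. (g i has_derivative mapp (J i x)) (at x within strip))) \<and>
     (\<exists>K. \<forall>i. \<forall>x\<in>strip. norm (J i x) \<le> K) \<and>
     (\<exists>d>0. \<forall>i. \<forall>x\<in>strip. d \<le> mdet (J i x)) \<and>
     (\<exists>L. \<forall>i. \<forall>x\<in>strip. \<forall>y\<in>strip. norm (x - y) \<le> L * norm (g i x - g i y))"

lemma UD_D:
  assumes "UD g J"
  shows "bij_betw (g i) strip strip" "x \<in> strip \<Longrightarrow> snd (g i x) = 1 \<longleftrightarrow> snd x = 1"
    "x \<in> strip \<Longrightarrow> snd (g i x) = -1 \<longleftrightarrow> snd x = -1"
    "continuous_on strip (J i)" "x \<in> strip \<Longrightarrow> (g i has_derivative mapp (J i x)) (at x within strip)"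
    "x \<in> strip \<Longrightarrow> g i x \<in> strip"
    "\<exists>K\<ge>0. \<forall>i. \<forall>x\<in>strip. norm (J i x) \<le> K"
    "\<exists>d>0. \<forall>i. \<forall>x\<in>strip. d \<le> mdet (J i x)"
    "\<exists>L. \<forall>i. \<forall>x\<in>strip. \<forall>y\<in>strip. norm (x - y) \<le> L * norm (g i x - g i y)"
proof -
  obtain K where "\<forall>i. \<forall>x\<in>strip. norm (J i x) \<le> K" using assms unfolding UD_def by blast
  then have "\<forall>i. \<forall>x\<in>strip. norm (J i x) \<le> max 0 K" by (simp add: le_max_iff_disj)
  then show "\<exists>K\<ge>0. \<forall>i. \<forall>x\<in>strip. norm (J i x) \<le> K" by (meson max.cobounded1)
  show b: "bij_betw (g i) strip strip" using assms unfolding UD_def by blast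
  show "x \<in> strip \<Longrightarrow> g i x \<in> strip" using bij_betwE[OF b] by blast
qed (use assms in \<open>unfold UD_def, blast+\<close>)

lemma UD_lipschitz:
  assumes "UD g J"
  shows "\<exists>L\<ge>0. \<forall>i. \<forall>x\<in>strip. \<forall>y\<in>strip. norm (g i x - g i y) \<le> L * norm (x - y)"
proof -
  obtain K where K: "K \<ge> 0" "\<And>i x. x \<in> strip \<Longrightarrow> norm (J i x) \<le> K" using UD_D(7)[OF assms] by blast
  have "norm (g i x - g i y) \<le> (4 * K) * norm (x - y)" if "x \<in> strip" "y \<in> strip" for i x y
  proof (rule differentiable_bound[OF convex_strip UD_D(5)[OF assms] _ that])
    fix z assume z: "z \<in> strip"
    have "norm (mapp (J i z) v) \<le> 4 * K * norm v" for v
      by (rule order_trans[OF norm_mapp_le]) (intro mult_right_mono mult_left_mono K z, auto)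
    then show "onorm (mapp (J i z)) \<le> 4 * K" using K(1) by (intro onorm_bound) auto
  qed
  then show ?thesis using K(1) by (intro exI[of _ "4 * K"]) simp
qed

lemma UD_comp:
  assumes f: "UD f J" and g: "UD g L"
  shows "UD (\<lambda>i x. f i (g i x)) (\<lambda>i x. mmul (J i (g i x)) (L i x))"
proof -
  note F = UD_D[OF f] and G = UD_D[OF g]
  have cont: "continuous_on strip (g i)" for i
    using G(5) by (rule has_derivative_continuous_on)
  show ?thesis
    unfolding UD_def
  proof (intro conjI allI ballI)
    fix i
    show "bij_betw (\<lambda>x. f i (g i x)) strip strip"
      using bij_betw_trans[OF G(1) F(1)] by (simp add: o_def)
    show "continuous_on strip (\<lambda>x. mmul (J i (g i x)) (L i x))"
      by (intro continuous_on_mmul G continuous_on_compose2[OF F(4) cont]) (auto simp: G)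
    fix x :: "real \<times> real" assume x: "x \<in> strip"
    show "snd (f i (g i x)) = 1 \<longleftrightarrow> snd x = 1" "snd (f i (g i x)) = -1 \<longleftrightarrow> snd x = -1"
      using F(2,3)[OF G(6)[OF x]] G(2,3)[OF x] by simp_all
    show "((\<lambda>x. f i (g i x)) has_derivative mapp (mmul (J i (g i x)) (L i x))) (at x within strip)"
      unfolding mapp_mmul by (rule has_derivative_in_compose2[OF F(5) _ x G(5)[OF x]]) (auto simp: G)
  next
    obtain K K' where K: "K \<ge> 0" "\<And>i x. x \<in> strip \<Longrightarrow> norm (J i x) \<le> K"
      and K': "K' \<ge> 0" "\<And>i x. x \<in> strip \<Longrightarrow> norm (L i x) \<le> K'" using F(7) G(7) by blast
    have "norm (mmul (J i (g i x)) (L i x)) \<le> 8 * K * K'" if "x \<in> strip" for i x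
      by (rule order_trans[OF norm_mmul_le]) (use K(1) K'(1) in \<open>intro mult_mono K(2) K'(2) G(6) that, simp_all\<close>)
    then show "\<exists>K. \<forall>i. \<forall>x\<in>strip. norm (mmul (J i (g i x)) (L i x)) \<le> K" by blast
  next
    obtain d d' where d: "d > 0" "\<And>i x. x \<in> strip \<Longrightarrow> d \<le> mdet (J i x)"
      and d': "d' > 0" "\<And>i x. x \<in> strip \<Longrightarrow> d' \<le> mdet (L i x)" using F(8) G(8) by blast
    have "d * d' \<le> mdet (mmul (J i (g i x)) (L i x))" if "x \<in> strip" for i x
    proof -
      note 1 = d(2)[OF G(6)[OF that], of i i] and 2 = d'(2)[OF that, of i]
      show ?thesis unfolding mdet_mmul using 1 2 d(1) d'(1) by (intro mult_mono) auto
    qed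
    then show "\<exists>d>0. \<forall>i. \<forall>x\<in>strip. d \<le> mdet (mmul (J i (g i x)) (L i x))"
      using mult_pos_pos[OF d(1) d'(1)] by blast
  next
    obtain A A' where A: "\<And>i x y. x \<in> strip \<Longrightarrow> y \<in> strip \<Longrightarrow> norm (x - y) \<le> A * norm (f i x - f i y)"
      and A': "\<And>i x y. x \<in> strip \<Longrightarrow> y \<in> strip \<Longrightarrow> norm (x - y) \<le> A' * norm (g i x - g i y)"
      using F(9) G(9) by blast
    have "norm (x - y) \<le> max 0 A' * A * norm (f i (g i x) - f i (g i y))" if "x \<in> strip" "y \<in> strip" for i x y
    proof -
      have "norm (x - y) \<le> max 0 A' * norm (g i x - g i y)"
        by (rule order_trans[OF A'[OF that, of i]]) (intro mult_right_mono, auto)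
      also have "\<dots> \<le> max 0 A' * (A * norm (f i (g i x) - f i (g i y)))"
        by (intro mult_left_mono A G(6) that) auto
      finally show ?thesis by (simp add: mult.assoc)
    qed
    then show "\<exists>A. \<forall>i. \<forall>x\<in>strip. \<forall>y\<in>strip. norm (x - y) \<le> A * norm (f i (g i x) - f i (g i y))"
      by blast
  qed
qed

lemma bij_inv_strip:
  assumes "bij_betw g strip strip" "x \<in> strip"
  shows "inv_into strip g x \<in> strip" "g (inv_into strip g x) = x" "inv_into strip g (g x) = x"
  using assms by (auto simp: bij_betw_def inv_into_into f_inv_into_f)

text \<open>The bounds exchange their roles: the lower bound of the determinant bounds the inverse
  matrix, the upper bound of the matrix keeps the inverse determinant away from 0, and the two
  Lipschitz bounds are swapped.\<close>

lemma UD_inv: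
  assumes g: "UD g J"
  shows "UD (\<lambda>i. inv_into strip (g i)) (\<lambda>i y. minv (J i (inv_into strip (g i) y)))"
proof -
  note G = UD_D[OF g]
  note I = bij_inv_strip[OF G(1)]
  obtain d where d: "d > 0" "\<And>i x. x \<in> strip \<Longrightarrow> d \<le> mdet (J i x)" using G(8) by blast
  have det0: "mdet (J i x) \<noteq> 0" if "x \<in> strip" for i x using d(1) d(2)[OF that, of i] by simp
  obtain K where K: "K \<ge> 0" "\<And>i x. x \<in> strip \<Longrightarrow> norm (J i x) \<le> K" using G(7) by blast
  obtain A where A: "\<And>i x y. x \<in> strip \<Longrightarrow> y \<in> strip \<Longrightarrow> norm (x - y) \<le> A * norm (g i x - g i y)"
    using G(9) by blast
  have lip: "norm (inv_into strip (g i) x - inv_into strip (g i) y) \<le> A * norm (x - y)"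
    if "x \<in> strip" "y \<in> strip" for i x y using A[OF I(1)[OF that(1)] I(1)[OF that(2)], of i i i] I(2) that by simp
  have der: "(inv_into strip (g i) has_derivative mapp (minv (J i (inv_into strip (g i) y)))) (at y within strip)"
    if y: "y \<in> strip" for i y
  proof (rule has_derivative_inverse_lipschitz[where h = "inv_into strip (g i)", OF G(5)[OF I(1)[OF y]] bounded_linear_mapp])
    show "mapp (minv (J i (inv_into strip (g i) y))) (mapp (J i (inv_into strip (g i) y)) v) = v" for v
      by (simp add: mapp_mmul[symmetric] mmul_minv(1) det0 I(1) y mapp_one)
    show "norm (inv_into strip (g i) z - inv_into strip (g i) y) \<le> A * norm (z - y)" if "z \<in> strip" for z
      by (rule lip[OF that y])
  qed (fact I(1) I(2) y)+
  have cont: "continuous_on strip (inv_into strip (g i))" for i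
    using der by (rule has_derivative_continuous_on)
  show ?thesis
    unfolding UD_def
  proof (intro conjI allI ballI)
    fix i
    show "bij_betw (inv_into strip (g i)) strip strip" by (rule bij_betw_inv_into[OF G(1)])
    show "continuous_on strip (\<lambda>y. minv (J i (inv_into strip (g i) y)))"
      by (intro continuous_on_minv continuous_on_compose2[OF G(4) cont]) (auto simp: I det0)
    fix y :: "real \<times> real" assume y: "y \<in> strip"
    show "(inv_into strip (g i) has_derivative mapp (minv (J i (inv_into strip (g i) y)))) (at y within strip)"
      by (rule der[OF y])
    show "snd (inv_into strip (g i) y) = 1 \<longleftrightarrow> snd y = 1" "snd (inv_into strip (g i) y) = -1 \<longleftrightarrow> snd y = -1"
      using G(2,3)[OF I(1)[OF y], of i i] I(2)[OF y, of i] by simp_all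
  next
    have "norm (minv (J i (inv_into strip (g i) y))) \<le> 4 * K / d" if "y \<in> strip" for i y
      by (rule norm_minv_le) (use d K I that in auto)
    then show "\<exists>K. \<forall>i. \<forall>y\<in>strip. norm (minv (J i (inv_into strip (g i) y))) \<le> K" by blast
  next
    \<comment> \<open>From \<open>abs_mdet_le\<close>; \<open>K + 1\<close> instead of
      \<open>K\<close> keeps the denominator positive.\<close>
    have "1 / (2 * (K + 1) * (K + 1)) \<le> mdet (minv (J i (inv_into strip (g i) y)))" if "y \<in> strip" for i y
    proof -
      let ?A = "J i (inv_into strip (g i) y)"
      have 1: "mdet ?A > 0" using d(1) d(2)[OF I(1)[OF that], of i i] by simp
      have "mdet ?A \<le> 2 * norm ?A * norm ?A" using abs_mdet_le[of ?A] by simp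
      also have "\<dots> \<le> 2 * (K + 1) * (K + 1)" using K(2)[OF I(1)[OF that], of i i] K(1) by (intro mult_mono) auto
      finally show ?thesis using 1 det0[OF I(1)[OF that], of i i] by (simp add: mmul_minv(3) frac_le)
    qed
    moreover have "1 / (2 * (K + 1) * (K + 1)) > 0" using K(1) by simp
    ultimately show "\<exists>d>0. \<forall>i. \<forall>y\<in>strip. d \<le> mdet (minv (J i (inv_into strip (g i) y)))" by blast
  next
    obtain L where L: "\<And>i x y. x \<in> strip \<Longrightarrow> y \<in> strip \<Longrightarrow> norm (g i x - g i y) \<le> L * norm (x - y)"
      using UD_lipschitz[OF g] by blast
    have "norm (x - y) \<le> L * norm (inv_into strip (g i) x - inv_into strip (g i) y)"
      if "x \<in> strip" "y \<in> strip" for i x y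
      using L[OF I(1)[OF that(1)] I(1)[OF that(2)], of i i i] I(2) that by simp
    then show "\<exists>L. \<forall>i. \<forall>x\<in>strip. \<forall>y\<in>strip. norm (x - y) \<le> L * norm (inv_into strip (g i) x - inv_into strip (g i) y)"
      by blast
  qed
qed

section \<open>Area preservation\<close>

lemma C1_stripI:
  assumes d: "\<And>x. x \<in> strip \<Longrightarrow> (g has_derivative mapp (J x)) (at x within strip)"
    and c: "continuous_on strip J"
  shows "C1_strip g"
proof -
  define E where "E A = Blinfun (mapp A)" for A
  have E: "blinfun_apply (E A) v = mapp A v" for A v
    unfolding E_def by (simp add: bounded_linear_Blinfun_apply bounded_linear_mapp)
  \<comment> \<open>As a combination of four fixed operators, the derivative depends continuously on
    x in operator norm as soon as its entries do.\<close>
  define G where "G x = fst (J x) *\<^sub>R E (1, 0, 0, 0) + fst (snd (J x)) *\<^sub>R E (0, 1, 0, 0)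
      + fst (snd (snd (J x))) *\<^sub>R E (0, 0, 1, 0) + snd (snd (snd (J x))) *\<^sub>R E (0, 0, 0, 1)" for x
  have "blinfun_apply (G x) v = mapp (J x) v" for x v
    by (cases "J x"; cases v) (simp add: G_def blinfun.add_left blinfun.scaleR_left E mapp_def)
  then have "blinfun_apply (G x) = mapp (J x)" for x by (rule ext)
  moreover have "continuous_on strip G"
    unfolding G_def by (intro continuous_intros c)
  ultimately show ?thesis unfolding C1_strip_def using d by metis
qed

lemma UD_diffeo_strip:
  assumes "UD g J"
  shows "diffeo_strip (g i)"
  unfolding diffeo_strip_def
  using UD_D[OF assms] UD_D[OF UD_inv[OF assms]]
  by (intro conjI C1_stripI[where J = "J i"] C1_stripI[where J = "\<lambda>y. minv (J i (inv_into strip (g i) y))"]) simp_all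

lemma UD_deriv_bounded:
  assumes "UD g J"
  shows "\<exists>K. \<forall>i. deriv_bounded K (g i)"
proof -
  obtain K where K: "K \<ge> 0" "\<And>i x. x \<in> strip \<Longrightarrow> norm (J i x) \<le> K" using UD_D(7)[OF assms] by blast
  have "onorm (mapp (J i x)) \<le> 4 * K" if "x \<in> strip" for i x
  proof (rule onorm_bound)
    show "norm (mapp (J i x) v) \<le> 4 * K * norm v" for v
      by (rule order_trans[OF norm_mapp_le]) (intro mult_right_mono mult_left_mono K that, auto)
  qed (use K in auto)
  then have "deriv_bounded (4 * K) (g i)" for i
    unfolding deriv_bounded_def using UD_D(5)[OF assms] by blast
  then show ?thesis by blast
qed

lemma UD_continuous: "UD g J \<Longrightarrow> continuous_on strip (g i)"
  using UD_D(5) by (rule has_derivative_continuous_on)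

text \<open>The image is the preimage under the inverse, which is continuous.\<close>

lemma UD_image_borel:
  assumes "UD g J" "A \<in> sets borel" "A \<subseteq> strip"
  shows "g i ` A \<in> sets borel" "g i ` A \<subseteq> strip"
proof -
  note I = bij_inv_strip[OF UD_D(1)[OF assms(1)]]
  show "g i ` A \<subseteq> strip" using UD_D(6)[OF assms(1)] assms(3) by auto
  have "g i ` A = inv_into strip (g i) -` A \<inter> strip"
  proof (intro equalityI subsetI)
    fix y assume "y \<in> g i ` A"
    then obtain x where x: "x \<in> A" "y = g i x" by blast
    then have "x \<in> strip" using assms(3) by blast
    then show "y \<in> inv_into strip (g i) -` A \<inter> strip"
      using x I(3) UD_D(6)[OF assms(1)] by simp
  next
    fix y assume "y \<in> inv_into strip (g i) -` A \<inter> strip"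
    then show "y \<in> g i ` A" using I(2)[of y i] by (metis IntE image_eqI vimageE)
  qed
  moreover have "inv_into strip (g i) -` A \<inter> strip \<in> sets (restrict_space borel strip)"
    using measurable_sets[OF borel_measurable_continuous_on_restrict[OF UD_continuous[OF UD_inv[OF assms(1)]]] assms(2)]
    by (simp add: space_restrict_space)
  ultimately show "g i ` A \<in> sets borel"
    using closed_strip by (auto simp: sets_restrict_space_iff)
qed

section \<open>Change of variables through \<open>real ^ 2\<close>\<close>

definition vec2 :: "real \<times> real \<Rightarrow> real ^ 2" where
  "vec2 x = (\<chi> i. if i = 1 then fst x else snd x)"

definition pair2 :: "real ^ 2 \<Rightarrow> real \<times> real" where
  "pair2 v = (v $ 1, v $ 2)"

lemma vec2_simps [simp]: "vec2 x $ 1 = fst x" "vec2 x $ 2 = snd x" "pair2 (vec2 x) = x" "vec2 (pair2 v) = v"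
  by (auto simp: vec2_def pair2_def vec_eq_iff forall_2)

lemma bounded_linear_vec2: "bounded_linear vec2"
  unfolding linear_conv_bounded_linear[symmetric] by (rule linearI) (auto simp: vec_eq_iff forall_2)

lemma bounded_linear_pair2: "bounded_linear pair2"
  unfolding linear_conv_bounded_linear[symmetric] by (rule linearI) (auto simp: pair2_def)

lemma vec2_image: "vec2 ` A = pair2 -` A"
proof -
  have "v \<in> vec2 ` A" if "pair2 v \<in> A" for v
    using that by (metis image_eqI vec2_simps(4))
  then show ?thesis by auto
qed

lemma vec2_measurable: "vec2 \<in> borel_measurable borel" "pair2 \<in> borel_measurable borel"
  by (auto intro!: borel_measurable_continuous_onI linear_continuous_on bounded_linear_vec2 bounded_linear_pair2)

text \<open>Preimages of boxes are products of intervals, and volumes of boxes determine Lebesgue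
  measure. This carries the change of variables formula, which speaks of
  \<open>det (matrix _)\<close>, over to the product plane.\<close>

lemma lborel_vec2: "lborel = distr lborel borel vec2"
proof (rule lborel_eqI)
  fix l u :: "real ^ 2" assume le: "\<And>b. b \<in> Basis \<Longrightarrow> l \<bullet> b \<le> u \<bullet> b"
  have le': "l $ i \<le> u $ i" for i using le[of "axis i 1"] by (simp add: inner_axis axis_in_Basis_iff)
  have "vec2 -` box l u = box (l $ 1) (u $ 1) \<times> box (l $ 2) (u $ 2)"
    by (auto simp: mem_box_cart forall_2)
  then have "emeasure (distr lborel borel vec2) (box l u) = emeasure (lborel \<Otimes>\<^sub>M lborel) (box (l $ 1) (u $ 1) \<times> box (l $ 2) (u $ 2))"
    using vec2_measurable by (subst emeasure_distr) (auto simp: lborel_prod)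
  also have "\<dots> = ennreal (u $ 1 - l $ 1) * ennreal (u $ 2 - l $ 2)"
    using le' by (subst lborel.emeasure_pair_measure_Times) auto
  also have "\<dots> = ennreal ((u $ 1 - l $ 1) * (u $ 2 - l $ 2))"
    using le' by (simp add: ennreal_mult)
  also have "(u $ 1 - l $ 1) * (u $ 2 - l $ 2) = (\<Prod>b\<in>Basis. (u - l) \<bullet> b)"
  proof -
    have "inj (\<lambda>i. axis i (1::real) :: real ^ 2)" by (auto simp: inj_on_def axis_eq_axis)
    moreover have "(Basis :: (real ^ 2) set) = (\<lambda>i. axis i 1) ` UNIV" by (auto simp: Basis_vec_def)
    ultimately have "(\<Prod>b\<in>Basis. (u - l) \<bullet> b) = (\<Prod>i\<in>UNIV. (u - l) \<bullet> axis i 1)"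
      by (metis (no_types, lifting) prod.reindex_cong)
    then show ?thesis by (simp add: inner_axis UNIV_2)
  qed
  finally show "emeasure (distr lborel borel vec2) (box l u) = (\<Prod>b\<in>Basis. (u - l) \<bullet> b)" .
qed simp

lemma emeasure_pair2_vimage:
  assumes "A \<in> sets borel"
  shows "pair2 -` A \<in> sets borel" "emeasure lborel (pair2 -` A) = emeasure lborel A"
proof -
  show 1: "pair2 -` A \<in> sets borel" using measurable_sets[OF vec2_measurable(2) assms] by simp
  have "vec2 -` (pair2 -` A) = A" by auto
  then show "emeasure lborel (pair2 -` A) = emeasure lborel A"
    using 1 vec2_measurable by (subst lborel_vec2) (simp add: emeasure_distr)
qed

text \<open>Change of variables with integrand 1, transported by \<open>vec2\<close>. Boundedness
  makes the measures finite, so that the real-valued \<open>measure\<close> determines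
  \<open>emeasure\<close>.\<close>

lemma emeasure_image_unit_jacobian:
  assumes A: "A \<in> sets borel" "A \<subseteq> S" "bounded A" and gA: "g ` A \<in> sets borel" and inj: "inj_on g A"
    and d: "\<And>x. x \<in> A \<Longrightarrow> (g has_derivative mapp (J x)) (at x within S)"
    and J: "\<And>x. x \<in> A \<Longrightarrow> \<bar>mdet (J x)\<bar> = 1"
  shows "emeasure lborel (g ` A) = emeasure lborel A"
proof -
  define B where "B = vec2 ` A"
  define G where "G = (\<lambda>v. vec2 (g (pair2 v)))"
  define G' where "G' = (\<lambda>v w. vec2 (mapp (J (pair2 v)) (pair2 w)))"
  have B: "B = pair2 -` A" unfolding B_def by (rule vec2_image)
  have Bm: "B \<in> sets borel" unfolding B by (rule emeasure_pair2_vimage[OF A(1)])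
  have "bounded B" unfolding B_def using A(3) bounded_linear_vec2 by (rule bounded_linear_image)
  then have Bf: "B \<in> lmeasurable" using Bm by (intro bounded_set_imp_lmeasurable) auto
  have GB: "G ` B = pair2 -` (g ` A)"
    unfolding vec2_image[symmetric] G_def B_def by (auto simp: image_image)
  have der: "(G has_derivative G' v) (at v within B)" if "v \<in> B" for v
  proof -
    have v: "pair2 v \<in> A" using that by (auto simp: B)
    have "pair2 ` B \<subseteq> S" using A(2) by (auto simp: B)
    with d[OF v] have "(g has_derivative mapp (J (pair2 v))) (at (pair2 v) within pair2 ` B)"
      by (rule has_derivative_subset)
    from has_derivative_in_compose[OF bounded_linear_imp_has_derivative[OF bounded_linear_pair2] this]
    have "((\<lambda>v. g (pair2 v)) has_derivative (\<lambda>w. mapp (J (pair2 v)) (pair2 w))) (at v within B)" .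
    then show ?thesis unfolding G_def G'_def
      by (rule bounded_linear.has_derivative[OF bounded_linear_vec2])
  qed
  have det: "\<bar>det (matrix (G' v))\<bar> = 1" if "v \<in> B" for v
  proof -
    obtain a b c d where J': "J (pair2 v) = (a, b, c, d)" by (cases "J (pair2 v)")
    have "det (matrix (G' v)) = a * d - b * c"
      unfolding G'_def J' by (simp add: det_2 matrix_def mapp_def pair2_def axis_def)
    moreover have "\<bar>mdet (J (pair2 v))\<bar> = 1" using J that by (auto simp: B)
    ultimately show ?thesis by (simp add: J' mdet_def)
  qed
  have injG: "inj_on G B"
  proof (rule inj_onI)
    fix v w assume vw: "v \<in> B" "w \<in> B" "G v = G w"
    then have "g (pair2 v) = g (pair2 w)" unfolding G_def by (metis vec2_simps(3))
    then have "pair2 v = pair2 w" using vw inj by (auto simp: B inj_on_def)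
    then show "v = w" by (metis vec2_simps(4))
  qed
  have const: "(\<lambda>v. \<bar>det (matrix (G' v))\<bar>) integrable_on B"
    using integrable_on_const[OF Bf, of "1::real"] det by (simp cong: integrable_cong)
  have S: "B \<in> sets lebesgue" using Bm by simp
  have m: "measure lebesgue (G ` B) = integral B (\<lambda>v. \<bar>det (matrix (G' v))\<bar>)"
    using S der injG const by (rule measure_differentiable_image_eq)
  also have "\<dots> = integral B (\<lambda>v. 1)" using det by (intro integral_cong) auto
  also have "\<dots> = measure lebesgue B" using Bf by (simp add: lmeasure_integral)
  finally have meq: "measure lebesgue (G ` B) = measure lebesgue B" .
  have GBf: "G ` B \<in> lmeasurable"
    using measurable_differentiable_image_eq[OF S der injG] const by blast
  have GBm: "G ` B \<in> sets borel" unfolding GB using emeasure_pair2_vimage[OF gA] by simp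
  have "emeasure lborel (G ` B) = emeasure lebesgue (G ` B)" using GBm by simp
  also have "\<dots> = emeasure lebesgue B" using meq Bf GBf by (simp add: emeasure_eq_measure2)
  also have "\<dots> = emeasure lborel B" using Bm by simp
  finally have "emeasure lborel (pair2 -` (g ` A)) = emeasure lborel (pair2 -` A)"
    unfolding GB[symmetric] B[symmetric] .
  then show ?thesis
    using emeasure_pair2_vimage[OF gA] emeasure_pair2_vimage[OF A(1)] by simp
qed

text \<open>Exhaustion by balls reduces the claim to bounded sets; continuity from below applies
  because the images are Borel.\<close>

lemma UD_area_preserving:
  assumes g: "UD g J" and J: "\<And>x. x \<in> strip \<Longrightarrow> mdet (J i x) = 1"
  shows "area_preserving (g i)"
  unfolding area_preserving_def
proof (intro ballI impI)
  fix A :: "(real \<times> real) set" assume A: "A \<in> sets borel" "A \<subseteq> strip"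
  define B where "B n = A \<inter> cball 0 (real n)" for n
  have B: "B n \<in> sets borel" "B n \<subseteq> strip" "bounded (B n)" "incseq B" for n
    using A by (auto simp: B_def incseq_def intro: bounded_Int)
  have gB: "g i ` B n \<in> sets borel" for n using UD_image_borel[OF g B(1,2)] by simp
  have "(\<Union>n. B n) = A"
    unfolding B_def using real_arch_simple by auto
  then have sup: "emeasure lborel A = (SUP n. emeasure lborel (B n))"
    using SUP_emeasure_incseq[of B lborel, OF _ B(4)] B(1) by (metis image_subsetI sets_lborel)
  have "(\<Union>n. g i ` B n) = g i ` A"
    using \<open>(\<Union>n. B n) = A\<close> by auto
  moreover have "range (\<lambda>n. g i ` B n) \<subseteq> sets lborel" using gB by (simp add: image_subset_iff)
  moreover have "incseq (\<lambda>n. g i ` B n)" using monoD[OF B(4)] by (simp add: incseq_def image_mono)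
  ultimately have "emeasure lborel (g i ` A) = (SUP n. emeasure lborel (g i ` B n))"
    using SUP_emeasure_incseq[of "\<lambda>n. g i ` B n" lborel] by simp
  moreover have "emeasure lborel (g i ` B n) = emeasure lborel (B n)" for n
  proof (rule emeasure_image_unit_jacobian[OF B(1-3) gB])
    show "inj_on (g i) (B n)" using UD_D(1)[OF g] B(2) by (metis bij_betw_def inj_on_subset)
    show "(g i has_derivative mapp (J i x)) (at x within strip)" if "x \<in> B n" for x
      using UD_D(5)[OF g] B(2) that by blast
    show "\<bar>mdet (J i x)\<bar> = 1" if "x \<in> B n" for x using J[of x] B(2)[of n] that by auto
  qed
  ultimately show "emeasure lborel (g i ` A) = emeasure lborel A" using sup by simp
qed

lemma area_preserving_comp:
  assumes "area_preserving f" "area_preserving g" and "\<And>A. A \<in> sets borel \<Longrightarrow> A \<subseteq> strip \<Longrightarrow> g ` A \<in> sets borel \<and> g ` A \<subseteq> strip"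
  shows "area_preserving (\<lambda>x. f (g x))"
  using assms unfolding area_preserving_def by (simp add: image_image[symmetric])

lemma area_preserving_cong:
  assumes "area_preserving f" "\<And>x. x \<in> strip \<Longrightarrow> f x = g x"
  shows "area_preserving g"
proof -
  have "f ` A = g ` A" if "A \<subseteq> strip" for A using assms(2) that by (intro image_cong) auto
  then show ?thesis using assms(1) unfolding area_preserving_def by metis
qed

lemma UD_area_preserving_comp:
  assumes "area_preserving f" "area_preserving (g i)" "UD g J"
  shows "area_preserving (\<lambda>x. f (g i x))"
  using assms(1,2) by (rule area_preserving_comp) (use UD_image_borel[OF assms(3)] in auto)

text \<open>The image of a Borel set under the inner map is again an admissible set for the outer
  one, whose effect on areas can therefore be undone. This yields area preservation for inverses and
  for the triangular map at time 1.\<close>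

lemma UD_area_preserving_cancel:
  assumes "area_preserving (\<lambda>x. f i (g i x))" "area_preserving (f i)" "UD g J"
  shows "area_preserving (g i)"
  unfolding area_preserving_def
proof (intro ballI impI)
  fix A :: "(real \<times> real) set" assume A: "A \<in> sets borel" "A \<subseteq> strip"
  have "emeasure lborel (g i ` A) = emeasure lborel (f i ` (g i ` A))"
    using assms(2) UD_image_borel[OF assms(3) A] unfolding area_preserving_def by metis
  also have "\<dots> = emeasure lborel A"
    using assms(1) A unfolding area_preserving_def by (metis image_image)
  finally show "emeasure lborel (g i ` A) = emeasure lborel A" .
qed

lemma UD_area_preserving_inv:
  assumes "area_preserving (g i)" "UD g J"
  shows "area_preserving (inv_into strip (g i))"
proof (rule UD_area_preserving_cancel[where f = g and g = "\<lambda>i. inv_into strip (g i)", OF _ assms(1) UD_inv[OF assms(2)]])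
  have "area_preserving (\<lambda>x. x)" by (simp add: area_preserving_def)
  then show "area_preserving (\<lambda>x. g i (inv_into strip (g i) x))"
    by (rule area_preserving_cong) (simp add: bij_inv_strip(2)[OF UD_D(1)[OF assms(2)]])
qed

section \<open>The area-preserving rearrangement\<close>

lemma pdiff_section_q:
  assumes "pdiff g" "(q, p) \<in> strip"
  shows "((\<lambda>q. g (q, p)) has_vector_derivative dq g (q, p)) (at q)"
proof -
  have "((\<lambda>q. (q, p)) has_derivative (\<lambda>h. (h, 0))) (at q within UNIV)"
    by (auto intro!: derivative_eq_intros)
  moreover have "range (\<lambda>q. (q, p)) \<subseteq> strip" using assms(2) by (auto simp: strip_iff)
  ultimately show ?thesis
    using has_derivative_in_compose2[OF pdiffD[OF assms(1)], of "\<lambda>q. (q, p)" UNIV q "\<lambda>h. (h, 0)"]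
    by (simp add: has_vector_derivative_def)
qed

lemma pdiff_section_p:
  assumes "pdiff g" "(q, p) \<in> strip"
  shows "((\<lambda>p. g (q, p)) has_vector_derivative dp g (q, p)) (at p within {-1..1})"
proof -
  have "((\<lambda>p. (q, p)) has_derivative (\<lambda>h. (0, h))) (at p within {-1..1})"
    by (auto intro!: derivative_eq_intros)
  moreover have "(\<lambda>p. (q, p)) ` {-1..1} \<subseteq> strip" by (auto simp: strip_iff)
  ultimately show ?thesis
    using has_derivative_in_compose2[OF pdiffD[OF assms(1)], of "\<lambda>p. (q, p)" "{-1..1}" p "\<lambda>h. (0, h)"] assms(2)
    by (simp add: has_vector_derivative_def strip_iff)
qed

lemma strip_section:
  assumes "continuous_on strip f"
  shows "continuous_on {-1..1} (\<lambda>p. f (q, p))"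
  by (rule continuous_on_compose2[OF assms]) (auto intro!: continuous_intros simp: strip_iff)

text \<open>Symmetry of second derivatives up to the edges, where p-derivatives are one-sided.
  Differentiating the vertical integral of \<open>dp g\<close> in q under the integral sign exhibits
  \<open>dq g\<close> as a primitive in p of \<open>dq (dp g)\<close>.\<close>

lemma dp_dq_commute:
  fixes g :: "real \<times> real \<Rightarrow> real \<times> real"
  assumes g: "pdiff g" "pdiff (dq g)" "pdiff (dp g)" and c: "continuous_on strip (dq (dp g))"
    and x: "x \<in> strip"
  shows "dp (dq g) x = dq (dp g) x"
proof -
  obtain q p where qp: "x = (q, p)" by (cases x)
  have p: "p \<in> {-1..1}" using x by (simp add: qp strip_iff)
  have eq: "dq g (q, r) = dq g (q, -1) + integral {-1..r} (\<lambda>s. dq (dp g) (q, s))" if r: "r \<in> {-1..1}" for r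
  proof -
    have ftc: "integral {-1..r} (\<lambda>s. dp g (a, s)) = g (a, r) - g (a, -1)" for a
    proof (rule integral_unique, rule fundamental_theorem_of_calculus)
      show "((\<lambda>s. g (a, s)) has_vector_derivative dp g (a, s)) (at s within {-1..r})" if "s \<in> {-1..r}" for s
        using pdiff_section_p[OF g(1), of a s] that r
        by (auto simp: strip_iff intro: has_vector_derivative_within_subset)
    qed (use r in auto)
    have "((\<lambda>a. integral (cbox (-1) r) (\<lambda>s. dp g (a, s))) has_vector_derivative
        integral (cbox (-1) r) (\<lambda>s. dq (dp g) (q, s))) (at q within UNIV)"
    proof (rule leibniz_rule_vector_derivative)
      show "((\<lambda>a. dp g (a, s)) has_vector_derivative dq (dp g) (a, s)) (at a within UNIV)"
        if "s \<in> cbox (-1) r" for a s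
        using pdiff_section_q[OF g(3), of a s] that r by (simp add: strip_iff)
      show "(\<lambda>s. dp g (a, s)) integrable_on cbox (-1) r" for a
        using integrable_continuous_real[OF continuous_on_subset[OF strip_section[OF pdiff_continuous[OF g(3)], of a], of "{-1..r}"]] r
        by simp
      show "continuous_on (UNIV \<times> cbox (-1) r) (\<lambda>(a, s). dq (dp g) (a, s))"
        using c r by (auto simp: strip_def intro: continuous_on_subset)
    qed auto
    then have "((\<lambda>a. g (a, r) - g (a, -1)) has_vector_derivative integral {-1..r} (\<lambda>s. dq (dp g) (q, s))) (at q)"
      by (simp add: ftc)
    moreover have "((\<lambda>a. g (a, r) - g (a, -1)) has_vector_derivative dq g (q, r) - dq g (q, -1)) (at q)"
      using r by (intro has_vector_derivative_diff pdiff_section_q g) (auto simp: strip_iff)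
    ultimately show ?thesis using vector_derivative_unique_at by fastforce
  qed
  have "((\<lambda>r. integral {-1..r} (\<lambda>s. dq (dp g) (q, s))) has_vector_derivative dq (dp g) (q, p)) (at p within {-1..1})"
    using strip_section[OF c] p by (rule integral_has_vector_derivative)
  then have "((\<lambda>r. dq g (q, -1) + integral {-1..r} (\<lambda>s. dq (dp g) (q, s))) has_vector_derivative dq (dp g) (q, p)) (at p within {-1..1})"
    by (intro derivative_eq_intros) auto
  then have "((\<lambda>r. dq g (q, r)) has_vector_derivative dq (dp g) (q, p)) (at p within {-1..1})"
    by (rule has_vector_derivative_transform[OF p, rotated]) (rule eq)
  moreover have "((\<lambda>r. dq g (q, r)) has_vector_derivative dp (dq g) (q, p)) (at p within {-1..1})"
    using pdiff_section_p[OF g(2)] x qp by simp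
  ultimately show ?thesis
    unfolding qp using p by (intro vector_derivative_unique_within_closed_interval[of "-1" 1 p]) auto
qed

lemma vint_section_q:
  assumes fq: "\<And>q p. (q, p) \<in> strip \<Longrightarrow> ((\<lambda>q. f (q, p)) has_real_derivative fq (q, p)) (at q)"
    and c: "continuous_on strip f" "continuous_on strip fq" and p: "p \<in> {-1..1}"
  shows "((\<lambda>q. vint f (q, p)) has_real_derivative vint fq (q, p)) (at q)"
proof -
  have "((\<lambda>a. integral (cbox (-1) p) (\<lambda>s. f (a, s))) has_real_derivative
      integral (cbox (-1) p) (\<lambda>s. fq (q, s))) (at q within UNIV)"
  proof (rule leibniz_rule_field_derivative)
    show "((\<lambda>a. f (a, s)) has_real_derivative fq (a, s)) (at a within UNIV)"
      if "s \<in> cbox (-1) p" for a s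
      using fq[of a s] that p by (simp add: strip_iff)
    show "(\<lambda>s. f (a, s)) integrable_on cbox (-1) p" for a
      using integrable_continuous_real[OF continuous_on_subset[OF strip_section[OF c(1), of a], of "{-1..p}"]] p
      by simp
    show "continuous_on (UNIV \<times> cbox (-1) p) (\<lambda>(a, s). fq (a, s))"
      using c(2) p by (auto simp: strip_def intro: continuous_on_subset)
  qed auto
  then show ?thesis by (simp add: vint_def)
qed

text \<open>Leibniz rule in q and fundamental theorem in p. Total differentiability follows because
  the p-partial is the integrand itself, which is continuous.\<close>

lemma vint_has_derivative:
  assumes fq: "\<And>q p. (q, p) \<in> strip \<Longrightarrow> ((\<lambda>q. f (q, p)) has_real_derivative fq (q, p)) (at q)"
    and c: "continuous_on strip f" "continuous_on strip fq" and x: "x \<in> strip"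
  shows "(vint f has_derivative (\<lambda>(u, v). vint fq x * u + f x * v)) (at x within strip)"
proof -
  obtain q p where qp: "x = (q, p)" by (cases x)
  have p: "p \<in> {-1..1}" using x by (simp add: qp strip_iff)
  have "((\<lambda>(a, b). vint f (a, b)) has_derivative (\<lambda>(u, v). vint fq (q, p) * u + blinfun_mult_right (f (q, p)) v))
      (at (q, p) within UNIV \<times> {-1..1})"
  proof (rule has_derivative_partialsI)
    show "((\<lambda>a. vint f (a, p)) has_derivative (*) (vint fq (q, p))) (at q within UNIV)"
      using vint_section_q[OF fq c p] by (simp add: has_field_derivative_def)
    have "blinfun_apply (blinfun_mult_right (f (a, b))) = (\<lambda>h. h *\<^sub>R f (a, b))" for a b by auto
    then show "((\<lambda>b. vint f (a, b)) has_derivative blinfun_apply (blinfun_mult_right (f (a, b)))) (at b within {-1..1})"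
      if "b \<in> {-1..1}" for a b
      using integral_has_vector_derivative[OF strip_section[OF c(1), of a] that]
      unfolding vint_def has_vector_derivative_def by simp
    show "continuous (at (q, p) within UNIV \<times> {-1..1}) (\<lambda>(a, b). blinfun_mult_right (f (a, b)))"
    proof -
      have "continuous (at x within strip) f"
        using c(1) x by (simp add: continuous_on_eq_continuous_within)
      then have "continuous (at x within strip) (\<lambda>z. blinfun_mult_right (f z))"
        by (rule bounded_linear.continuous[OF bounded_linear_blinfun_mult_right])
      moreover have "(\<lambda>(a, b). blinfun_mult_right (f (a, b))) = (\<lambda>z. blinfun_mult_right (f z))" by auto
      ultimately show ?thesis by (simp add: qp strip_def)
    qed
  qed (use p in auto)
  then show ?thesis by (simp add: strip_def qp)
qed

definition Jac :: "(real \<times> real \<Rightarrow> real \<times> real) \<Rightarrow> real \<times> real \<Rightarrow> mat2" where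
  "Jac g x = (fst (dq g x), fst (dp g x), snd (dq g x), snd (dp g x))"

definition dens :: "(real \<times> real \<Rightarrow> real \<times> real) \<Rightarrow> real \<times> real \<Rightarrow> real" where
  "dens g x = mdet (Jac g x)"

lemma displacement_partials:
  fixes g :: "real \<times> real \<Rightarrow> real \<times> real"
  assumes g: "pdiff (\<lambda>x. g x - x)" and x: "x \<in> strip"
  shows "dq g x = dq (\<lambda>x. g x - x) x + (1, 0)" "dp g x = dp (\<lambda>x. g x - x) x + (0, 1)"
    "(g has_derivative mapp (Jac g x)) (at x within strip)"
proof -
  let ?e = "\<lambda>x. g x - x"
  have "((\<lambda>y. ?e y + y) has_derivative (\<lambda>h. (\<lambda>(u, v). u *\<^sub>R dq ?e x + v *\<^sub>R dp ?e x) h + h)) (at x within strip)"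
    by (intro has_derivative_add pdiffD[OF g x] has_derivative_ident)
  then have d: "(g has_derivative (\<lambda>h. (\<lambda>(u, v). u *\<^sub>R dq ?e x + v *\<^sub>R dp ?e x) h + h)) (at x within strip)"
    by simp
  show q: "dq g x = dq ?e x + (1, 0)" and p: "dp g x = dp ?e x + (0, 1)"
    using dq_eq[OF d x] dp_eq[OF d x] by auto
  show "(g has_derivative mapp (Jac g x)) (at x within strip)"
    using d by (rule has_derivative_eq_rhs) (auto simp: fun_eq_iff mapp_def Jac_def q p prod_eq_iff algebra_simps)
qed

lemma dens_displacement:
  fixes g :: "real \<times> real \<Rightarrow> real \<times> real"
  assumes "pdiff (\<lambda>x. g x - x)" "x \<in> strip"
  defines "e \<equiv> \<lambda>x. g x - x"
  shows "dens g x = (1 + fst (dq e x)) * (1 + snd (dp e x)) - fst (dp e x) * snd (dq e x)"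
  using displacement_partials[OF assms(1,2)] by (simp add: e_def dens_def mdet_def Jac_def add.commute)

text \<open>
  Half the signed area between the curve \<open>g ({q} \<times> [-1, 1])\<close> and the vertical line through \<open>q\<close>.
\<close>

definition area_shift :: "(real \<times> real \<Rightarrow> real \<times> real) \<Rightarrow> real \<Rightarrow> real" where
  "area_shift g q = 1 / 2 * vint (\<lambda>x. fst (g x - x) * snd (dp g x)) (q, 1)"

text \<open>
  The Knothe rearrangement transporting the density \<open>dens g\<close> to the Lebesgue measure. Adding
  \<open>area_shift g q\<close> in the first component yields a primitive of \<open>vint (dens g) (q, 1) / 2\<close> that is
  at bounded distance from the identity and is compatible with translations in \<open>q\<close>.
\<close>

definition rearr :: "(real \<times> real \<Rightarrow> real \<times> real) \<Rightarrow> real \<times> real \<Rightarrow> real \<times> real" where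
  "rearr g x = (fst x + area_shift g (fst x), 2 * vint (dens g) x / vint (dens g) (fst x, 1) - 1)"

lemma fst_snd_norm: "\<bar>fst z\<bar> \<le> norm z" "\<bar>snd z\<bar> \<le> norm z" for z :: "real \<times> real"
  using norm_fst_le[of "fst z" "snd z"] norm_snd_le[of "snd z" "fst z"] by auto

text \<open>The index stands for \<omega>, and \<open>K\<close>, \<open>L\<close>,
  \<open>\<delta>\<close> are common to all indices. The conditions are imposed for every index,
  since the identity path will be substituted on the exceptional orbits.\<close>

locale C3_isotopy =
  fixes F v :: "'i \<Rightarrow> real \<Rightarrow> real \<times> real \<Rightarrow> real \<times> real" and K L \<delta> :: real
  assumes path: "\<And>i. Cr_path (\<lambda>t x. F i t x - x) (v i) K"
    and F_bij: "\<And>i t. t \<in> {0..1} \<Longrightarrow> bij_betw (F i t) strip strip"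
    and F_bdry: "\<And>i t x. t \<in> {0..1} \<Longrightarrow> x \<in> strip \<Longrightarrow>
      (snd (F i t x) = 1 \<longleftrightarrow> snd x = 1) \<and> (snd (F i t x) = -1 \<longleftrightarrow> snd x = -1)"
    and F_inv_lip: "\<And>i t x y. t \<in> {0..1} \<Longrightarrow> x \<in> strip \<Longrightarrow> y \<in> strip \<Longrightarrow>
      norm (x - y) \<le> L * norm (F i t x - F i t y)"
    and \<delta>_pos: "\<delta> > 0"
    and det_ge: "\<And>i t x. t \<in> {0..1} \<Longrightarrow> x \<in> strip \<Longrightarrow> \<delta> \<le> dens (F i t) x"
    and F_0: "\<And>i x. x \<in> strip \<Longrightarrow> F i 0 x = x"
begin

definition e where "e i t x = F i t x - x"

lemma Cr_path_e: "Cr_path (e i) (v i) K"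
  using path[of i] unfolding e_def .

lemmas e_D = Cr_path.e_D[OF Cr_path_e]

lemma F_partials:
  assumes "t \<in> {0..1}" "x \<in> strip"
  shows "dq (F i t) x = dq (e i t) x + (1, 0)" "dp (F i t) x = dp (e i t) x + (0, 1)"
  using displacement_partials[OF e_D(1)[OF assms(1), unfolded e_def] assms(2)] by (simp_all add: e_def[abs_def])

text \<open>The increment is split at the intermediate value \<open>g i s x\<close>: first time
  changes, then the point.\<close>

lemma BL_of_path:
  assumes g: "\<And>i t. t \<in> {0..1} \<Longrightarrow> pdiff (g i t)"
    and b: "\<And>i t x. t \<in> {0..1} \<Longrightarrow> x \<in> strip \<Longrightarrow> norm (g i t x) \<le> K"
      "\<And>i t x. t \<in> {0..1} \<Longrightarrow> x \<in> strip \<Longrightarrow> norm (dq (g i t) x) \<le> K"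
      "\<And>i t x. t \<in> {0..1} \<Longrightarrow> x \<in> strip \<Longrightarrow> norm (dp (g i t) x) \<le> K"
    and tl: "\<And>i s t x. s \<in> {0..1} \<Longrightarrow> t \<in> {0..1} \<Longrightarrow> x \<in> strip \<Longrightarrow> norm (g i s x - g i t x) \<le> C * \<bar>s - t\<bar>"
  shows "BL (\<lambda>i t x. fst (g i t x :: real \<times> real))" "BL (\<lambda>i t x. snd (g i t x))"
proof -
  have *: "norm (g i t x - g i s y) \<le> max C (2 * K) * (\<bar>t - s\<bar> + norm (x - y))"
    if "t \<in> {0..1}" "s \<in> {0..1}" "x \<in> strip" "y \<in> strip" for i s t x y
  proof -
    have "norm (g i t x - g i s y) \<le> norm (g i t x - g i s x) + norm (g i s x - g i s y)"
      using norm_triangle_ineq[of "g i t x - g i s x" "g i s x - g i s y"] by simp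
    also have "\<dots> \<le> C * \<bar>t - s\<bar> + 2 * K * norm (x - y)"
      by (intro add_mono tl pdiff_lipschitz g b that)
    also have "\<dots> \<le> max C (2 * K) * \<bar>t - s\<bar> + max C (2 * K) * norm (x - y)"
      by (intro add_mono mult_right_mono) auto
    finally show ?thesis by (simp add: algebra_simps)
  qed
  show "BL (\<lambda>i t x. fst (g i t x))"
    by (rule BL_I[where A = K and B = "max C (2 * K)"])
      (rule order_trans[OF fst_snd_norm(1) b(1)], assumption+,
       unfold fst_diff[symmetric], rule order_trans[OF fst_snd_norm(1) *], assumption+)
  show "BL (\<lambda>i t x. snd (g i t x))"
    by (rule BL_I[where A = K and B = "max C (2 * K)"])
      (rule order_trans[OF fst_snd_norm(2) b(1)], assumption+,
       unfold snd_diff[symmetric], rule order_trans[OF fst_snd_norm(2) *], assumption+)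
qed

lemmas time_lip = Cr_path.time_lip_0[OF Cr_path_e] Cr_path.time_lip_d1[OF Cr_path_e] Cr_path.time_lip_d2[OF Cr_path_e]

text \<open>These are the quantities entering \<open>dens\<close>, \<open>densq\<close> and
  \<open>area_shift\<close>. The spatial Lipschitz bounds of the second derivatives use up the third
  ones.\<close>

lemma BL_e:
  shows "BL (\<lambda>i t x. fst (e i t x))" "BL (\<lambda>i t x. snd (e i t x))"
    "BL (\<lambda>i t x. fst (dq (e i t) x))" "BL (\<lambda>i t x. snd (dq (e i t) x))"
    "BL (\<lambda>i t x. fst (dp (e i t) x))" "BL (\<lambda>i t x. snd (dp (e i t) x))"
    "BL (\<lambda>i t x. fst (dq (dq (e i t)) x))" "BL (\<lambda>i t x. snd (dq (dq (e i t)) x))"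
    "BL (\<lambda>i t x. fst (dq (dp (e i t)) x))" "BL (\<lambda>i t x. snd (dq (dp (e i t)) x))"
  by (rule BL_of_path, (rule e_D time_lip; assumption)+)+

text \<open>The q-derivative of the determinant, by the product rule, with all mixed derivatives
  taken in the order \<open>dq (dp _)\<close>.\<close>

definition densq where
  "densq i t x = fst (dq (dq (e i t)) x) * (1 + snd (dp (e i t) x)) + (1 + fst (dq (e i t) x)) * snd (dq (dp (e i t)) x)
     - (fst (dq (dp (e i t)) x) * snd (dq (e i t) x) + fst (dp (e i t) x) * snd (dq (dq (e i t)) x))"

lemma dens_eq:
  assumes "t \<in> {0..1}" "x \<in> strip"
  shows "dens (F i t) x = (1 + fst (dq (e i t) x)) * (1 + snd (dp (e i t) x)) - fst (dp (e i t) x) * snd (dq (e i t) x)"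
  using dens_displacement[OF e_D(1)[OF assms(1), unfolded e_def] assms(2)] by (simp add: e_def[abs_def])

lemma BL_dens: "BL (\<lambda>i t. dens (F i t))"
  by (rule BL_cong[OF BL_diff[OF BL_mult[OF BL_add[OF BL_const[of 1] BL_e(3)] BL_add[OF BL_const[of 1] BL_e(6)]] BL_mult[OF BL_e(5) BL_e(4)]]])
    (simp add: dens_eq)

lemma BL_densq: "BL densq"
  unfolding densq_def by (intro BL_diff BL_add BL_mult BL_const BL_e)

lemma section_q_real:
  assumes "pdiff g" "(q, p) \<in> strip"
  shows "((\<lambda>q. fst (g (q, p) :: real \<times> real)) has_real_derivative fst (dq g (q, p))) (at q)"
    "((\<lambda>q. snd (g (q, p))) has_real_derivative snd (dq g (q, p))) (at q)"
  using pdiff_section_q[OF assms]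
  by (auto simp: has_real_derivative_iff_has_vector_derivative
      intro: bounded_linear.has_vector_derivative[OF bounded_linear_fst] bounded_linear.has_vector_derivative[OF bounded_linear_snd])

lemma section_p_real:
  assumes "pdiff g" "(q, p) \<in> strip"
  shows "((\<lambda>p. fst (g (q, p) :: real \<times> real)) has_real_derivative fst (dp g (q, p))) (at p within {-1..1})"
    "((\<lambda>p. snd (g (q, p))) has_real_derivative snd (dp g (q, p))) (at p within {-1..1})"
  using pdiff_section_p[OF assms]
  by (auto simp: has_real_derivative_iff_has_vector_derivative
      intro: bounded_linear.has_vector_derivative[OF bounded_linear_fst] bounded_linear.has_vector_derivative[OF bounded_linear_snd])

lemma dens_section:
  assumes t: "t \<in> {0..1}" and x: "(q, p) \<in> strip"
  shows "((\<lambda>q. dens (F i t) (q, p)) has_real_derivative densq i t (q, p)) (at q)"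
proof -
  have "(a, p) \<in> strip" for a using x by (simp add: strip_iff)
  then have "(\<lambda>q. dens (F i t) (q, p)) = (\<lambda>q. (1 + fst (dq (e i t) (q, p))) * (1 + snd (dp (e i t) (q, p)))
      - fst (dp (e i t) (q, p)) * snd (dq (e i t) (q, p)))"
    using t by (simp add: dens_eq)
  then show ?thesis
    unfolding densq_def
    by (auto intro!: derivative_eq_intros section_q_real e_D t x)
qed

text \<open>Each edge is mapped into itself, so the vertical displacement vanishes along it. This
  kills the boundary terms of the integration by parts in \<open>area_shift_deriv\<close>.\<close>

lemma e_bdry:
  assumes t: "t \<in> {0..1}" and r: "r = 1 \<or> r = -1"
  shows "snd (dq (e i t) (q, r)) = 0"
proof -
  have x: "(q, r) \<in> strip" for q using r by (auto simp: strip_iff)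
  have "snd (F i t (a, r)) = r" for a using F_bdry[OF t x] r by auto
  then have "(\<lambda>q. snd (e i t (q, r))) = (\<lambda>q. 0)" by (simp add: e_def)
  then show ?thesis using section_q_real(2)[OF e_D(1)[OF t] x, of i q] DERIV_unique DERIV_const by metis
qed

definition m where "m i t q = vint (dens (F i t)) (q, 1)"
definition mq where "mq i t q = vint (densq i t) (q, 1)"

lemma area_shift_eq:
  assumes t: "t \<in> {0..1}"
  shows "area_shift (F i t) q = 1 / 2 * vint (\<lambda>x. fst (e i t x) * (1 + snd (dp (e i t) x))) (q, 1)"
proof -
  have "integral {-1..1} (\<lambda>s. fst (F i t (q, s) - (q, s)) * snd (dp (F i t) (q, s))) =
     integral {-1..1} (\<lambda>s. fst (e i t (q, s)) * (1 + snd (dp (e i t) (q, s))))"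
    by (rule integral_cong) (use t in \<open>simp add: F_partials strip_iff e_def add.commute\<close>)
  then show ?thesis by (simp add: area_shift_def vint_def)
qed

text \<open>Integration by parts in p. The integral of \<open>P\<close> is 2 because the second
  component runs from -1 to 1 along a vertical segment; what remains of the integrated density is
  the q-derivative of the integral of \<open>E1 * P\<close>, that is, of twice the shift.\<close>

lemma area_shift_deriv:
  assumes t: "t \<in> {0..1}"
  shows "((\<lambda>q. area_shift (F i t) q) has_real_derivative (m i t q / 2 - 1)) (at q)"
proof -
  define E1 P where "E1 x = fst (e i t x)" and "P x = 1 + snd (dp (e i t) x)" for x
  define E1q E1p Pq P1 where "E1q x = fst (dq (e i t) x)" and "E1p x = fst (dp (e i t) x)"
    and "Pq x = snd (dq (dp (e i t)) x)" and "P1 x = snd (dq (e i t) x)" for x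
  have c: "continuous_on strip E1" "continuous_on strip P" "continuous_on strip E1q" "continuous_on strip E1p"
    "continuous_on strip Pq" "continuous_on strip P1"
    unfolding E1_def P_def E1q_def E1p_def Pq_def P1_def
    by (rule BL_continuous[OF BL_e(1) t] BL_continuous[OF BL_add[OF BL_const BL_e(6)] t] BL_continuous[OF BL_e(3) t]
        BL_continuous[OF BL_e(5) t] BL_continuous[OF BL_e(10) t] BL_continuous[OF BL_e(4) t])+
  have d1: "((\<lambda>q. vint (\<lambda>x. E1 x * P x) (q, 1)) has_real_derivative vint (\<lambda>x. E1q x * P x + E1 x * Pq x) (q, 1)) (at q)"
  proof (rule vint_section_q)
    show "((\<lambda>q. E1 (q, p) * P (q, p)) has_real_derivative E1q (q, p) * P (q, p) + E1 (q, p) * Pq (q, p)) (at q)"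
      if "(q, p) \<in> strip" for q p
      unfolding E1_def P_def E1q_def Pq_def
      by (auto intro!: derivative_eq_intros section_q_real e_D t that)
  qed (auto intro!: continuous_intros c)
  have int: "(\<lambda>s. f (q, s)) integrable_on {-1..1}" if "continuous_on strip f" for f :: "real \<times> real \<Rightarrow> real"
    using strip_section[OF that] by (rule integrable_continuous_real)
  \<comment> \<open>By symmetry of the mixed derivatives the integrand is the p-derivative of
    \<open>E1 * P1\<close>, and \<open>P1\<close> vanishes on both edges.\<close>
  have parts: "integral {-1..1} (\<lambda>s. E1p (q, s) * P1 (q, s) + E1 (q, s) * Pq (q, s)) = 0"
  proof -
    have "((\<lambda>s. E1p (q, s) * P1 (q, s) + E1 (q, s) * Pq (q, s)) has_integral
        (E1 (q, 1) * P1 (q, 1) - E1 (q, -1) * P1 (q, -1))) {-1..1}"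
    proof (rule fundamental_theorem_of_calculus)
      fix s :: real assume s: "s \<in> {-1..1}"
      then have x: "(q, s) \<in> strip" by (simp add: strip_iff)
      have "continuous_on strip (dq (dp (e i t)))" by (intro pdiff_continuous e_D t)
      then have "dp (dq (e i t)) (q, s) = dq (dp (e i t)) (q, s)"
        by (intro dp_dq_commute e_D t x)
      then have "((\<lambda>s. P1 (q, s)) has_real_derivative Pq (q, s)) (at s within {-1..1})"
        using section_p_real(2)[OF e_D(2)[OF t] x, of i] by (simp add: P1_def Pq_def)
      then have "((\<lambda>s. E1 (q, s) * P1 (q, s)) has_real_derivative E1p (q, s) * P1 (q, s) + E1 (q, s) * Pq (q, s)) (at s within {-1..1})"
        unfolding E1_def E1p_def by (auto intro!: derivative_eq_intros section_p_real e_D t x)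
      then show "((\<lambda>s. E1 (q, s) * P1 (q, s)) has_vector_derivative E1p (q, s) * P1 (q, s) + E1 (q, s) * Pq (q, s)) (at s within {-1..1})"
        by (simp add: has_real_derivative_iff_has_vector_derivative)
    qed simp
    moreover have "P1 (q, 1) = 0" "P1 (q, -1) = 0" unfolding P1_def using e_bdry[OF t] by auto
    ultimately show ?thesis by (simp add: integral_unique)
  qed
  have total: "integral {-1..1} (\<lambda>s. P (q, s)) = 2"
  proof -
    have "((\<lambda>s. P (q, s)) has_integral (1 + snd (e i t (q, 1)) - (-1 + snd (e i t (q, -1))))) {-1..1}"
    proof (rule fundamental_theorem_of_calculus)
      fix s :: real assume s: "s \<in> {-1..1}"
      then have x: "(q, s) \<in> strip" by (simp add: strip_iff)
      have "((\<lambda>s. s + snd (e i t (q, s))) has_real_derivative P (q, s)) (at s within {-1..1})"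
        unfolding P_def by (auto intro!: derivative_eq_intros section_p_real e_D t x)
      then show "((\<lambda>s. s + snd (e i t (q, s))) has_vector_derivative P (q, s)) (at s within {-1..1})"
        by (simp add: has_real_derivative_iff_has_vector_derivative)
    qed simp
    moreover have "snd (e i t (q, 1)) = 0" "snd (e i t (q, -1)) = 0"
      using F_bdry[OF t, of "(q, 1)" i] F_bdry[OF t, of "(q, -1)" i] by (auto simp: e_def strip_iff)
    ultimately show ?thesis by (simp add: integral_unique)
  qed
  \<comment> \<open>\<open>E1 * Pq\<close> is added and subtracted: it completes the q-derivative of
    \<open>E1 * P\<close> in one bracket and the p-derivative of \<open>E1 * P1\<close> in the
    other.\<close>
  have "m i t q = integral {-1..1} (\<lambda>s. P (q, s) + ((E1q (q, s) * P (q, s) + E1 (q, s) * Pq (q, s))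
      - (E1p (q, s) * P1 (q, s) + E1 (q, s) * Pq (q, s))))"
    unfolding m_def vint_def fst_conv snd_conv
    by (rule integral_cong) (use t in \<open>simp add: dens_eq strip_iff E1q_def P_def E1p_def P1_def algebra_simps\<close>)
  also have "\<dots> = integral {-1..1} (\<lambda>s. P (q, s)) + (integral {-1..1} (\<lambda>s. E1q (q, s) * P (q, s) + E1 (q, s) * Pq (q, s))
      - integral {-1..1} (\<lambda>s. E1p (q, s) * P1 (q, s) + E1 (q, s) * Pq (q, s)))"
  proof -
    have iP: "(\<lambda>s. P (q, s)) integrable_on {-1..1}" by (rule int[OF c(2)])
    have iX: "(\<lambda>s. E1q (q, s) * P (q, s) + E1 (q, s) * Pq (q, s)) integrable_on {-1..1}"
      by (rule int) (intro continuous_intros c)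
    have iY: "(\<lambda>s. E1p (q, s) * P1 (q, s) + E1 (q, s) * Pq (q, s)) integrable_on {-1..1}"
      by (rule int) (intro continuous_intros c)
    show ?thesis
      by (simp only: integral_add[OF iP integrable_diff[OF iX iY]] integral_diff[OF iX iY])
  qed
  also have "\<dots> = 2 + vint (\<lambda>x. E1q x * P x + E1 x * Pq x) (q, 1)"
    unfolding total parts by (simp add: vint_def)
  finally have "m i t q / 2 - 1 = 1 / 2 * vint (\<lambda>x. E1q x * P x + E1 x * Pq x) (q, 1)" by linarith
  moreover have "area_shift (F i t) = (\<lambda>q. 1 / 2 * vint (\<lambda>x. E1 x * P x) (q, 1))"
    using area_shift_eq[OF t] by (auto simp: E1_def P_def)
  ultimately show ?thesis using DERIV_cmult[OF d1, of "1 / 2"] by (simp only:)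
qed

end

section \<open>Derivative, inverse bounds and bijectivity of the triangular map\<close>

context C3_isotopy begin

abbreviation T where "T i t \<equiv> rearr (F i t)"

text \<open>Lower triangular, as the first component of \<open>T\<close> depends on q alone. The
  entry m / 2 comes from \<open>area_shift_deriv\<close>, the bottom row from the quotient rule; in
  the product of the diagonal entries m / 2 cancels and the density remains.\<close>

definition JT :: "'i \<Rightarrow> real \<Rightarrow> real \<times> real \<Rightarrow> mat2" where
  "JT i t x = (m i t (fst x) / 2, 0,
     2 * (vint (densq i t) x * m i t (fst x) - vint (dens (F i t)) x * mq i t (fst x)) / (m i t (fst x) * m i t (fst x)),
     2 * dens (F i t) x / m i t (fst x))"

lemma T_eq: "T i t (q, p) = (q + area_shift (F i t) q, 2 * vint (dens (F i t)) (q, p) / m i t q - 1)"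
  by (simp add: rearr_def m_def)

lemma vint_dens_increase:
  assumes t: "t \<in> {0..1}" and p: "-1 \<le> p'" "p' \<le> p" "p \<le> 1"
  shows "\<delta> * (p - p') \<le> vint (dens (F i t)) (q, p) - vint (dens (F i t)) (q, p')"
proof -
  have "vint (dens (F i t)) (q, p) = vint (dens (F i t)) (q, p') + integral {p'..p} (\<lambda>r. dens (F i t) (q, r))"
    unfolding vint_def fst_conv snd_conv using p
    by (subst Henstock_Kurzweil_Integration.integral_combine) (auto intro!: BL_line_integrable[OF BL_dens t])
  moreover have "integral {p'..p} (\<lambda>r. \<delta>) \<le> integral {p'..p} (\<lambda>r. dens (F i t) (q, r))"
    by (rule integral_le) (use p det_ge[OF t] in \<open>auto intro!: BL_line_integrable[OF BL_dens t] simp: strip_iff\<close>)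
  ultimately show ?thesis using p by (simp add: mult.commute)
qed

lemma vint_bottom: "vint f (q, -1) = 0"
  by (simp add: vint_def)

lemma m_ge: "t \<in> {0..1} \<Longrightarrow> 2 * \<delta> \<le> m i t q"
  using vint_dens_increase[of t "-1" 1 i q] by (simp add: m_def vint_bottom)

lemma m_pos: "t \<in> {0..1} \<Longrightarrow> 0 < m i t q"
  using m_ge[of t i q] \<delta>_pos by simp

lemma BL_m: "BL (\<lambda>i t x. m i t (fst x))" and BL_mq: "BL (\<lambda>i t x. mq i t (fst x))"
  unfolding m_def mq_def by (intro BL_top[OF BL_vint] BL_dens BL_densq)+

lemma m_deriv:
  assumes "t \<in> {0..1}"
  shows "((\<lambda>q. m i t q) has_real_derivative mq i t q) (at q)"
  unfolding m_def mq_def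
  by (rule vint_section_q[OF dens_section[OF assms]])
    (auto intro: BL_continuous[OF BL_dens assms] BL_continuous[OF BL_densq assms])

lemma T_has_derivative:
  assumes t: "t \<in> {0..1}" and x: "x \<in> strip"
  shows "(T i t has_derivative mapp (JT i t x)) (at x within strip)"
proof -
  have R: "(vint (dens (F i t)) has_derivative (\<lambda>(u, v). vint (densq i t) x * u + dens (F i t) x * v)) (at x within strip)"
    by (rule vint_has_derivative[OF dens_section[OF t]])
      (auto intro: BL_continuous[OF BL_dens t] BL_continuous[OF BL_densq t] x)
  have f: "(fst has_derivative fst) (at x within strip)"
    by (rule bounded_linear_imp_has_derivative[OF bounded_linear_fst])
  have m': "((\<lambda>y. m i t (fst y)) has_derivative (\<lambda>h. mq i t (fst x) * fst h)) (at x within strip)"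
    using has_derivative_compose[OF f m_deriv[OF t, of i "fst x", unfolded has_field_derivative_def]] .
  have a': "((\<lambda>y. fst y + area_shift (F i t) (fst y)) has_derivative (\<lambda>h. fst h + (m i t (fst x) / 2 - 1) * fst h)) (at x within strip)"
    using has_derivative_add[OF f has_derivative_compose[OF f area_shift_deriv[OF t, of i "fst x", unfolded has_field_derivative_def]]] .
  have m0: "m i t (fst x) \<noteq> 0" using m_pos[OF t, of i "fst x"] by simp
  have b': "((\<lambda>y. 2 * (vint (dens (F i t)) y / m i t (fst y)) - 1) has_derivative
      (\<lambda>h. 2 * (((\<lambda>(u, v). vint (densq i t) x * u + dens (F i t) x * v) h * m i t (fst x) - vint (dens (F i t)) x * (mq i t (fst x) * fst h))
        / (m i t (fst x) * m i t (fst x))) - 0)) (at x within strip)"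
    by (intro has_derivative_diff has_derivative_mult_right has_derivative_divide' R m' m0 has_derivative_const)
  have T: "(\<lambda>y. (fst y + area_shift (F i t) (fst y), 2 * (vint (dens (F i t)) y / m i t (fst y)) - 1)) = T i t"
    by (auto simp: T_eq fun_eq_iff)
  show ?thesis
    using has_derivative_Pair[OF a' b'] unfolding T
    by (rule has_derivative_eq_rhs) (use m0 in \<open>auto simp: fun_eq_iff mapp_def JT_def divide_simps, auto simp: algebra_simps\<close>)
qed

lemma T_snd_increase:
  assumes t: "t \<in> {0..1}" and p: "-1 \<le> p'" "p' \<le> p" "p \<le> 1"
  shows "2 * \<delta> / m i t q * (p - p') \<le> snd (T i t (q, p)) - snd (T i t (q, p'))"
proof -
  have "(2 / m i t q) * (\<delta> * (p - p')) \<le> (2 / m i t q) * (vint (dens (F i t)) (q, p) - vint (dens (F i t)) (q, p'))"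
    using m_pos[OF t, of i q] by (intro mult_left_mono vint_dens_increase t p) auto
  then show ?thesis by (simp add: T_eq algebra_simps)
qed

lemma T_bdry:
  assumes t: "t \<in> {0..1}"
  shows "snd (T i t (q, 1)) = 1" "snd (T i t (q, -1)) = -1"
  using m_pos[OF t, of i q] by (auto simp: T_eq vint_bottom m_def)

text \<open>The slope bound, applied from each edge, keeps the image of an inner point at a distance
  from that edge proportional to its own.\<close>

lemma T_snd_bounds:
  assumes t: "t \<in> {0..1}" and x: "(q, p) \<in> strip"
  shows "-1 \<le> snd (T i t (q, p))" "snd (T i t (q, p)) \<le> 1"
    "snd (T i t (q, p)) = 1 \<longleftrightarrow> p = 1" "snd (T i t (q, p)) = -1 \<longleftrightarrow> p = -1"
proof -
  have p: "-1 \<le> p" "p \<le> 1" using x by (auto simp: strip_iff)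
  define c where "c = 2 * \<delta> / m i t q"
  have c: "c > 0" unfolding c_def using m_pos[OF t, of i q] \<delta>_pos by simp
  have 1: "c * (p + 1) \<le> snd (T i t (q, p)) + 1"
    unfolding c_def using T_snd_increase[OF t _ p(1) p(2), of i q] T_bdry(2)[OF t, of i q] by simp
  have 2: "c * (1 - p) \<le> 1 - snd (T i t (q, p))"
    unfolding c_def using T_snd_increase[OF t p order_refl, of i q] T_bdry(1)[OF t, of i q] by simp
  have 3: "0 \<le> c * (p + 1)" "0 \<le> c * (1 - p)"
    using mult_nonneg_nonneg[OF less_imp_le[OF c]] p by simp_all
  show "-1 \<le> snd (T i t (q, p))" "snd (T i t (q, p)) \<le> 1" using 1 2 3 by linarith+
  have "p = 1" if "snd (T i t (q, p)) = 1"
  proof -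
    have "c * (1 - p) \<le> 0" using 2 that by simp
    then have "1 - p \<le> 0" using c by (simp add: mult_le_0_iff)
    then show ?thesis using p by simp
  qed
  then show "snd (T i t (q, p)) = 1 \<longleftrightarrow> p = 1" using T_bdry(1)[OF t] by auto
  have "p = -1" if "snd (T i t (q, p)) = -1"
  proof -
    have "c * (p + 1) \<le> 0" using 1 that by simp
    then have "p + 1 \<le> 0" using c by (simp add: mult_le_0_iff)
    then show ?thesis using p by simp
  qed
  then show "snd (T i t (q, p)) = -1 \<longleftrightarrow> p = -1" using T_bdry(2)[OF t] by auto
qed

text \<open>The derivative of the first component is m / 2, hence at least
  \<open>\<delta>\<close>.\<close>

lemma T_fst_increase:
  assumes t: "t \<in> {0..1}" and q: "q' \<le> q"
  shows "\<delta> * (q - q') \<le> (q + area_shift (F i t) q) - (q' + area_shift (F i t) q')"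
proof -
  have "\<exists>y. ((\<lambda>q. q + area_shift (F i t) q - \<delta> * q) has_real_derivative y) (at z) \<and> 0 \<le> y" for z
  proof (intro exI conjI)
    show "((\<lambda>q. q + area_shift (F i t) q - \<delta> * q) has_real_derivative (1 + (m i t z / 2 - 1) - \<delta>)) (at z)"
      by (auto intro!: derivative_eq_intros area_shift_deriv t)
    show "0 \<le> 1 + (m i t z / 2 - 1) - \<delta>" using m_ge[OF t, of i z] by simp
  qed
  from DERIV_nonneg_imp_nondecreasing[OF q this] show ?thesis by (simp add: algebra_simps)
qed

lemma BL_area_shift: "BL (\<lambda>i t x. area_shift (F i t) (fst x))"
  by (rule BL_cong[OF BL_mult[OF BL_const[of "1 / 2"] BL_top[OF BL_vint[OF BL_mult[OF BL_e(1) BL_add[OF BL_const[of 1] BL_e(6)]]]]]])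
    (simp add: area_shift_eq)

lemma BL_T_snd: "BL (\<lambda>i t x. snd (T i t x))"
  by (rule BL_cong[OF BL_diff[OF BL_divide[OF BL_mult[OF BL_const[of 2] BL_vint[OF BL_dens]] BL_m _ m_ge] BL_const[of 1]]])
    (use \<delta>_pos in \<open>auto simp: T_eq\<close>)

lemma T_time_lip: "\<exists>C\<ge>0. \<forall>i. \<forall>s\<in>{0..1}. \<forall>t\<in>{0..1}. \<forall>x\<in>strip. norm (T i s x - T i t x) \<le> C * \<bar>s - t\<bar>"
proof -
  obtain A B where A: "BLC A (\<lambda>i t x. area_shift (F i t) (fst x))" and B: "BLC B (\<lambda>i t x. snd (T i t x))"
    using BL_area_shift BL_T_snd by (auto simp: BL_def)
  have "norm (T i s x - T i t x) \<le> (A + B) * \<bar>s - t\<bar>" if "s \<in> {0..1}" "t \<in> {0..1}" "x \<in> strip" for i s t x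
  proof -
    obtain q p where x: "x = (q, p)" by (cases x)
    have "norm (T i s x - T i t x) \<le> \<bar>area_shift (F i s) (fst x) - area_shift (F i t) (fst x)\<bar> + \<bar>snd (T i s x) - snd (T i t x)\<bar>"
      using norm_Pair_le[of "area_shift (F i s) q - area_shift (F i t) q" "snd (T i s x) - snd (T i t x)"]
      by (simp add: T_eq x)
    also have "\<dots> \<le> A * \<bar>s - t\<bar> + B * \<bar>s - t\<bar>"
      using BLC_D(3)[OF A that(1,3) that(2,3), of i] BLC_D(3)[OF B that(1,3) that(2,3), of i] by simp
    finally show ?thesis by (simp add: algebra_simps)
  qed
  moreover have "A + B \<ge> 0" using BLC_D(1)[OF A] BLC_D(1)[OF B] by simp
  ultimately show ?thesis by blast
qed

lemma BL_JT:
  shows "BL (\<lambda>i t x. fst (JT i t x))" "BL (\<lambda>i t x. fst (snd (snd (JT i t x))))" "BL (\<lambda>i t x. snd (snd (snd (JT i t x))))"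
proof -
  have d: "2 * \<delta> > 0" "2 * \<delta> * (2 * \<delta>) > 0" using \<delta>_pos by auto
  have mm: "2 * \<delta> * (2 * \<delta>) \<le> m i t q * m i t q" if "t \<in> {0..1}" for i t q
    using m_ge[OF that, of i q] \<delta>_pos by (intro mult_mono) auto
  show "BL (\<lambda>i t x. fst (JT i t x))" "BL (\<lambda>i t x. snd (snd (snd (JT i t x))))"
    unfolding JT_def fst_conv snd_conv
    by (rule BL_divide[OF BL_m BL_const[of 2], of 1] BL_divide[OF BL_mult[OF BL_const BL_dens] BL_m d(1) m_ge]; simp)+
  show "BL (\<lambda>i t x. fst (snd (snd (JT i t x))))"
    unfolding JT_def fst_conv snd_conv
    by (rule BL_divide[OF BL_mult[OF BL_const BL_diff[OF BL_mult[OF BL_vint[OF BL_densq] BL_m] BL_mult[OF BL_vint[OF BL_dens] BL_mq]]]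
          BL_mult[OF BL_m BL_m] d(2) mm])
qed

lemma mdet_JT: "t \<in> {0..1} \<Longrightarrow> mdet (JT i t x) = dens (F i t) x"
  using m_pos[of t i "fst x"] by (simp add: JT_def mdet_def)

text \<open>The triangular form allows solving in order: q is controlled by the first component at
  rate 1 / \<open>\<delta>\<close>; then p by the second, whose vertical slope is at least c = 2
  \<open>\<delta>\<close> / M, after the effect of changing q, at most \<open>B\<close> times that
  change, has been subtracted.\<close>

lemma T_inv_lip: "\<exists>C\<ge>0. \<forall>i. \<forall>t\<in>{0..1}. \<forall>x\<in>strip. \<forall>y\<in>strip. norm (x - y) \<le> C * norm (T i t x - T i t y)"
proof -
  obtain B where B: "BLC B (\<lambda>i t x. snd (T i t x))" using BL_T_snd by (auto simp: BL_def)
  obtain M where M: "BLC M (\<lambda>i t x. m i t (fst x))" using BL_m by (auto simp: BL_def)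
  define c where "c = 2 * \<delta> / M"
  have c: "c > 0" using \<delta>_pos BLC_D(1)[OF M] by (simp add: c_def)
  have Bp: "B > 0" by (rule BLC_D(1)[OF B])
  have "norm (x - y) \<le> (1 / \<delta> + (1 + B / \<delta>) / c) * norm (T i t x - T i t y)"
    if t: "t \<in> {0..1}" and xy: "x \<in> strip" "y \<in> strip" for i t x y
  proof -
    obtain q p where x: "x = (q, p)" by (cases x)
    obtain q' p' where y: "y = (q', p')" by (cases y)
    have p: "-1 \<le> p" "p \<le> 1" "-1 \<le> p'" "p' \<le> 1" using xy by (auto simp: x y strip_iff)
    let ?N = "norm (T i t x - T i t y)"
    have f: "\<delta> * \<bar>q - q'\<bar> \<le> ?N"
    proof -
      have "\<delta> * \<bar>q - q'\<bar> \<le> \<bar>(q + area_shift (F i t) q) - (q' + area_shift (F i t) q')\<bar>"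
      proof (cases "q' \<le> q")
        case True
        then show ?thesis using T_fst_increase[OF t True, of i] by simp
      next
        case False
        then have le: "q \<le> q'" by simp
        show ?thesis using le T_fst_increase[OF t le, of i] by (simp add: abs_minus_commute)
      qed
      also have "\<dots> \<le> ?N" using fst_snd_norm(1)[of "T i t x - T i t y"] by (simp add: x y T_eq)
      finally show ?thesis .
    qed
    then have fq: "\<bar>q - q'\<bar> \<le> ?N / \<delta>" using \<delta>_pos by (simp add: pos_le_divide_eq mult.commute)
    have g: "c * \<bar>p - p'\<bar> \<le> \<bar>snd (T i t (q, p)) - snd (T i t (q, p'))\<bar>"
    proof -
      have mM: "m i t q \<le> M" using BLC_D(2)[OF M t xy(1), of i] by (simp add: x)
      have "c \<le> 2 * \<delta> / m i t q" unfolding c_def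
        using \<delta>_pos m_pos[OF t, of i q] mM by (intro divide_left_mono) auto
      then have 1: "c * \<bar>p - p'\<bar> \<le> 2 * \<delta> / m i t q * \<bar>p - p'\<bar>" by (intro mult_right_mono) auto
      show ?thesis
      proof (cases "p' \<le> p")
        case True
        then show ?thesis using T_snd_increase[OF t p(3) True p(2), of i q] 1 by simp
      next
        case False
        then have le: "p \<le> p'" by simp
        show ?thesis using le T_snd_increase[OF t p(1) le p(4), of i q] 1 by (simp add: abs_minus_commute)
      qed
    qed
    have "\<bar>snd (T i t (q, p')) - snd (T i t (q', p'))\<bar> \<le> B * \<bar>q - q'\<bar>"
      using BLC_D(3)[OF B t _ t xy(2), of "(q, p')" i] p by (simp add: y strip_iff norm_Pair)
    also have "\<dots> \<le> B * (?N / \<delta>)" using Bp fq by (intro mult_left_mono) auto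
    finally have h: "\<bar>snd (T i t (q, p')) - snd (T i t (q', p'))\<bar> \<le> B * (?N / \<delta>)" .
    have "\<bar>snd (T i t x) - snd (T i t y)\<bar> \<le> ?N" using fst_snd_norm(2)[of "T i t x - T i t y"] by simp
    then have "c * \<bar>p - p'\<bar> \<le> ?N + B * (?N / \<delta>)" using g h unfolding x y by linarith
    then have "\<bar>p - p'\<bar> \<le> (?N + B * (?N / \<delta>)) / c" using c by (simp add: pos_le_divide_eq mult.commute)
    then have "norm (x - y) \<le> ?N / \<delta> + (?N + B * (?N / \<delta>)) / c"
      using fq norm_Pair_le[of "q - q'" "p - p'"] by (simp add: x y)
    also have "\<dots> = (1 / \<delta> + (1 + B / \<delta>) / c) * ?N"
      by (simp add: algebra_simps add_divide_distrib)
    finally show ?thesis .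
  qed
  moreover have "1 / \<delta> + (1 + B / \<delta>) / c \<ge> 0" using \<delta>_pos c Bp by (auto intro!: add_nonneg_nonneg divide_nonneg_nonneg)
  ultimately show ?thesis by blast
qed

text \<open>Injectivity is the inverse Lipschitz bound. For surjectivity the intermediate value
  theorem is used first in q, where the bound \<open>A\<close> on the shift places the solution in
  [a - A, a + A], and then in p on the fibre found.\<close>

lemma T_bij:
  assumes t: "t \<in> {0..1}"
  shows "bij_betw (T i t) strip strip"
proof -
  obtain C where C: "\<forall>i. \<forall>t\<in>{0..1}. \<forall>x\<in>strip. \<forall>y\<in>strip. norm (x - y) \<le> C * norm (T i t x - T i t y)"
    using T_inv_lip by blast
  have inj: "inj_on (T i t) strip"
  proof (rule inj_onI)
    fix x y assume "x \<in> strip" "y \<in> strip" "T i t x = T i t y"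
    then have "norm (x - y) \<le> 0" using C[rule_format, OF t, of x y i] by simp
    then show "x = y" by simp
  qed
  obtain A where A: "BLC A (\<lambda>i t x. area_shift (F i t) (fst x))" using BL_area_shift by (auto simp: BL_def)
  have bnd: "\<bar>area_shift (F i t) q\<bar> \<le> A" for q
    using BLC_D(2)[OF A t, of "(q, 1)" i] by (simp add: strip_iff)
  have "y \<in> T i t ` strip" if y: "y \<in> strip" for y
  proof -
    obtain a b where ab: "y = (a, b)" by (cases y)
    have b: "-1 \<le> b" "b \<le> 1" using y by (auto simp: ab strip_iff)
    have "continuous_on {a - A..a + A} (\<lambda>q. q + area_shift (F i t) q)"
      by (intro continuous_intros DERIV_continuous_on[OF has_field_derivative_at_within[OF area_shift_deriv[OF t]]])
    then obtain q where q: "q + area_shift (F i t) q = a"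
      using IVT'[of "\<lambda>q. q + area_shift (F i t) q" "a - A" a "a + A"] bnd[of "a - A"] bnd[of "a + A"] BLC_D(1)[OF A]
      by (auto simp: abs_le_iff)
    have "continuous_on {-1..1} (\<lambda>p. snd (T i t (q, p)))"
      by (rule BL_line[OF BL_T_snd t])
    then obtain p where p: "-1 \<le> p" "p \<le> 1" "snd (T i t (q, p)) = b"
      using IVT'[of "\<lambda>p. snd (T i t (q, p))" "-1" b 1] T_bdry[OF t, of i q] b by auto
    have "T i t (q, p) = y" using q p by (simp add: T_eq ab)
    then show ?thesis using p by (metis image_eqI strip_iff)
  qed
  moreover have "T i t x \<in> strip" if "x \<in> strip" for x
    using T_snd_bounds[OF t, of "fst x" "snd x" i] that by (metis prod.collapse strip_iff)
  ultimately show ?thesis using inj by (auto simp: bij_betw_def)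
qed

end

text \<open>\<open>UD\<close> ranges over a full index type, while times live in [0, 1]; clamping
  lets every pair of an index and a real number serve as an index.\<close>

definition clamp01 :: "real \<Rightarrow> real" where
  "clamp01 t = max 0 (min 1 t)"

lemma clamp01: "clamp01 t \<in> {0..1}" "t \<in> {0..1} \<Longrightarrow> clamp01 t = t"
  by (auto simp: clamp01_def)

lemma BL_matrix:
  assumes "BL (\<lambda>i t x. fst (J i t x))" "BL (\<lambda>i t x. fst (snd (J i t x)))"
    "BL (\<lambda>i t x. fst (snd (snd (J i t x))))" "BL (\<lambda>i t x. snd (snd (snd (J i t x))))"
  shows "\<exists>K. \<forall>i. \<forall>t\<in>{0..1}. \<forall>x\<in>strip. norm (J i t x :: mat2) \<le> K"
    "t \<in> {0..1} \<Longrightarrow> continuous_on strip (J i t)"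
proof -
  obtain A B C D where b: "BLC A (\<lambda>i t x. fst (J i t x))" "BLC B (\<lambda>i t x. fst (snd (J i t x)))"
    "BLC C (\<lambda>i t x. fst (snd (snd (J i t x))))" "BLC D (\<lambda>i t x. snd (snd (snd (J i t x))))"
    using assms unfolding BL_def by blast
  have "norm (J i t x) \<le> A + B + C + D" if "t \<in> {0..1}" "x \<in> strip" for i t x
  proof -
    have "norm (J i t x) \<le> \<bar>fst (J i t x)\<bar> + \<bar>fst (snd (J i t x))\<bar> + \<bar>fst (snd (snd (J i t x)))\<bar> + \<bar>snd (snd (snd (J i t x)))\<bar>"
      using mat2_norm(5) by (metis prod.collapse)
    also have "\<dots> \<le> A + B + C + D"
      by (intro add_mono BLC_D(2)[OF b(1) that] BLC_D(2)[OF b(2) that] BLC_D(2)[OF b(3) that] BLC_D(2)[OF b(4) that])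
    finally show ?thesis .
  qed
  then show "\<exists>K. \<forall>i. \<forall>t\<in>{0..1}. \<forall>x\<in>strip. norm (J i t x) \<le> K" by blast
  assume t: "t \<in> {0..1}"
  have "continuous_on strip (\<lambda>x. (fst (J i t x), fst (snd (J i t x)), fst (snd (snd (J i t x))), snd (snd (snd (J i t x)))))"
    by (intro continuous_on_Pair BL_continuous[OF assms(1) t] BL_continuous[OF assms(2) t]
        BL_continuous[OF assms(3) t] BL_continuous[OF assms(4) t])
  then show "continuous_on strip (J i t)" by simp
qed

lemma UD_reindex: "UD g J \<Longrightarrow> UD (\<lambda>i. g (h i)) (\<lambda>i. J (h i))"
  unfolding UD_def by blast

section \<open>The area-preserving path and its increments\<close>

context C3_isotopy begin

lemma BL_Jac:
  shows "BL (\<lambda>i t x. fst (Jac (F i t) x))" "BL (\<lambda>i t x. fst (snd (Jac (F i t) x)))"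
    "BL (\<lambda>i t x. fst (snd (snd (Jac (F i t) x))))" "BL (\<lambda>i t x. snd (snd (snd (Jac (F i t) x))))"
proof -
  show "BL (\<lambda>i t x. fst (Jac (F i t) x))"
    by (rule BL_cong[OF BL_add[OF BL_const[of 1] BL_e(3)]]) (simp add: Jac_def F_partials)
  show "BL (\<lambda>i t x. fst (snd (Jac (F i t) x)))"
    by (rule BL_cong[OF BL_e(5)]) (simp add: Jac_def F_partials)
  show "BL (\<lambda>i t x. fst (snd (snd (Jac (F i t) x))))"
    by (rule BL_cong[OF BL_e(4)]) (simp add: Jac_def F_partials)
  show "BL (\<lambda>i t x. snd (snd (snd (Jac (F i t) x))))"
    by (rule BL_cong[OF BL_add[OF BL_const[of 1] BL_e(6)]]) (simp add: Jac_def F_partials)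
qed

lemma UD_F: "UD (\<lambda>j. F (fst j) (clamp01 (snd j))) (\<lambda>j. Jac (F (fst j) (clamp01 (snd j))))"
  unfolding UD_def
proof (intro conjI allI ballI)
  fix j :: "'i \<times> real"
  let ?F = "F (fst j) (clamp01 (snd j))"
  show "bij_betw ?F strip strip" by (rule F_bij[OF clamp01(1)])
  show "continuous_on strip (Jac ?F)" by (rule BL_matrix(2)[OF BL_Jac clamp01(1)])
  fix x assume x: "x \<in> strip"
  show "snd (?F x) = 1 \<longleftrightarrow> snd x = 1" "snd (?F x) = -1 \<longleftrightarrow> snd x = -1" using F_bdry[OF clamp01(1) x] by blast+
  show "(?F has_derivative mapp (Jac ?F x)) (at x within strip)"
    by (rule displacement_partials(3)[OF e_D(1)[OF clamp01(1), unfolded e_def] x])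
next
  show "\<exists>K. \<forall>j. \<forall>x\<in>strip. norm (Jac (F (fst j) (clamp01 (snd j))) x) \<le> K"
    using BL_matrix(1)[OF BL_Jac] clamp01(1) by blast
  show "\<exists>d>0. \<forall>j. \<forall>x\<in>strip. d \<le> mdet (Jac (F (fst j) (clamp01 (snd j))) x)"
    using \<delta>_pos det_ge[OF clamp01(1)] unfolding dens_def by blast
  show "\<exists>L. \<forall>j. \<forall>x\<in>strip. \<forall>y\<in>strip. norm (x - y) \<le> L * norm (F (fst j) (clamp01 (snd j)) x - F (fst j) (clamp01 (snd j)) y)"
    using F_inv_lip[OF clamp01(1)] by blast
qed

lemma UD_T: "UD (\<lambda>j. T (fst j) (clamp01 (snd j))) (\<lambda>j. JT (fst j) (clamp01 (snd j)))"
proof -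
  have B: "BL (\<lambda>i t x. fst (snd (JT i t x)))" unfolding JT_def fst_conv snd_conv by (rule BL_const)
  note M = BL_matrix[OF BL_JT(1) B BL_JT(2,3)]
  show ?thesis
  unfolding UD_def
proof (intro conjI allI ballI)
  fix j :: "'i \<times> real"
  let ?T = "T (fst j) (clamp01 (snd j))"
  show "bij_betw ?T strip strip" by (rule T_bij[OF clamp01(1)])
  show "continuous_on strip (JT (fst j) (clamp01 (snd j)))" by (rule M(2)[OF clamp01(1)])
  fix x assume x: "x \<in> strip"
  show "snd (?T x) = 1 \<longleftrightarrow> snd x = 1" "snd (?T x) = -1 \<longleftrightarrow> snd x = -1"
    using T_snd_bounds(3,4)[OF clamp01(1), of "fst x" "snd x"] x by (metis prod.collapse)+
  show "(?T has_derivative mapp (JT (fst j) (clamp01 (snd j)) x)) (at x within strip)"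
    by (rule T_has_derivative[OF clamp01(1) x])
next
  show "\<exists>K. \<forall>j. \<forall>x\<in>strip. norm (JT (fst j) (clamp01 (snd j)) x) \<le> K"
    using M(1) clamp01(1) by blast
  show "\<exists>d>0. \<forall>j. \<forall>x\<in>strip. d \<le> mdet (JT (fst j) (clamp01 (snd j)) x)"
    unfolding mdet_JT[OF clamp01(1)] using \<delta>_pos det_ge[OF clamp01(1)] by blast
  show "\<exists>L. \<forall>j. \<forall>x\<in>strip. \<forall>y\<in>strip. norm (x - y) \<le> L * norm (T (fst j) (clamp01 (snd j)) x - T (fst j) (clamp01 (snd j)) y)"
    using T_inv_lip clamp01(1) by blast
qed
qed

definition A where "A i t x = F i t (inv_into strip (T i t) x)"
text \<open>The Jacobian matrix of \<open>A\<close> at the point \<open>T i t x\<close>. In this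
  form it is jointly Lipschitz in time and space by the \<open>BL\<close> calculus; the inverse of
  \<open>T\<close> enters only in \<open>JA\<close>.\<close>

definition BB where "BB i t x = mmul (Jac (F i t) x) (minv (JT i t x))"
definition JA where "JA i t x = BB i t (inv_into strip (T i t) x)"

lemma UD_A:
  assumes t: "t \<in> {0..1}"
  shows "UD (\<lambda>i. A i t) (\<lambda>i. JA i t)"
  using UD_reindex[OF UD_comp[OF UD_F UD_inv[OF UD_T]], of "\<lambda>i. (i, t)"] clamp01(2)[OF t]
  by (simp add: A_def[abs_def] JA_def[abs_def] BB_def)

lemma UD_T_at:
  assumes t: "t \<in> {0..1}"
  shows "UD (\<lambda>i. T i t) (\<lambda>i. JT i t)"
  using UD_reindex[OF UD_T, of "\<lambda>i. (i, t)"] clamp01(2)[OF t] by simp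

lemma mdet_BB:
  assumes "t \<in> {0..1}" "x \<in> strip"
  shows "mdet (BB i t x) = 1"
  using det_ge[OF assms, of i] \<delta>_pos mdet_JT[OF assms(1), of i x] mmul_minv(3)[of "JT i t x"]
  by (simp add: BB_def mdet_mmul dens_def)

lemma A_area_preserving:
  assumes t: "t \<in> {0..1}"
  shows "area_preserving (A i t)"
  by (rule UD_area_preserving[where g = "\<lambda>i. A i t", OF UD_A[OF t]])
    (simp add: JA_def mdet_BB[OF t] bij_inv_strip(1)[OF T_bij[OF t]])

lemma F_eq_A_T:
  assumes "t \<in> {0..1}" "x \<in> strip"
  shows "F i t x = A i t (T i t x)"
  using bij_inv_strip(3)[OF T_bij[OF assms(1)] assms(2)] by (simp add: A_def)

lemma T_area_preserving:
  assumes "area_preserving (F i 1)"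
  shows "area_preserving (T i 1)"
proof (rule UD_area_preserving_cancel[where f = "\<lambda>i. A i 1" and g = "\<lambda>i. T i 1", OF _ A_area_preserving UD_T_at])
  show "area_preserving (\<lambda>x. A i 1 (T i 1 x))"
    using assms by (rule area_preserving_cong) (simp add: F_eq_A_T)
qed auto

text \<open>Needed for the path \<open>A\<close> to start at the identity. At time 0 the
  displacement vanishes on the strip, so the density is 1 and the shift 0.\<close>

lemma T_0: "x \<in> strip \<Longrightarrow> T i 0 x = x"
proof -
  have 0: "0 \<in> {0..1::real}" by simp
  have e: "e i 0 x = 0" if "x \<in> strip" for x using F_0[OF that] by (simp add: e_def)
  have h: "(e i 0 has_derivative (\<lambda>h. 0)) (at x within strip)" if "x \<in> strip" for x
    by (rule has_derivative_transform[where f = "\<lambda>_. 0", OF that e has_derivative_const])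
  then have d: "dq (e i 0) x = 0" "dp (e i 0) x = 0" if "x \<in> strip" for x
    using dq_eq[OF h[OF that] that] dp_eq[OF h[OF that] that] by simp_all
  have dens: "dens (F i 0) x = 1" if "x \<in> strip" for x
    using dens_eq[OF 0 that, of i] d[OF that] by simp
  have v: "vint (dens (F i 0)) (q, p) = p + 1" if "-1 \<le> p" "p \<le> 1" for q p
  proof -
    have "integral {-1..p} (\<lambda>s. dens (F i 0) (q, s)) = integral {-1..p} (\<lambda>s. 1)"
      by (rule integral_cong) (use that dens in \<open>simp add: strip_iff\<close>)
    then show ?thesis using that by (simp add: vint_def)
  qed
  have a: "area_shift (F i 0) q = 0" for q
  proof -
    have "integral {-1..1} (\<lambda>s. fst (F i 0 (q, s) - (q, s)) * snd (dp (F i 0) (q, s))) = integral {-1..1::real} (\<lambda>s. 0)"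
      by (rule integral_cong) (use F_0 in \<open>simp add: strip_iff\<close>)
    then show ?thesis by (simp add: area_shift_def vint_def)
  qed
  assume x: "x \<in> strip"
  then show ?thesis by (cases x) (auto simp: T_eq m_def v a strip_iff field_simps)
qed

lemma A_0:
  assumes x: "x \<in> strip"
  shows "A i 0 x = x"
proof -
  have "inv_into strip (T i 0) x = x"
    using bij_inv_strip(3)[OF T_bij, of 0 x i] T_0[OF x] x by simp
  then show ?thesis using F_0[OF x] by (simp add: A_def)
qed

lemma minv_JT:
  assumes "t \<in> {0..1}"
  shows "minv (JT i t x) = (snd (snd (snd (JT i t x))) / dens (F i t) x, 0,
     - fst (snd (snd (JT i t x))) / dens (F i t) x, fst (JT i t x) / dens (F i t) x)"
proof -
  have "minv M = (snd (snd (snd M)) / mdet M, - fst (snd M) / mdet M, - fst (snd (snd M)) / mdet M, fst M / mdet M)" for M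
    by (cases M) (simp add: minv_def mdet_def Let_def)
  then have "minv (JT i t x) = (snd (snd (snd (JT i t x))) / mdet (JT i t x), - fst (snd (JT i t x)) / mdet (JT i t x),
      - fst (snd (snd (JT i t x))) / mdet (JT i t x), fst (JT i t x) / mdet (JT i t x))" .
  moreover have "fst (snd (JT i t x)) = 0" by (simp add: JT_def)
  ultimately show ?thesis unfolding mdet_JT[OF assms] by simp
qed

text \<open>Inverting the triangular matrix divides only by its determinant, the density, which is
  bounded below by \<open>\<delta>\<close>.\<close>

lemma BL_BB:
  shows "BL (\<lambda>i t x. fst (BB i t x))" "BL (\<lambda>i t x. fst (snd (BB i t x)))"
    "BL (\<lambda>i t x. fst (snd (snd (BB i t x))))" "BL (\<lambda>i t x. snd (snd (snd (BB i t x))))"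
proof -
  note D1 = BL_divide[OF BL_JT(3) BL_dens \<delta>_pos det_ge]
    and D2 = BL_divide[OF BL_JT(2) BL_dens \<delta>_pos det_ge]
    and D3 = BL_divide[OF BL_JT(1) BL_dens \<delta>_pos det_ge]
  have eq: "BB i t x = (
      fst (Jac (F i t) x) * (snd (snd (snd (JT i t x))) / dens (F i t) x) - fst (snd (Jac (F i t) x)) * (fst (snd (snd (JT i t x))) / dens (F i t) x),
      fst (snd (Jac (F i t) x)) * (fst (JT i t x) / dens (F i t) x),
      fst (snd (snd (Jac (F i t) x))) * (snd (snd (snd (JT i t x))) / dens (F i t) x) - snd (snd (snd (Jac (F i t) x))) * (fst (snd (snd (JT i t x))) / dens (F i t) x),
      snd (snd (snd (Jac (F i t) x))) * (fst (JT i t x) / dens (F i t) x))" if "t \<in> {0..1}" for i t x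
    unfolding BB_def minv_JT[OF that] mmul_def by (simp add: case_prod_beta)
  show "BL (\<lambda>i t x. fst (BB i t x))"
    by (rule BL_cong[OF BL_diff[OF BL_mult[OF BL_Jac(1) D1] BL_mult[OF BL_Jac(2) D2]]]) (simp_all add: eq)
  show "BL (\<lambda>i t x. fst (snd (BB i t x)))"
    by (rule BL_cong[OF BL_mult[OF BL_Jac(2) D3]]) (simp_all add: eq)
  show "BL (\<lambda>i t x. fst (snd (snd (BB i t x))))"
    by (rule BL_cong[OF BL_diff[OF BL_mult[OF BL_Jac(3) D1] BL_mult[OF BL_Jac(4) D2]]]) (simp_all add: eq)
  show "BL (\<lambda>i t x. snd (snd (snd (BB i t x))))"
    by (rule BL_cong[OF BL_mult[OF BL_Jac(4) D3]]) (simp_all add: eq)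
qed

definition step where "step i s t x = A i s (inv_into strip (A i t) x)"
definition Jstep where "Jstep i s t x = mmul (JA i s (inv_into strip (A i t) x)) (minv (JA i t (inv_into strip (A i t) x)))"

lemma UD_step:
  assumes "s \<in> {0..1}" "t \<in> {0..1}"
  shows "UD (\<lambda>i. step i s t) (\<lambda>i. Jstep i s t)"
  using UD_comp[OF UD_A[OF assms(1)] UD_inv[OF UD_A[OF assms(2)]]]
  by (simp add: step_def[abs_def] Jstep_def[abs_def])

lemma step_area_preserving:
  assumes "s \<in> {0..1}" "t \<in> {0..1}"
  shows "area_preserving (step i s t)"
  unfolding step_def[abs_def]
  by (rule UD_area_preserving_comp[where g = "\<lambda>i. inv_into strip (A i t)", OF A_area_preserving[OF assms(1)] _ UD_inv[OF UD_A[OF assms(2)]]])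
    (rule UD_area_preserving_inv[where g = "\<lambda>i. A i t", OF A_area_preserving[OF assms(2)] UD_A[OF assms(2)]])

text \<open>The upper left entry is what the shear construction needs. At time s = t it equals 1,
  and its deviation is governed by the change of \<open>BB\<close> between the two
  \<open>T\<close>-preimages of one point, which are at distance of order |s - t|.\<close>

lemma Jstep_bound:
  "\<exists>C. \<forall>i. \<forall>s\<in>{0..1}. \<forall>t\<in>{0..1}. \<forall>y\<in>strip. 1 - C * \<bar>s - t\<bar> \<le> fst (Jstep i s t y)"
proof -
  obtain C1 C2 C3 C4 where b: "BLC C1 (\<lambda>i t x. fst (BB i t x))" "BLC C2 (\<lambda>i t x. fst (snd (BB i t x)))"
    "BLC C3 (\<lambda>i t x. fst (snd (snd (BB i t x))))" "BLC C4 (\<lambda>i t x. snd (snd (snd (BB i t x))))"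
    using BL_BB unfolding BL_def by blast
  obtain LT where LT: "LT \<ge> 0" "\<forall>i. \<forall>t\<in>{0..1}. \<forall>x\<in>strip. \<forall>y\<in>strip. norm (x - y) \<le> LT * norm (T i t x - T i t y)"
    using T_inv_lip by blast
  obtain CT where CT: "\<forall>i. \<forall>s\<in>{0..1}. \<forall>t\<in>{0..1}. \<forall>x\<in>strip. norm (T i s x - T i t x) \<le> CT * \<bar>s - t\<bar>"
    using T_time_lip by blast
  define C where "C = (C1 * (1 + LT * CT)) * C4 + (C2 * (1 + LT * CT)) * C3"
  have "1 - C * \<bar>s - t\<bar> \<le> fst (Jstep i s t y)" if s: "s \<in> {0..1}" and t: "t \<in> {0..1}" and y: "y \<in> strip" for i s t y
  proof -
    define z where "z = inv_into strip (A i t) y"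
    have z: "z \<in> strip" unfolding z_def by (rule bij_inv_strip(1)[OF UD_D(1)[OF UD_A[OF t]] y])
    define x where "x = inv_into strip (T i t) z"
    define x' where "x' = inv_into strip (T i s) z"
    have x: "x \<in> strip" "T i t x = z" unfolding x_def using bij_inv_strip[OF T_bij[OF t] z] by auto
    have x': "x' \<in> strip" "T i s x' = z" unfolding x'_def using bij_inv_strip[OF T_bij[OF s] z] by auto
    \<comment> \<open>Both points are sent to \<open>z\<close>, one at time t and one at time s; so
      the inverse Lipschitz bound of \<open>T\<close> at time s reduces their distance to the motion
      of \<open>T\<close> in time at the fixed point \<open>x\<close>.\<close>
    have "norm (x' - x) \<le> LT * norm (T i s x' - T i s x)" using LT(2) s x x' by blast
    also have "\<dots> = LT * norm (T i s x - T i t x)" using x(2) x'(2) by (simp add: norm_minus_commute)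
    also have "\<dots> \<le> LT * (CT * \<bar>s - t\<bar>)" using LT(1) CT s t x(1) by (intro mult_left_mono) auto
    finally have near: "\<bar>s - t\<bar> + norm (x' - x) \<le> (1 + LT * CT) * \<bar>s - t\<bar>" by (simp add: algebra_simps)
    obtain a b' c d where B: "BB i t x = (a, b', c, d)" by (cases "BB i t x")
    obtain a' b'' c' d' where B': "BB i s x' = (a', b'', c', d')" by (cases "BB i s x'")
    have det: "a * d - b' * c = 1" using mdet_BB[OF t x(1), of i] by (simp add: B mdet_def)
    \<comment> \<open>The inverse of a matrix of determinant 1 has first column (d, -c).\<close>
    have J: "fst (Jstep i s t y) = a' * d - b'' * c"
      using det unfolding Jstep_def JA_def z_def[symmetric] x_def[symmetric] x'_def[symmetric] B B'
      by (simp add: mmul_def minv_def Let_def)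
    have lip: "\<bar>a' - a\<bar> \<le> C1 * ((1 + LT * CT) * \<bar>s - t\<bar>)" "\<bar>b'' - b'\<bar> \<le> C2 * ((1 + LT * CT) * \<bar>s - t\<bar>)"
      using order_trans[OF BLC_D(3)[OF b(1) s x'(1) t x(1), of i] mult_left_mono[OF near less_imp_le[OF BLC_D(1)[OF b(1)]]]]
        order_trans[OF BLC_D(3)[OF b(2) s x'(1) t x(1), of i] mult_left_mono[OF near less_imp_le[OF BLC_D(1)[OF b(2)]]]]
      by (simp_all add: B B')
    have bd: "\<bar>d\<bar> \<le> C4" "\<bar>c\<bar> \<le> C3"
      using BLC_D(2)[OF b(4) t x(1), of i] BLC_D(2)[OF b(3) t x(1), of i] by (simp_all add: B)
    have "1 - fst (Jstep i s t y) = - ((a' - a) * d) + (b'' - b') * c" using det J by (simp add: algebra_simps)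
    also have "\<dots> \<le> \<bar>a' - a\<bar> * \<bar>d\<bar> + \<bar>b'' - b'\<bar> * \<bar>c\<bar>"
      unfolding abs_mult[symmetric] by (intro add_mono) auto
    also have "\<dots> \<le> C1 * ((1 + LT * CT) * \<bar>s - t\<bar>) * C4 + C2 * ((1 + LT * CT) * \<bar>s - t\<bar>) * C3"
      using lip bd by (intro add_mono mult_mono) (auto intro: order_trans[OF abs_ge_zero])
    also have "\<dots> = C * \<bar>s - t\<bar>" by (simp add: C_def algebra_simps)
    finally show ?thesis by simp
  qed
  then show ?thesis by blast
qed

lemma JT_11:
  assumes "t \<in> {0..1}"
  shows "\<delta> \<le> fst (JT i t x)"
  using m_ge[OF assms, of i "fst x"] by (simp add: JT_def)

end

text \<open>The bound, against a shear with larger coefficient, decides the direction in which the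
  edges move; it also gives the second moments.\<close>

definition displ_bounded :: "('i \<Rightarrow> real \<times> real \<Rightarrow> real \<times> real) \<Rightarrow> bool" where
  "displ_bounded g \<longleftrightarrow> (\<exists>C. \<forall>i. \<forall>x\<in>strip. norm (g i x - x) \<le> C)"

lemma displ_bounded_comp:
  assumes "displ_bounded f" "displ_bounded g" "\<And>i x. x \<in> strip \<Longrightarrow> g i x \<in> strip"
  shows "displ_bounded (\<lambda>i x. f i (g i x))"
proof -
  obtain C D where C: "\<And>i x. x \<in> strip \<Longrightarrow> norm (f i x - x) \<le> C" and D: "\<And>i x. x \<in> strip \<Longrightarrow> norm (g i x - x) \<le> D"
    using assms(1,2) unfolding displ_bounded_def by blast
  have "norm (f i (g i x) - x) \<le> C + D" if "x \<in> strip" for i x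
    using norm_triangle_ineq[of "f i (g i x) - g i x" "g i x - x"] C[OF assms(3)[OF that], of i i] D[OF that, of i] by simp
  then show ?thesis unfolding displ_bounded_def by blast
qed

lemma displ_bounded_inv:
  assumes "displ_bounded g" "\<And>i. bij_betw (g i) strip strip"
  shows "displ_bounded (\<lambda>i. inv_into strip (g i))"
proof -
  obtain D where D: "\<And>i x. x \<in> strip \<Longrightarrow> norm (g i x - x) \<le> D"
    using assms(1) unfolding displ_bounded_def by blast
  have "norm (inv_into strip (g i) x - x) \<le> D" if "x \<in> strip" for i x
    using D[OF bij_inv_strip(1)[OF assms(2) that], of i i] bij_inv_strip(2)[OF assms(2) that, of i]
    by (simp add: norm_minus_commute)
  then show ?thesis unfolding displ_bounded_def by blast
qed

context C3_isotopy begin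

lemma displ_F: "t \<in> {0..1} \<Longrightarrow> displ_bounded (\<lambda>i. F i t)"
  unfolding displ_bounded_def using e_D(6) unfolding e_def by blast

lemma displ_T:
  assumes t: "t \<in> {0..1}"
  shows "displ_bounded (\<lambda>i. T i t)"
proof -
  obtain A where A: "BLC A (\<lambda>i t x. area_shift (F i t) (fst x))" using BL_area_shift by (auto simp: BL_def)
  have "norm (T i t x - x) \<le> A + 2" if x: "x \<in> strip" for i x
  proof -
    obtain q p where qp: "x = (q, p)" by (cases x)
    have "norm (T i t x - x) \<le> \<bar>area_shift (F i t) q\<bar> + \<bar>snd (T i t x) - p\<bar>"
      using norm_Pair_le[of "area_shift (F i t) q" "snd (T i t x) - p"] by (simp add: T_eq qp)
    moreover have "\<bar>snd (T i t x) - p\<bar> \<le> 2"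
      using T_snd_bounds(1,2)[OF t x[unfolded qp], of i] x by (simp add: qp strip_iff abs_le_iff)
    moreover have "\<bar>area_shift (F i t) q\<bar> \<le> A" using BLC_D(2)[OF A t x, of i] by (simp add: qp)
    ultimately show ?thesis by simp
  qed
  then show ?thesis unfolding displ_bounded_def by blast
qed

lemma displ_A:
  assumes t: "t \<in> {0..1}"
  shows "displ_bounded (\<lambda>i. A i t)"
  unfolding A_def[abs_def]
  by (rule displ_bounded_comp[OF displ_F[OF t] displ_bounded_inv[OF displ_T[OF t] T_bij[OF t]] bij_inv_strip(1)[OF T_bij[OF t]]])

lemma displ_step:
  assumes "s \<in> {0..1}" "t \<in> {0..1}"
  shows "displ_bounded (\<lambda>i. step i s t)"
  unfolding step_def[abs_def]
  by (rule displ_bounded_comp[OF displ_A[OF assms(1)] displ_bounded_inv[OF displ_A[OF assms(2)] UD_D(1)[OF UD_A[OF assms(2)]]]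
        bij_inv_strip(1)[OF UD_D(1)[OF UD_A[OF assms(2)]]]])

end

section \<open>Measurability and equivariance\<close>

abbreviation strip_borel :: "(real \<times> real) measure" where
  "strip_borel \<equiv> restrict_space borel strip"

definition jmeas :: "'w measure \<Rightarrow> ('w \<Rightarrow> real \<times> real \<Rightarrow> real \<times> real) \<Rightarrow> bool" where
  "jmeas M g \<longleftrightarrow> (\<lambda>z. g (fst z) (snd z)) \<in> M \<Otimes>\<^sub>M strip_borel \<rightarrow>\<^sub>M strip_borel"

lemma space_strip_borel: "space strip_borel = strip"
  by (simp add: space_restrict_space)

lemma jmeasD:
  assumes "jmeas M g" "f \<in> N \<rightarrow>\<^sub>M M" "h \<in> N \<rightarrow>\<^sub>M strip_borel"
  shows "(\<lambda>z. g (f z) (h z)) \<in> N \<rightarrow>\<^sub>M strip_borel"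
  using measurable_compose[OF measurable_Pair[OF assms(2,3)] assms(1)[unfolded jmeas_def]] by simp

lemma measurable_strip_borel_iff:
  "f \<in> N \<rightarrow>\<^sub>M strip_borel \<longleftrightarrow> f \<in> borel_measurable N \<and> (\<forall>z\<in>space N. f z \<in> strip)"
  by (auto simp: measurable_restrict_space2_iff)

lemma jmeas_comp:
  assumes "jmeas M f" "jmeas M g"
  shows "jmeas M (\<lambda>\<omega> x. f \<omega> (g \<omega> x))"
  unfolding jmeas_def
  by (rule jmeasD[OF assms(1) measurable_fst assms(2)[unfolded jmeas_def]])

text \<open>The inverse image lies in a compact set \<open>C\<close> exactly if points of a
  countable dense subset of \<open>C\<close> are mapped arbitrarily close to the target. This uses
  continuity in one direction and compactness in the other, and is a countable combination of
  measurable conditions. Closed sets are then exhausted by compact ones.\<close>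

lemma jmeas_inv:
  assumes g: "jmeas M g" and bij: "\<And>\<omega>. bij_betw (g \<omega>) strip strip" and cont: "\<And>\<omega>. continuous_on strip (g \<omega>)"
  shows "jmeas M (\<lambda>\<omega>. inv_into strip (g \<omega>))"
proof -
  let ?N = "M \<Otimes>\<^sub>M strip_borel"
  let ?h = "\<lambda>z. inv_into strip (g (fst z)) (snd z)"
  have sp: "snd z \<in> strip" if "z \<in> space ?N" for z
    using that by (auto simp: space_pair_measure space_strip_borel)
  have compact: "?h -` C \<inter> space ?N \<in> sets ?N" if C: "compact C" "C \<subseteq> strip" for C
  proof -
    obtain D where D: "countable D" "D \<subseteq> C" "C \<subseteq> closure D" using separable by blast
    \<comment> \<open>Each set on the right evaluates \<open>g\<close> only at fixed points
      x.\<close>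
    have "?h -` C \<inter> space ?N = (\<Inter>n. \<Union>x\<in>D. {z \<in> space ?N. dist (g (fst z) x) (snd z) < 1 / real (Suc n)})"
      (is "?L = ?R")
    proof (intro equalityI subsetI)
      fix z assume z: "z \<in> ?L"
      let ?x = "?h z"
      have x: "?x \<in> C" "?x \<in> strip" "g (fst z) ?x = snd z"
        using z C bij_inv_strip[OF bij sp, of z] by auto
      have "\<exists>x\<in>D. dist (g (fst z) x) (snd z) < 1 / real (Suc n)" for n
      proof -
        have "0 < 1 / real (Suc n)" by simp
        from cont[of "fst z", unfolded continuous_on_iff, rule_format, OF x(2) this]
        obtain d where d: "d > 0" "\<And>y. y \<in> strip \<Longrightarrow> dist y ?x < d \<Longrightarrow> dist (g (fst z) y) (g (fst z) ?x) < 1 / real (Suc n)"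
          by blast
        have "?x \<in> closure D" using x(1) D(3) by blast
        then obtain y where y: "y \<in> D" "dist y ?x < d" using d(1) unfolding closure_approachable by blast
        then have "y \<in> strip" using D(2) C(2) by blast
        from d(2)[OF this y(2)] show ?thesis using y(1) unfolding x(3) by blast
      qed
      then show "z \<in> ?R" using z by blast
    next
      fix z assume z: "z \<in> ?R"
      then have zN: "z \<in> space ?N" by blast
      have "\<forall>n. \<exists>x. x \<in> D \<and> dist (g (fst z) x) (snd z) < 1 / real (Suc n)" using z by blast
      then obtain X where X: "\<And>n. X n \<in> D" "\<And>n. dist (g (fst z) (X n)) (snd z) < 1 / real (Suc n)" by metis
      have XC: "X n \<in> C" for n using X(1) D(2) by auto
      obtain l r where lr: "l \<in> C" "strict_mono (r :: nat \<Rightarrow> nat)" "(X \<circ> r) \<longlonglongrightarrow> l"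
        using C(1) XC unfolding compact_def by metis
      have "(\<lambda>n. g (fst z) ((X \<circ> r) n)) \<longlonglongrightarrow> g (fst z) l"
      proof (rule continuous_on_tendsto_compose[OF cont lr(3)])
        show "l \<in> strip" using lr(1) C(2) by blast
        have "(X \<circ> r) n \<in> strip" for n using XC[of "r n"] C(2) by auto
        then show "\<forall>\<^sub>F n in sequentially. (X \<circ> r) n \<in> strip" by (intro always_eventually allI)
      qed
      moreover have "(\<lambda>n. g (fst z) (X n)) \<longlonglongrightarrow> snd z"
        unfolding tendsto_dist_iff[of _ "snd z"]
        by (rule Lim_null_comparison[OF _ tendsto_inverse_Suc[of 1]])
          (use X(2) in \<open>auto intro!: always_eventually less_imp_le simp del: of_nat_Suc\<close>)
      then have "(\<lambda>n. g (fst z) ((X \<circ> r) n)) \<longlonglongrightarrow> snd z"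
        using LIMSEQ_subseq_LIMSEQ[OF _ lr(2)] by (simp add: o_def)
      ultimately have "g (fst z) l = snd z" by (rule LIMSEQ_unique)
      then have "?h z = l" using bij_inv_strip(3)[OF bij, of l "fst z"] lr(1) C(2) by auto
      then show "z \<in> ?L" using lr(1) zN by simp
    qed
    moreover have "{z \<in> space ?N. dist (g (fst z) x) (snd z) < 1 / real (Suc n)} \<in> sets ?N" if "x \<in> D" for x n
    proof -
      have x: "x \<in> strip" using that D(2) C(2) by auto
      have "(\<lambda>z. g (fst z) x) \<in> ?N \<rightarrow>\<^sub>M strip_borel"
        by (rule jmeasD[OF g measurable_fst measurable_const]) (simp add: space_strip_borel x)
      then have [measurable]: "(\<lambda>z. g (fst z) x) \<in> borel_measurable ?N" by (simp add: measurable_strip_borel_iff)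
      have [measurable]: "snd \<in> borel_measurable ?N"
        using measurable_snd[of M strip_borel] by (simp add: measurable_strip_borel_iff)
      show ?thesis by measurable
    qed
    then have "(\<Union>x\<in>D. {z \<in> space ?N. dist (g (fst z) x) (snd z) < 1 / real (Suc n)}) \<in> sets ?N" for n
      by (intro sets.countable_UN'[OF D(1)]) (simp add: image_subset_iff del: of_nat_Suc)
    then have "?R \<in> sets ?N"
      by (intro sets.countable_INT) (simp_all add: image_subset_iff del: of_nat_Suc)
    ultimately show ?thesis by simp
  qed
  have closed: "?h -` S \<inter> space ?N \<in> sets ?N" if S: "closed S" for S
  proof -
    have "?h -` S \<inter> space ?N = (\<Union>n. ?h -` (S \<inter> strip \<inter> cball 0 (real n)) \<inter> space ?N)"
    proof (intro equalityI subsetI)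
      fix z assume z: "z \<in> ?h -` S \<inter> space ?N"
      obtain n where "norm (?h z) \<le> real n" using real_arch_simple by blast
      then have "z \<in> ?h -` (S \<inter> strip \<inter> cball 0 (real n)) \<inter> space ?N"
        using z bij_inv_strip(1)[OF bij sp, of z] by auto
      then show "z \<in> (\<Union>n. ?h -` (S \<inter> strip \<inter> cball 0 (real n)) \<inter> space ?N)" by blast
    qed blast
    moreover have "?h -` (S \<inter> strip \<inter> cball 0 (real n)) \<inter> space ?N \<in> sets ?N" for n
      by (rule compact) (use S closed_strip in \<open>auto intro!: closed_Int_compact closed_Int\<close>)
    then have "(\<Union>n. ?h -` (S \<inter> strip \<inter> cball 0 (real n)) \<inter> space ?N) \<in> sets ?N"
      by (intro sets.countable_UN image_subsetI)
    ultimately show ?thesis by metis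
  qed
  have "?h \<in> borel_measurable ?N"
  proof (rule borel_measurableI)
    fix S :: "(real \<times> real) set" assume "open S"
    then have "?h -` (- S) \<inter> space ?N \<in> sets ?N" by (intro closed) auto
    then have "space ?N - (?h -` (- S) \<inter> space ?N) \<in> sets ?N" by auto
    moreover have "space ?N - (?h -` (- S) \<inter> space ?N) = ?h -` S \<inter> space ?N" by auto
    ultimately show "?h -` S \<inter> space ?N \<in> sets ?N" by simp
  qed
  then show ?thesis
    unfolding jmeas_def measurable_strip_borel_iff using bij_inv_strip(1)[OF bij sp] by blast
qed

section \<open>Measurability of partial derivatives and vertical integrals\<close>

definition jmeas_real :: "'w measure \<Rightarrow> ('w \<Rightarrow> real \<times> real \<Rightarrow> real) \<Rightarrow> bool" where
  "jmeas_real M g \<longleftrightarrow> (\<lambda>z. g (fst z) (snd z)) \<in> borel_measurable (M \<Otimes>\<^sub>M strip_borel)"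

lemma jmeas_realD:
  assumes "jmeas_real M g" "f \<in> N \<rightarrow>\<^sub>M M" "h \<in> N \<rightarrow>\<^sub>M strip_borel"
  shows "(\<lambda>z. g (f z) (h z)) \<in> borel_measurable N"
  using measurable_compose[OF measurable_Pair[OF assms(2,3)] assms(1)[unfolded jmeas_real_def]] by simp

lemma snd_borel: "snd \<in> borel_measurable (M \<Otimes>\<^sub>M strip_borel)"
  using measurable_snd[of M strip_borel] by (simp add: measurable_strip_borel_iff)

lemma inward_measurable [measurable]: "inward \<in> borel_measurable borel"
  unfolding inward_def by measurable

lemma borel_measurable_fst_snd:
  assumes "f \<in> borel_measurable N"
  shows "(\<lambda>z. fst (f z) :: real) \<in> borel_measurable N" "(\<lambda>z. snd (f z) :: real) \<in> borel_measurable N"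
  using measurable_compose[OF assms, of fst borel] measurable_compose[OF assms, of snd borel]
  by (simp_all add: borel_prod[symmetric])

lemma jmeas_partials:
  assumes g: "jmeas M g"
  shows "(\<lambda>z. dq (g (fst z)) (snd z)) \<in> borel_measurable (M \<Otimes>\<^sub>M strip_borel)"
    "(\<lambda>z. dp (g (fst z)) (snd z)) \<in> borel_measurable (M \<Otimes>\<^sub>M strip_borel)"
proof -
  let ?N = "M \<Otimes>\<^sub>M strip_borel"
  note [measurable] = snd_borel[of M] borel_measurable_fst_snd[OF snd_borel[of M]]
  have sp: "snd z \<in> strip" if "z \<in> space ?N" for z
    using that by (auto simp: space_pair_measure space_strip_borel)
  have g0 [measurable]: "(\<lambda>z. g (fst z) (snd z)) \<in> borel_measurable ?N"
    using g by (simp add: jmeas_def measurable_strip_borel_iff)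
  have gs: "(\<lambda>z. g (fst z) (snd z + a z)) \<in> borel_measurable ?N"
    if "a \<in> borel_measurable ?N" "\<And>z. z \<in> space ?N \<Longrightarrow> snd z + a z \<in> strip" for a
  proof -
    have "(\<lambda>z. snd z + a z) \<in> ?N \<rightarrow>\<^sub>M strip_borel"
      unfolding measurable_strip_borel_iff using that snd_borel[of M] by auto
    from jmeasD[OF g measurable_fst this] show ?thesis by (simp add: measurable_strip_borel_iff)
  qed
  have 1: "(\<lambda>z. g (fst z) (snd z + (1 / real (Suc n), 0))) \<in> borel_measurable ?N" for n
    by (rule gs) (use sp in auto)
  show "(\<lambda>z. dq (g (fst z)) (snd z)) \<in> borel_measurable ?N"
    unfolding dq_def by (intro borel_measurable_lim_metric borel_measurable_scaleR borel_measurable_diff borel_measurable_const 1 g0)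
  have 2: "(\<lambda>z. g (fst z) (snd z + (0, inward (snd (snd z)) / real (Suc n)))) \<in> borel_measurable ?N" for n
  proof (rule gs)
    show "(\<lambda>z. (0 :: real, inward (snd (snd z)) / real (Suc n))) \<in> borel_measurable ?N"
      using measurable_compose[OF borel_measurable_fst_snd(2)[OF snd_borel] inward_measurable]
      by (intro borel_measurable_Pair) simp_all
  qed (rule inward_mem_strip[OF sp])
  show "(\<lambda>z. dp (g (fst z)) (snd z)) \<in> borel_measurable ?N"
    unfolding dp_def
    by (intro borel_measurable_lim_metric borel_measurable_scaleR borel_measurable_diff 2 g0) measurable
qed

lemma jmeas_real_vint:
  assumes d: "jmeas_real M d" and c: "\<And>\<omega>. continuous_on strip (d \<omega>)"
  shows "jmeas_real M (\<lambda>\<omega>. vint (d \<omega>))"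
proof -
  let ?N = "M \<Otimes>\<^sub>M strip_borel"
  \<comment> \<open>Clamping keeps the argument in the strip for every s, where joint measurability
    is available; an indicator then cuts the integral down to [-1, p] and makes the clamping
    invisible.\<close>
  let ?c = "\<lambda>s :: real. max (-1) (min 1 s)"
  have sp: "snd z \<in> strip" if "z \<in> space ?N" for z
    using that by (auto simp: space_pair_measure space_strip_borel)
  have [measurable]: "(\<lambda>y. d (fst (fst y)) (fst (snd (fst y)), ?c (snd y))) \<in> borel_measurable (?N \<Otimes>\<^sub>M lborel)"
  proof (rule jmeas_realD[OF d])
    show "(\<lambda>y. fst (fst y)) \<in> ?N \<Otimes>\<^sub>M lborel \<rightarrow>\<^sub>M M" by measurable
    have [measurable]: "(\<lambda>y. fst (snd (fst y))) \<in> borel_measurable (?N \<Otimes>\<^sub>M lborel)"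
      by (rule measurable_compose[OF measurable_fst borel_measurable_fst_snd(1)[OF snd_borel]])
    show "(\<lambda>y. (fst (snd (fst y)), ?c (snd y))) \<in> ?N \<Otimes>\<^sub>M lborel \<rightarrow>\<^sub>M strip_borel"
      unfolding measurable_strip_borel_iff
    proof
      show "(\<lambda>y. (fst (snd (fst y)), ?c (snd y))) \<in> borel_measurable (?N \<Otimes>\<^sub>M lborel)" by measurable
    qed (auto simp: strip_iff)
  qed
  have [measurable]: "(\<lambda>y. snd (snd (fst y))) \<in> borel_measurable (?N \<Otimes>\<^sub>M lborel)"
    by (rule measurable_compose[OF measurable_fst borel_measurable_fst_snd(2)[OF snd_borel]])
  have "(\<lambda>z. \<integral>s. (if -1 \<le> s \<and> s \<le> snd (snd z) then 1 else 0) * d (fst z) (fst (snd z), ?c s) \<partial>lborel) \<in> borel_measurable ?N"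
  proof (rule lborel.borel_measurable_lebesgue_integral)
    show "(\<lambda>(z, s). (if -1 \<le> s \<and> s \<le> snd (snd z) then 1 else 0) * d (fst z) (fst (snd z), ?c s)) \<in> borel_measurable (?N \<Otimes>\<^sub>M lborel)"
      unfolding case_prod_beta by measurable
  qed
  moreover have "(\<integral>s. (if -1 \<le> s \<and> s \<le> snd (snd z) then 1 else 0) * d (fst z) (fst (snd z), ?c s) \<partial>lborel) = vint (d (fst z)) (snd z)"
    if z: "z \<in> space ?N" for z
  proof -
    have le: "-1 \<le> snd (snd z)" "snd (snd z) \<le> 1" using sp[OF z] by (cases z; cases "snd z"; auto simp: strip_iff)+
    have "continuous_on {-1..snd (snd z)} (\<lambda>s. d (fst z) (fst (snd z), s))"
      by (rule continuous_on_subset[OF strip_section[OF c]]) (use le in auto)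
    then have "set_integrable lborel {-1..snd (snd z)} (\<lambda>s. d (fst z) (fst (snd z), s))"
      by (rule borel_integrable_atLeastAtMost')
    from set_borel_integral_eq_integral(2)[OF this]
    have "vint (d (fst z)) (snd z) = (LINT s:{-1..snd (snd z)}|lborel. d (fst z) (fst (snd z), s))"
      by (simp add: vint_def)
    also have "\<dots> = (\<integral>s. (if -1 \<le> s \<and> s \<le> snd (snd z) then 1 else 0) * d (fst z) (fst (snd z), ?c s) \<partial>lborel)"
      unfolding set_lebesgue_integral_def
    proof (rule Bochner_Integration.integral_cong)
      fix s
      have "?c s = s" if "-1 \<le> s \<and> s \<le> snd (snd z)" using that le by simp
      then show "indicat_real {-1..snd (snd z)} s *\<^sub>R d (fst z) (fst (snd z), s)
          = (if -1 \<le> s \<and> s \<le> snd (snd z) then 1 else 0) * d (fst z) (fst (snd z), ?c s)"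
        by (simp add: indicator_def)
    qed simp
    finally show ?thesis by simp
  qed
  ultimately show ?thesis unfolding jmeas_real_def by (subst (asm) measurable_cong) auto
qed

lemma fst_top_measurable: "(\<lambda>z. (fst (snd z), 1)) \<in> M \<Otimes>\<^sub>M strip_borel \<rightarrow>\<^sub>M strip_borel"
  unfolding measurable_strip_borel_iff
  using borel_measurable_fst_snd(1)[OF snd_borel[of M]] by (auto simp: strip_iff)

lemma jmeas_rearr:
  assumes g: "jmeas M g" and c: "\<And>\<omega>. continuous_on strip (dens (g \<omega>))"
      "\<And>\<omega>. continuous_on strip (\<lambda>x. fst (g \<omega> x - x) * snd (dp (g \<omega>) x))"
    and s: "\<And>\<omega> x. x \<in> strip \<Longrightarrow> rearr (g \<omega>) x \<in> strip"
  shows "jmeas M (\<lambda>\<omega>. rearr (g \<omega>))"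
proof -
  let ?N = "M \<Otimes>\<^sub>M strip_borel"
  note [measurable] = snd_borel[of M] borel_measurable_fst_snd[OF snd_borel[of M]]
    borel_measurable_fst_snd[OF jmeas_partials(1)[OF g]] borel_measurable_fst_snd[OF jmeas_partials(2)[OF g]]
  have "(\<lambda>z. g (fst z) (snd z)) \<in> borel_measurable ?N"
    using g by (simp add: jmeas_def measurable_strip_borel_iff)
  note [measurable] = borel_measurable_fst_snd[OF this]
  have "jmeas_real M (\<lambda>\<omega>. dens (g \<omega>))"
    unfolding jmeas_real_def dens_def mdet_def Jac_def case_prod_beta fst_conv snd_conv by measurable
  then have V: "jmeas_real M (\<lambda>\<omega>. vint (dens (g \<omega>)))" by (rule jmeas_real_vint[OF _ c(1)])
  have "jmeas_real M (\<lambda>\<omega> x. fst (g \<omega> x - x) * snd (dp (g \<omega>) x))"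
    unfolding jmeas_real_def fst_diff by measurable
  then have W: "jmeas_real M (\<lambda>\<omega>. vint (\<lambda>x. fst (g \<omega> x - x) * snd (dp (g \<omega>) x)))" by (rule jmeas_real_vint[OF _ c(2)])
  note [measurable] = V[unfolded jmeas_real_def] jmeas_realD[OF V measurable_fst fst_top_measurable]
    jmeas_realD[OF W measurable_fst fst_top_measurable]
  have "(\<lambda>z. rearr (g (fst z)) (snd z)) \<in> borel_measurable ?N"
    unfolding rearr_def area_shift_def by measurable
  then show ?thesis
    unfolding jmeas_def measurable_strip_borel_iff using s by (auto simp: space_pair_measure space_strip_borel)
qed

text \<open>The covariance satisfied by every map of the form \<open>rmap\<close>: moving \<omega>
  along the flow translates q. Conversely it lets a map be rebuilt from its values on the fibre q =
  0.\<close>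

definition equivariant :: "(real \<Rightarrow> 'w \<Rightarrow> 'w) \<Rightarrow> ('w \<Rightarrow> real \<times> real \<Rightarrow> real \<times> real) \<Rightarrow> bool" where
  "equivariant \<tau> g \<longleftrightarrow> (\<forall>a \<omega>. \<forall>x\<in>strip. g (\<tau> a \<omega>) x = g \<omega> (x + (a, 0)) - (a, 0))"

lemma equivariantD: "equivariant \<tau> g \<Longrightarrow> x \<in> strip \<Longrightarrow> g (\<tau> a \<omega>) x = g \<omega> (x + (a, 0)) - (a, 0)"
  by (auto simp: equivariant_def)

lemma equivariant_comp:
  assumes "equivariant \<tau> f" "equivariant \<tau> g" "\<And>\<omega> x. x \<in> strip \<Longrightarrow> g \<omega> x \<in> strip"
  shows "equivariant \<tau> (\<lambda>\<omega> x. f \<omega> (g \<omega> x))"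
  unfolding equivariant_def
proof (intro allI ballI)
  fix a \<omega> x assume x: "x \<in> strip"
  have "f (\<tau> a \<omega>) (g (\<tau> a \<omega>) x) = f \<omega> (g (\<tau> a \<omega>) x + (a, 0)) - (a, 0)"
    by (rule equivariantD[OF assms(1) assms(3)[OF x]])
  then show "f (\<tau> a \<omega>) (g (\<tau> a \<omega>) x) = f \<omega> (g \<omega> (x + (a, 0))) - (a, 0)"
    by (simp add: equivariantD[OF assms(2) x])
qed

lemma equivariant_inv:
  assumes "equivariant \<tau> g" "\<And>\<omega>. bij_betw (g \<omega>) strip strip"
  shows "equivariant \<tau> (\<lambda>\<omega>. inv_into strip (g \<omega>))"
  unfolding equivariant_def
proof (intro allI ballI)
  fix a \<omega> y assume y: "y \<in> strip"
  let ?x = "inv_into strip (g (\<tau> a \<omega>)) y"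
  note x = bij_inv_strip[OF assms(2) y, of "\<tau> a \<omega>"]
  have "g \<omega> (?x + (a, 0)) = y + (a, 0)"
    using equivariantD[OF assms(1) x(1), of a \<omega>] x(2) by (simp add: algebra_simps)
  then have "inv_into strip (g \<omega>) (y + (a, 0)) = ?x + (a, 0)"
    using bij_inv_strip(3)[OF assms(2), of "?x + (a, 0)" \<omega>] x(1) by simp
  then show "?x = inv_into strip (g \<omega>) (y + (a, 0)) - (a, 0)" by simp
qed

text \<open>Purely algebraic: the fixed difference quotients behind \<open>dq\<close> and
  \<open>dp\<close> are carried into each other by the translation, whether or not they
  converge.\<close>

lemma partials_translate:
  fixes g g' :: "real \<times> real \<Rightarrow> real \<times> real"
  assumes g: "\<And>z. z \<in> strip \<Longrightarrow> g' z = g (z + (a, 0)) - (a, 0)" and z: "z \<in> strip"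
  shows "dq g' z = dq g (z + (a, 0))" "dp g' z = dp g (z + (a, 0))" "dens g' z = dens g (z + (a, 0))"
proof -
  have "g' (z + (h, 0)) = g (z + (a, 0) + (h, 0)) - (a, 0)" for h
    using g[of "z + (h, 0)"] z by (simp add: ac_simps del: add_Pair)
  then show q: "dq g' z = dq g (z + (a, 0))" unfolding dq_def using g[OF z] by simp
  have i: "snd (z + (a, 0)) = snd z" by (cases z) simp
  have "g' (z + (0, inward (snd z) / real (Suc n))) = g (z + (a, 0) + (0, inward (snd z) / real (Suc n))) - (a, 0)" for n
    using g[OF inward_mem_strip[OF z, of n]] by (simp add: ac_simps del: add_Pair of_nat_Suc)
  then show p: "dp g' z = dp g (z + (a, 0))" unfolding dp_def i using g[OF z] by simp
  show "dens g' z = dens g (z + (a, 0))" by (simp add: dens_def Jac_def q p)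
qed

text \<open>Only vertical integrals of the density and of the displacement times a partial
  derivative occur, and these merely move with q.\<close>

lemma equivariant_rearr:
  assumes g: "equivariant \<tau> g"
  shows "equivariant \<tau> (\<lambda>\<omega>. rearr (g \<omega>))"
  unfolding equivariant_def
proof (intro allI ballI)
  fix a \<omega> x assume x: "x \<in> strip"
  have tr: "g (\<tau> a \<omega>) z = g \<omega> (z + (a, 0)) - (a, 0)" if "z \<in> strip" for z
    by (rule equivariantD[OF g that])
  note p = partials_translate(2)[of "g (\<tau> a \<omega>)" "g \<omega>" a, OF tr]
  have d: "dens (g (\<tau> a \<omega>)) (b, s) = dens (g \<omega>) (b + a, s)" if "(b, s) \<in> strip" for b s
    using partials_translate(3)[of "g (\<tau> a \<omega>)" "g \<omega>" a, OF tr that] by simp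
  have V: "vint (dens (g (\<tau> a \<omega>))) (b, r) = vint (dens (g \<omega>)) (b + a, r)" if "r \<le> 1" for b r
    unfolding vint_def fst_conv snd_conv by (rule integral_cong) (use that d in \<open>simp add: strip_iff\<close>)
  have W: "area_shift (g (\<tau> a \<omega>)) b = area_shift (g \<omega>) (b + a)" for b
  proof -
    have "integral {-1..1} (\<lambda>s. fst (g (\<tau> a \<omega>) (b, s) - (b, s)) * snd (dp (g (\<tau> a \<omega>)) (b, s))) =
        integral {-1..1} (\<lambda>s. fst (g \<omega> (b + a, s) - (b + a, s)) * snd (dp (g \<omega>) (b + a, s)))"
      by (rule integral_cong) (use p equivariantD[OF g] in \<open>simp add: strip_iff\<close>)
    then show ?thesis by (simp add: area_shift_def vint_def)
  qed
  obtain b r where "x = (b, r)" "r \<le> 1" using x by (cases x) (auto simp: strip_iff)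
  then show "rearr (g (\<tau> a \<omega>)) x = rearr (g \<omega>) (x + (a, 0)) - (a, 0)"
    by (simp add: rearr_def V W)
qed

section \<open>Monotone twists\<close>

text \<open>At q = 0 the first component of the image is itself the displacement, so nothing has to
  be subtracted.\<close>

definition prof :: "('w \<Rightarrow> real \<times> real \<Rightarrow> real \<times> real) \<Rightarrow> 'w \<times> real \<Rightarrow> real \<times> real" where
  "prof g = (\<lambda>(\<omega>, p). g \<omega> (0, p))"

lemma prof_apply: "prof g (\<omega>, p) = g \<omega> (0, p)"
  by (simp add: prof_def)

lemma rmap_prof:
  assumes "equivariant \<tau> g" "x \<in> strip"
  shows "rmap \<tau> (prof g) \<omega> x = g \<omega> x"
proof -
  obtain q p where x: "x = (q, p)" by (cases x)
  have "g (\<tau> q \<omega>) (0, p) = g \<omega> (q, p) - (q, 0)"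
    using equivariantD[OF assms(1), of "(0, p)" q \<omega>] assms(2) by (simp add: x strip_iff)
  then show ?thesis by (simp add: rmap_def prof_def x prod_eq_iff)
qed

lemma profile_prof:
  assumes "jmeas M g"
  shows "profile M (prof g)"
proof -
  have "snd \<in> M \<Otimes>\<^sub>M restrict_space borel {-1..1::real} \<rightarrow>\<^sub>M restrict_space borel {-1..1}" by simp
  then have "snd \<in> borel_measurable (M \<Otimes>\<^sub>M restrict_space borel {-1..1::real})"
    by (simp add: measurable_restrict_space2_iff)
  then have "(\<lambda>z. (0, snd z)) \<in> M \<Otimes>\<^sub>M restrict_space borel {-1..1::real} \<rightarrow>\<^sub>M strip_borel"
    unfolding measurable_strip_borel_iff by (auto simp: strip_iff space_pair_measure space_restrict_space)
  from jmeasD[OF assms measurable_fst this] show ?thesis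
    unfolding profile_def prof_def case_prod_beta .
qed

lemma inv_into_strip_cong:
  assumes "\<And>x. x \<in> strip \<Longrightarrow> f x = g x"
  shows "inv_into strip f = inv_into strip g"
  unfolding inv_into_def using assms by (intro ext) (metis (mono_tags, lifting))

lemma diffeo_strip_cong:
  assumes "diffeo_strip f" "\<And>x. x \<in> strip \<Longrightarrow> f x = g x"
  shows "diffeo_strip g"
proof -
  have d: "(g has_derivative D) (at x within strip)" if "(f has_derivative D) (at x within strip)" "x \<in> strip" for D x
    using has_derivative_transform[OF that(2) _ that(1), of g] assms(2) by simp
  have "C1_strip g" using assms(1) d unfolding diffeo_strip_def C1_strip_def by blast
  moreover have "bij_betw g strip strip" using assms bij_betw_cong[of strip f g] unfolding diffeo_strip_def by blast
  ultimately show ?thesis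
    using assms(1) inv_into_strip_cong[of f g] assms(2) unfolding diffeo_strip_def by simp
qed

lemma deriv_bounded_cong:
  assumes "deriv_bounded K f" "\<And>x. x \<in> strip \<Longrightarrow> f x = g x"
  shows "deriv_bounded K g"
  unfolding deriv_bounded_def
proof
  fix x assume x: "x \<in> strip"
  obtain D where D: "(f has_derivative D) (at x within strip)" "onorm D \<le> K"
    using assms(1) x unfolding deriv_bounded_def by blast
  have "(g has_derivative D) (at x within strip)"
    using has_derivative_transform[OF x _ D(1), of g] assms(2) by simp
  then show "\<exists>D. (g has_derivative D) (at x within strip) \<and> onorm D \<le> K" using D(2) by blast
qed

definition shear :: "real \<Rightarrow> real \<times> real \<Rightarrow> real \<times> real" where
  "shear k = (\<lambda>(q, p). (q + k * p, p))"

lemma shear_shear: "shear a (shear b x) = shear (a + b) x"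
  by (cases x) (simp add: shear_def algebra_simps)

lemma shear_mem [simp]: "shear k x \<in> strip \<longleftrightarrow> x \<in> strip"
  by (cases x) (simp add: shear_def strip_iff)

lemma shear_0 [simp]: "shear 0 x = x"
  by (cases x) (simp add: shear_def)

lemma shear_mapp: "shear k = mapp (1, k, 0, 1)"
  by (auto simp: shear_def mapp_def)

lemma bij_shear: "bij_betw (shear k) strip strip"
  by (rule bij_betw_byWitness[where f' = "shear (- k)"]) (auto simp: shear_shear)

lemma shear_diff: "shear k x - shear k y = shear k (x - y)"
  by (cases x; cases y) (simp add: shear_def algebra_simps)

lemma UD_shear: "UD (\<lambda>i :: 'i. shear k) (\<lambda>i x. (1, k, 0, 1))"
  unfolding UD_def
proof (intro conjI allI ballI bij_shear)
  have "norm (x - y) \<le> (4 * norm (1 :: real, - k, 0 :: real, 1 :: real)) * norm (shear k x - shear k y)" for x y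
  proof -
    have "norm (shear (- k) (shear k (x - y))) \<le> (4 * norm (1 :: real, - k, 0 :: real, 1 :: real)) * norm (shear k (x - y))"
      unfolding shear_mapp[of "- k"] by (rule norm_mapp_le)
    then show ?thesis by (simp add: shear_shear shear_diff)
  qed
  then show "\<exists>L. \<forall>i :: 'i. \<forall>x\<in>strip. \<forall>y\<in>strip. norm (x - y) \<le> L * norm (shear k x - shear k y)" by blast
  show "(shear k has_derivative mapp (1, k, 0, 1)) (at x within strip)" for x
    unfolding shear_mapp by (rule bounded_linear_imp_has_derivative[OF bounded_linear_mapp])
  show "\<exists>d>0. \<forall>i :: 'i. \<forall>x :: real \<times> real \<in> strip. d \<le> mdet (1, k, 0, 1)"
    by (intro exI[of _ 1]) (simp add: mdet_def)
qed (auto simp: shear_def)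

lemma shear_area_preserving: "area_preserving (shear k)"
  by (rule UD_area_preserving[where g = "\<lambda>_ :: unit. shear k", OF UD_shear]) (simp add: mdet_def)

lemma shear_equivariant: "equivariant \<tau> (\<lambda>\<omega>. shear k)"
  by (auto simp: equivariant_def shear_def)

lemma shear_jmeas: "jmeas M (\<lambda>\<omega>. shear k)"
proof -
  have "continuous_on UNIV (shear k)"
    unfolding shear_mapp by (rule linear_continuous_on[OF bounded_linear_mapp])
  then have "shear k \<in> borel_measurable borel" by (rule borel_measurable_continuous_onI)
  from measurable_compose[OF snd_borel this] show ?thesis
    unfolding jmeas_def measurable_strip_borel_iff
    by (auto simp: space_pair_measure space_strip_borel)
qed

lemma UD_partials_fst:
  assumes "UD g J" "(q, p) \<in> strip"
  shows "((\<lambda>q. fst (g i (q, p))) has_real_derivative fst (J i (q, p))) (at q)"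
    "((\<lambda>p. fst (g i (q, p))) has_real_derivative fst (snd (J i (q, p)))) (at p within {-1..1})"
proof -
  note D = UD_D(5)[OF assms, of i]
  obtain a b c d where J: "J i (q, p) = (a, b, c, d)" by (cases "J i (q, p)")
  have "((\<lambda>q. (q, p)) has_derivative (\<lambda>h. (h, 0))) (at q within UNIV)"
    by (auto intro!: derivative_eq_intros)
  moreover have "range (\<lambda>q. (q, p)) \<subseteq> strip" using assms(2) by (auto simp: strip_iff)
  ultimately have "((\<lambda>q. g i (q, p)) has_derivative (\<lambda>h. mapp (J i (q, p)) (h, 0))) (at q)"
    using has_derivative_in_compose2[OF UD_D(5)[OF assms(1)], of "\<lambda>q. (q, p)" UNIV q "\<lambda>h. (h, 0)" i] by simp
  from has_derivative_fst[OF this]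
  show "((\<lambda>q. fst (g i (q, p))) has_real_derivative fst (J i (q, p))) (at q)"
    unfolding has_field_derivative_def by (rule has_derivative_eq_rhs) (auto simp: J mapp_def)
  have "((\<lambda>p. (q, p)) has_derivative (\<lambda>h. (0, h))) (at p within {-1..1})"
    by (auto intro!: derivative_eq_intros)
  moreover have "(\<lambda>p. (q, p)) ` {-1..1} \<subseteq> strip" by (auto simp: strip_iff)
  ultimately have "((\<lambda>p. g i (q, p)) has_derivative (\<lambda>h. mapp (J i (q, p)) (0, h))) (at p within {-1..1})"
    using has_derivative_in_compose2[OF UD_D(5)[OF assms(1)], of "\<lambda>p. (q, p)" "{-1..1}" p "\<lambda>h. (0, h)" i] assms(2)
    by (simp add: strip_iff)
  from has_derivative_fst[OF this]
  show "((\<lambda>p. fst (g i (q, p))) has_real_derivative fst (snd (J i (q, p)))) (at p within {-1..1})"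
    unfolding has_field_derivative_def by (rule has_derivative_eq_rhs) (auto simp: J mapp_def)
qed

lemma regular_rmap_UD:
  assumes "UD g J" "AE \<omega> in M. \<forall>x\<in>strip. rmap \<tau> f \<omega> x = g \<omega> x"
  shows "regular_rmap M \<tau> f"
proof -
  obtain K where K: "\<And>\<omega>. deriv_bounded K (g \<omega>)" using UD_deriv_bounded[OF assms(1)] by blast
  obtain K' where K': "\<And>\<omega>. deriv_bounded K' (inv_into strip (g \<omega>))"
    using UD_deriv_bounded[OF UD_inv[OF assms(1)]] by blast
  have mono: "deriv_bounded (max K K') h" if "deriv_bounded K h \<or> deriv_bounded K' h" for h
    using that unfolding deriv_bounded_def by (metis le_max_iff_disj)
  have "AE \<omega> in M. deriv_bounded (max K K') (rmap \<tau> f \<omega>) \<and> deriv_bounded (max K K') (inv_into strip (rmap \<tau> f \<omega>))"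
    using assms(2)
  proof (rule AE_mp, intro AE_I2 impI conjI)
    fix \<omega> assume e: "\<forall>x\<in>strip. rmap \<tau> f \<omega> x = g \<omega> x"
    show "deriv_bounded (max K K') (rmap \<tau> f \<omega>)"
      by (rule deriv_bounded_cong[OF mono]) (use K e in auto)
    have "inv_into strip (rmap \<tau> f \<omega>) = inv_into strip (g \<omega>)" by (rule inv_into_strip_cong) (use e in auto)
    then show "deriv_bounded (max K K') (inv_into strip (rmap \<tau> f \<omega>))" using mono K' by metis
  qed
  then show ?thesis unfolding regular_rmap_def by blast
qed

text \<open>With rows (a, b) and (c, d) for the Jacobian matrix of \<open>g\<close>, the first row
  after the shear is (a, a k + b). As a is at least \<open>\<delta>\<close> and b is bounded, both
  entries are positive for large k: the first gives monotonicity in q, the second in p.\<close>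

lemma (in prob_space) positive_monotone_shear:
  assumes ud: "UD g J" and jm: "jmeas M g" and eq: "equivariant \<tau> g" and db: "displ_bounded g"
    and \<delta>: "\<delta> > 0" "\<And>\<omega> x. x \<in> strip \<Longrightarrow> \<delta> \<le> fst (J \<omega> x)"
    and ap: "AE \<omega> in M. area_preserving (g \<omega>)"
  shows "\<exists>k0. \<forall>k\<ge>k0. positive_monotone M \<tau> (prof (\<lambda>\<omega> x. g \<omega> (shear k x))) \<and>
      regular_rmap M \<tau> (prof (\<lambda>\<omega> x. g \<omega> (shear k x))) \<and>
      (\<forall>\<omega>. \<forall>x\<in>strip. rmap \<tau> (prof (\<lambda>\<omega> x. g \<omega> (shear k x))) \<omega> x = g \<omega> (shear k x))"
proof -
  obtain K where K: "\<And>\<omega> x. x \<in> strip \<Longrightarrow> norm (J \<omega> x) \<le> K" using UD_D(7)[OF ud] by blast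
  obtain C where C: "\<And>\<omega> x. x \<in> strip \<Longrightarrow> norm (g \<omega> x - x) \<le> C" using db unfolding displ_bounded_def by blast
  show ?thesis
  \<comment> \<open>The first threshold lets the shear beat the displacement of \<open>g\<close> on
    the edges, the second makes \<open>\<delta> * k\<close> exceed the bound \<open>K\<close> on the
    entry b.\<close>
  proof (intro exI[of _ "max (C + 1) ((K + 1) / \<delta>)"] allI impI)
    fix k assume "max (C + 1) ((K + 1) / \<delta>) \<le> k"
    then have k: "C + 1 \<le> k" "(K + 1) / \<delta> \<le> k" by auto
    then have kd: "K + 1 \<le> \<delta> * k" using \<delta>(1) by (simp add: pos_divide_le_eq mult.commute)
    have C0: "C \<ge> 0" using order_trans[OF norm_ge_zero C[of "(0, 0)"]] by (simp add: strip_iff)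
    have k0: "k > 0" using k(1) C0 by simp
    define h where "h = (\<lambda>\<omega> x. g \<omega> (shear k x))"
    define L where "L = (\<lambda>\<omega> x. mmul (J \<omega> (shear k x)) (1, k, 0, 1))"
    have h_ud: "UD h L" unfolding h_def L_def by (rule UD_comp[OF ud UD_shear])
    have h_jm: "jmeas M h" unfolding h_def by (rule jmeas_comp[OF jm shear_jmeas])
    have h_eq: "equivariant \<tau> h" unfolding h_def by (rule equivariant_comp[OF eq shear_equivariant]) simp
    have r: "rmap \<tau> (prof h) \<omega> x = h \<omega> x" if "x \<in> strip" for \<omega> x by (rule rmap_prof[OF h_eq that])
    have L1: "fst (L \<omega> x) > 0" "fst (snd (L \<omega> x)) > 0" if x: "x \<in> strip" for \<omega> x
    proof -
      obtain a b c d where J': "J \<omega> (shear k x) = (a, b, c, d)" by (cases "J \<omega> (shear k x)")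
      have a: "\<delta> \<le> a" using \<delta>(2)[of "shear k x" \<omega>] x by (simp add: J')
      have "\<bar>b\<bar> \<le> norm (a, b, c, d)" by (rule mat2_norm)
      then have b: "\<bar>b\<bar> \<le> K" using K[of "shear k x" \<omega>] x by (simp add: J')
      have "\<delta> * k \<le> a * k" using a k0 by (intro mult_right_mono) auto
      then have "a * k + b > 0" using kd b by linarith
      then show "fst (L \<omega> x) > 0" "fst (snd (L \<omega> x)) > 0" using a \<delta>(1) by (simp_all add: L_def J' mmul_def)
    qed
    have mono_q: "fst (h \<omega> (a, p)) < fst (h \<omega> (b, p))" if "a < b" "p \<in> {-1..1}" for a b p \<omega>
    proof (rule DERIV_pos_imp_increasing[OF that(1)])
      fix x
      have "(x, p) \<in> strip" using that(2) by (simp add: strip_iff)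
      from UD_partials_fst(1)[OF h_ud this, of \<omega>] L1(1)[OF this, of \<omega>]
      show "\<exists>y. ((\<lambda>q. fst (h \<omega> (q, p))) has_real_derivative y) (at x) \<and> 0 < y" by blast
    qed
    have mono_p: "fst (h \<omega> (0, a)) < fst (h \<omega> (0, b))" if ab: "a < b" "-1 \<le> a" "b \<le> 1" for a b \<omega>
    \<comment> \<open>The two-sided p-derivative exists only between the edges; continuity covers
      the end points.\<close>
    proof (rule DERIV_pos_imp_increasing_open[OF ab(1)])
      fix p assume p: "a < p" "p < b"
      then have "(0, p) \<in> strip" using ab by (simp add: strip_iff)
      from UD_partials_fst(2)[OF h_ud this, of \<omega>] L1(2)[OF this, of \<omega>]
      show "\<exists>y. ((\<lambda>p. fst (h \<omega> (0, p))) has_real_derivative y) (at p) \<and> 0 < y"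
        using p ab by (auto simp: at_within_Icc_at)
    next
      have "continuous_on {-1..1} (\<lambda>p. fst (h \<omega> (0, p)))"
        by (intro continuous_on_fst strip_section UD_continuous[OF h_ud])
      then show "continuous_on {a..b} (\<lambda>p. fst (h \<omega> (0, p)))"
        by (rule continuous_on_subset) (use ab in auto)
    qed
    have disp: "norm (h \<omega> (0, p) - (k * p, p)) \<le> C" if "p \<in> {-1..1}" for \<omega> p
      using C[of "shear k (0, p)" \<omega>] that by (simp add: h_def strip_iff shear_def)
    have sgn: "fst (h \<omega> (0, 1)) > 0" "fst (h \<omega> (0, -1)) < 0" for \<omega>
    proof -
      have "\<bar>fst (h \<omega> (0, 1)) - k\<bar> \<le> C"
        using order_trans[OF fst_snd_norm(1) disp[of 1 \<omega>]] by simp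
      then show "fst (h \<omega> (0, 1)) > 0" using k(1) by linarith
      have "\<bar>fst (h \<omega> (0, -1)) + k\<bar> \<le> C"
        using order_trans[OF fst_snd_norm(1) disp[of "-1" \<omega>]] by simp
      then show "fst (h \<omega> (0, -1)) < 0" using k(1) by linarith
    qed
    \<comment> \<open>A bound uniform in \<omega> and p; integrated against a probability measure it
      settles the moment condition.\<close>
    have sq: "(fst (h \<omega> (0, p)))\<^sup>2 + (snd (h \<omega> (0, p)))\<^sup>2 \<le> (C + (k + 1))\<^sup>2" if p: "p \<in> {-1..1}" for \<omega> p
    proof -
      have "norm (h \<omega> (0, p)) \<le> norm (h \<omega> (0, p) - (k * p, p)) + norm (k * p, p)"
        using norm_triangle_ineq[of "h \<omega> (0, p) - (k * p, p)" "(k * p, p)"] by simp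
      also have "norm (k * p, p) \<le> \<bar>k * p\<bar> + \<bar>p\<bar>" using norm_Pair_le[of "k * p" p] by simp
      also have "\<dots> \<le> k * 1 + 1" using p k0 unfolding abs_mult by (intro add_mono mult_mono) auto
      finally have "norm (h \<omega> (0, p)) \<le> C + (k + 1)" using disp[OF p, of \<omega>] by simp
      then have "(norm (h \<omega> (0, p)))\<^sup>2 \<le> (C + (k + 1))\<^sup>2" by (intro power_mono) auto
      then show ?thesis by (cases "h \<omega> (0, p)") (simp add: norm_Pair)
    qed
    have bdry: "snd (h \<omega> (q, 1)) = 1" "snd (h \<omega> (q, -1)) = -1" for \<omega> q
      using UD_D(2)[OF h_ud, of "(q, 1)" \<omega>] UD_D(3)[OF h_ud, of "(q, -1)" \<omega>] by (auto simp: strip_iff)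
    have s1: "(q, 1) \<in> strip" "(q, -1) \<in> strip" for q by (auto simp: strip_iff)
    have "ap_random_twist M \<tau> (prof h)"
      unfolding ap_random_twist_def
    proof (intro conjI)
      show "profile M (prof h)" by (rule profile_prof[OF h_jm])
      show "AE \<omega> in M. diffeo_strip (rmap \<tau> (prof h) \<omega>) \<and> area_preserving (rmap \<tau> (prof h) \<omega>) \<and>
        (\<forall>q. snd (rmap \<tau> (prof h) \<omega> (q, 1)) = 1 \<and> snd (rmap \<tau> (prof h) \<omega> (q, -1)) = -1) \<and>
        strict_mono (\<lambda>q. fst (rmap \<tau> (prof h) \<omega> (q, 1))) \<and>
        strict_mono (\<lambda>q. fst (rmap \<tau> (prof h) \<omega> (q, -1))) \<and>
        fst (prof h (\<omega>, 1)) > 0 \<and> fst (prof h (\<omega>, -1)) < 0"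
        using ap
      proof (rule AE_mp, intro AE_I2 impI)
        fix \<omega> assume ap': "area_preserving (g \<omega>)"
        have "diffeo_strip (rmap \<tau> (prof h) \<omega>)"
          by (rule diffeo_strip_cong[OF UD_diffeo_strip[OF h_ud]]) (simp add: r)
        moreover have "area_preserving (h \<omega>)"
          unfolding h_def
          by (rule UD_area_preserving_comp[where g = "\<lambda>_ :: unit. shear k", OF ap' shear_area_preserving UD_shear])
        then have "area_preserving (rmap \<tau> (prof h) \<omega>)"
          by (rule area_preserving_cong) (simp add: r)
        ultimately show "diffeo_strip (rmap \<tau> (prof h) \<omega>) \<and> area_preserving (rmap \<tau> (prof h) \<omega>) \<and>
          (\<forall>q. snd (rmap \<tau> (prof h) \<omega> (q, 1)) = 1 \<and> snd (rmap \<tau> (prof h) \<omega> (q, -1)) = -1) \<and>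
          strict_mono (\<lambda>q. fst (rmap \<tau> (prof h) \<omega> (q, 1))) \<and>
          strict_mono (\<lambda>q. fst (rmap \<tau> (prof h) \<omega> (q, -1))) \<and>
          fst (prof h (\<omega>, 1)) > 0 \<and> fst (prof h (\<omega>, -1)) < 0"
          using mono_q sgn by (simp add: r s1 bdry strict_mono_def prof_apply)
      qed
      have "(SUP p\<in>{-1..1}. \<integral>\<^sup>+ \<omega>. ennreal ((fst (prof h (\<omega>, p)))\<^sup>2 + (snd (prof h (\<omega>, p)))\<^sup>2) \<partial>M) \<le> ennreal ((C + (k + 1))\<^sup>2)"
      proof (rule SUP_least)
        fix p :: real assume p: "p \<in> {-1..1}"
        have "(\<integral>\<^sup>+ \<omega>. ennreal ((fst (prof h (\<omega>, p)))\<^sup>2 + (snd (prof h (\<omega>, p)))\<^sup>2) \<partial>M) \<le> (\<integral>\<^sup>+ \<omega>. ennreal ((C + (k + 1))\<^sup>2) \<partial>M)"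
          by (intro nn_integral_mono ennreal_leI) (simp add: prof_apply sq[OF p])
        then show "(\<integral>\<^sup>+ \<omega>. ennreal ((fst (prof h (\<omega>, p)))\<^sup>2 + (snd (prof h (\<omega>, p)))\<^sup>2) \<partial>M) \<le> ennreal ((C + (k + 1))\<^sup>2)"
          by (simp add: emeasure_space_1)
      qed
      then show "(SUP p\<in>{-1..1}. \<integral>\<^sup>+ \<omega>. ennreal ((fst (prof h (\<omega>, p)))\<^sup>2 + (snd (prof h (\<omega>, p)))\<^sup>2) \<partial>M) < \<infinity>"
        by (rule order.strict_trans1) simp
    qed
    moreover have "AE \<omega> in M. strict_mono_on {-1..1} (\<lambda>p. fst (prof h (\<omega>, p)))"
      using mono_p by (intro AE_I2) (auto simp: strict_mono_on_def prof_apply)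
    ultimately have "positive_monotone M \<tau> (prof h)" unfolding positive_monotone_def by blast
    moreover have "regular_rmap M \<tau> (prof h)"
      by (rule regular_rmap_UD[OF h_ud]) (simp add: r)
    ultimately show "positive_monotone M \<tau> (prof (\<lambda>\<omega> x. g \<omega> (shear k x))) \<and>
      regular_rmap M \<tau> (prof (\<lambda>\<omega> x. g \<omega> (shear k x))) \<and>
      (\<forall>\<omega>. \<forall>x\<in>strip. rmap \<tau> (prof (\<lambda>\<omega> x. g \<omega> (shear k x))) \<omega> x = g \<omega> (shear k x))"
      using r unfolding h_def by blast
  qed
qed

text \<open>The shear itself is positive monotone, by the previous lemma for the identity
  \<open>shear 0\<close>. Agreement with its inverse is asked for almost surely only, which leaves
  room to alter the first factor on a null set.\<close>

lemma (in prob_space) negative_monotone_shear: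
  "\<exists>k0. \<forall>k\<ge>k0. \<forall>f. profile M f \<longrightarrow> (AE \<omega> in M. \<forall>x\<in>strip. rmap \<tau> f \<omega> x = shear (- k) x) \<longrightarrow>
     negative_monotone M \<tau> f \<and> regular_rmap M \<tau> f"
proof -
  have "\<exists>k0. \<forall>k\<ge>k0. positive_monotone M \<tau> (prof (\<lambda>\<omega> x. shear 0 (shear k x))) \<and>
      regular_rmap M \<tau> (prof (\<lambda>\<omega> x. shear 0 (shear k x))) \<and>
      (\<forall>\<omega>. \<forall>x\<in>strip. rmap \<tau> (prof (\<lambda>\<omega> x. shear 0 (shear k x))) \<omega> x = shear 0 (shear k x))"
    by (rule positive_monotone_shear[where g = "\<lambda>\<omega>. shear 0" and \<delta> = 1, OF UD_shear shear_jmeas shear_equivariant])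
      (auto simp: displ_bounded_def shear_area_preserving)
  then obtain k0 where k0: "\<And>k. k \<ge> k0 \<Longrightarrow> positive_monotone M \<tau> (prof (\<lambda>\<omega> x. shear k x))"
    "\<And>k \<omega> x. k \<ge> k0 \<Longrightarrow> x \<in> strip \<Longrightarrow> rmap \<tau> (prof (\<lambda>\<omega> x. shear k x)) \<omega> x = shear k x"
    by auto
  show ?thesis
  proof (intro exI[of _ k0] allI impI conjI)
    fix k f assume k: "k0 \<le> k" and f: "profile M f" "AE \<omega> in M. \<forall>x\<in>strip. rmap \<tau> f \<omega> x = shear (- k) x"
    show "regular_rmap M \<tau> f" by (rule regular_rmap_UD[OF UD_shear f(2)])
    have "AE \<omega> in M. \<forall>x\<in>strip. rmap \<tau> f \<omega> (rmap \<tau> (prof (\<lambda>\<omega> x. shear k x)) \<omega> x) = x \<and>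
        rmap \<tau> (prof (\<lambda>\<omega> x. shear k x)) \<omega> (rmap \<tau> f \<omega> x) = x"
      using f(2)
      by (rule AE_mp, intro AE_I2 impI ballI) (simp add: k0(2)[OF k] shear_shear)
    then show "negative_monotone M \<tau> f"
      unfolding negative_monotone_def using f(1) k0(1)[OF k] by blast
  qed
qed

section \<open>The isotopy along a single orbit\<close>

lemma snd_strip_cases:
  assumes "x \<in> strip"
  obtains "snd x = 1" | "snd x = -1" | "-1 < snd x" "snd x < 1"
  using assms by (cases x) (force simp: strip_iff)

text \<open>Invariance of domain: the open strip has an open image inside the closed strip, hence
  inside its interior.\<close>

lemma interior_invariant:
  fixes g :: "real \<times> real \<Rightarrow> real \<times> real"
  assumes c: "continuous_on strip g" and b: "bij_betw g strip strip"
    and x: "-1 < snd x" "snd x < 1"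
  shows "-1 < snd (g x)" "snd (g x) < 1"
proof -
  define U :: "(real \<times> real) set" where "U = UNIV \<times> {-1<..<1}"
  have U: "open U" "U \<subseteq> strip" "x \<in> U" unfolding U_def using x by (auto simp: open_Times strip_def mem_Times_iff)
  have "open (g ` U)"
    by (rule invariance_of_domain[OF continuous_on_subset[OF c U(2)] U(1)])
      (use b U(2) in \<open>auto simp: bij_betw_def intro: inj_on_subset\<close>)
  moreover have "g ` U \<subseteq> strip" using b U(2) by (auto simp: bij_betw_def)
  ultimately have "g ` U \<subseteq> interior strip" by (rule interior_maximal[rotated])
  also have "interior strip = UNIV \<times> {-1<..<1}" unfolding strip_def by (simp add: interior_Times)
  finally have "g x \<in> UNIV \<times> {-1<..<1}" using U(3) by blast
  then show "-1 < snd (g x)" "snd (g x) < 1" by (auto simp: mem_Times_iff)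
qed

text \<open>\<open>interior_invariant\<close> for the map and for its inverse. The two edges may
  still be interchanged at this stage.\<close>

lemma snd_boundary:
  fixes g :: "real \<times> real \<Rightarrow> real \<times> real"
  assumes d: "diffeo_strip g" and x: "x \<in> strip"
  shows "snd x = 1 \<or> snd x = -1 \<longleftrightarrow> snd (g x) = 1 \<or> snd (g x) = -1"
proof -
  have b: "bij_betw g strip strip" using d by (simp add: diffeo_strip_def)
  have c: "continuous_on strip h" if "C1_strip h" for h
    using that has_derivative_continuous_on unfolding C1_strip_def by meson
  note I = bij_inv_strip[OF b]
  have gx: "g x \<in> strip" using b x by (auto simp: bij_betw_def)
  have 1: "\<not> (snd (g x) = 1 \<or> snd (g x) = -1)" if "-1 < snd x" "snd x < 1"
    using interior_invariant[OF c b that] d by (auto simp: diffeo_strip_def)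
  have 2: "\<not> (snd x = 1 \<or> snd x = -1)" if "-1 < snd (g x)" "snd (g x) < 1"
    using interior_invariant[OF c bij_betw_inv_into[OF b] that] d I(3)[OF x] by (auto simp: diffeo_strip_def)
  show ?thesis
  proof (cases rule: snd_strip_cases[OF x])
    case 3
    then show ?thesis using 1 by auto
  next
    case 1
    then show ?thesis using 2 by (cases rule: snd_strip_cases[OF gx]) auto
  next
    case 2
    then show ?thesis using \<open>-1 < snd (g x) \<Longrightarrow> snd (g x) < 1 \<Longrightarrow> \<not> (snd x = 1 \<or> snd x = -1)\<close>
      by (cases rule: snd_strip_cases[OF gx]) auto
  qed
qed

lemma continuous_nonzero_pos:
  fixes h :: "real \<Rightarrow> real"
  assumes c: "continuous_on {0..1} h" and v: "\<And>t. t \<in> {0..1} \<Longrightarrow> h t \<noteq> 0" and 0: "h 0 > 0" and t: "t \<in> {0..1}"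
  shows "h t > 0"
proof (rule ccontr)
  assume "\<not> h t > 0"
  then have "\<exists>x\<ge>0. x \<le> t \<and> h x = 0"
    using 0 t continuous_on_subset[OF c, of "{0..t}"] by (intro IVT2') auto
  then show False using v t by fastforce
qed

text \<open>The conditions of \<open>C3_isotopy\<close> for a single index, stated as a predicate so
  that they can be transported along an orbit.\<close>

definition isotopy_core :: "real \<Rightarrow> real \<Rightarrow> real \<Rightarrow> (real \<Rightarrow> real \<times> real \<Rightarrow> real \<times> real) \<Rightarrow> bool" where
  "isotopy_core K L \<delta> \<Phi> \<longleftrightarrow>
     (\<exists>v. Cr_path (\<lambda>t x. \<Phi> t x - x) v K) \<and>
     (\<forall>t\<in>{0..1}. bij_betw (\<Phi> t) strip strip) \<and>
     (\<forall>t\<in>{0..1}. \<forall>x\<in>strip. (snd (\<Phi> t x) = 1 \<longleftrightarrow> snd x = 1) \<and> (snd (\<Phi> t x) = -1 \<longleftrightarrow> snd x = -1)) \<and>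
     (\<forall>t\<in>{0..1}. \<forall>x\<in>strip. \<forall>y\<in>strip. norm (x - y) \<le> L * norm (\<Phi> t x - \<Phi> t y)) \<and>
     (\<forall>t\<in>{0..1}. \<forall>x\<in>strip. \<delta> \<le> dens (\<Phi> t) x) \<and>
     (\<forall>x\<in>strip. \<Phi> 0 x = x)"

lemma Cr_bounded_shift: "Cr_bounded r K g \<Longrightarrow> Cr_bounded r K (\<lambda>x. g (x + (a, 0)))"
proof (induction r arbitrary: g)
  case 0
  have "continuous_on strip (\<lambda>x. g (x + (a, 0)))"
    by (rule continuous_on_compose2[OF Cr_bounded_continuous[OF 0]]) (auto intro!: continuous_intros simp: strip_iff)
  moreover have "\<forall>x\<in>strip. norm (g (x + (a, 0))) \<le> K"
    using Cr_bounded_norm[OF 0] shift_mem_strip by blast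
  ultimately show ?case unfolding Cr_bounded.simps(1) by blast
next
  case (Suc r)
  note D = Cr_bounded_Suc_D[OF Suc.prems]
  have "\<forall>x\<in>strip. norm (g (x + (a, 0))) \<le> K"
    using Cr_bounded_norm[OF Suc.prems] shift_mem_strip by blast
  moreover have "\<forall>x\<in>strip. ((\<lambda>x. g (x + (a, 0))) has_derivative
      (\<lambda>(u, v). u *\<^sub>R dq g (x + (a, 0)) + v *\<^sub>R dp g (x + (a, 0)))) (at x within strip)"
    using pdiff_shift[OF D(1)] by blast
  ultimately show ?case
    unfolding Cr_bounded.simps(2) using Suc.IH[OF D(2)] Suc.IH[OF D(3)]
    by (intro conjI exI[of _ "\<lambda>x. dq g (x + (a, 0))"] exI[of _ "\<lambda>x. dp g (x + (a, 0))"])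
qed

text \<open>Passing to another point of an orbit conjugates the maps by a translation in q. Hence
  one good point makes its whole orbit good, with the same constants.\<close>

lemma isotopy_core_translate:
  assumes \<Phi>: "isotopy_core K L \<delta> \<Phi>"
  shows "isotopy_core K L \<delta> (\<lambda>t x. \<Phi> t (x + (a, 0)) - (a, 0))"
proof -
  obtain v where v: "Cr_path (\<lambda>t x. \<Phi> t x - x) v K" using \<Phi> unfolding isotopy_core_def by blast
  have "Cr_path (\<lambda>t x. \<Phi> t (x + (a, 0)) - (a, 0) - x) (\<lambda>t x. v t (x + (a, 0))) K"
  proof
    have eq: "\<Phi> t (x + (a, 0)) - (a, 0) - x = \<Phi> t (x + (a, 0)) - (x + (a, 0))" for t x
      by (simp add: algebra_simps del: add_Pair)
    fix t :: real assume t: "t \<in> {0..1}"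
    show "Cr_bounded 3 K (\<lambda>x. \<Phi> t (x + (a, 0)) - (a, 0) - x)"
      unfolding eq by (rule Cr_bounded_shift[OF Cr_path.e_Cr[OF v t]])
    show "Cr_bounded 2 K (\<lambda>x. v t (x + (a, 0)))"
      by (rule Cr_bounded_shift[OF Cr_path.v_Cr[OF v t]])
    fix x assume "x \<in> strip"
    then have "x + (a, 0) \<in> strip" by simp
    from Cr_path.vel[OF v t this]
    show "((\<lambda>s. \<Phi> s (x + (a, 0)) - (a, 0) - x) has_vector_derivative v t (x + (a, 0))) (at t within {0..1})"
      unfolding eq .
  qed
  moreover have "bij_betw (\<lambda>x. \<Phi> t (x + (a, 0)) - (a, 0)) strip strip" if t: "t \<in> {0..1}" for t
  proof -
    have s: "bij_betw (\<lambda>x. x + (b, 0)) strip strip" for b :: real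
      by (rule bij_betw_byWitness[where f' = "\<lambda>x. x - (b, 0)"]) (auto simp: strip_iff)
    have "bij_betw (\<Phi> t) strip strip" using \<Phi> t unfolding isotopy_core_def by blast
    from bij_betw_trans[OF bij_betw_trans[OF s[of a] this] s[of "-a"]]
    show ?thesis by (rule bij_betw_cong[THEN iffD1, rotated]) (simp add: prod_eq_iff)
  qed
  moreover have "(snd (\<Phi> t (x + (a, 0)) - (a, 0)) = 1 \<longleftrightarrow> snd x = 1) \<and> (snd (\<Phi> t (x + (a, 0)) - (a, 0)) = -1 \<longleftrightarrow> snd x = -1)"
    if t: "t \<in> {0..1}" and x: "x \<in> strip" for t x
  proof -
    have "x + (a, 0) \<in> strip" using x by simp
    then have "(snd (\<Phi> t (x + (a, 0))) = 1 \<longleftrightarrow> snd (x + (a, 0)) = 1) \<and> (snd (\<Phi> t (x + (a, 0))) = -1 \<longleftrightarrow> snd (x + (a, 0)) = -1)"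
      using \<Phi> t unfolding isotopy_core_def by blast
    then show ?thesis by simp
  qed
  moreover have "norm (x - y) \<le> L * norm (\<Phi> t (x + (a, 0)) - (a, 0) - (\<Phi> t (y + (a, 0)) - (a, 0)))"
    if t: "t \<in> {0..1}" and x: "x \<in> strip" "y \<in> strip" for t x y
  proof -
    have "x + (a, 0) \<in> strip" "y + (a, 0) \<in> strip" using x by simp_all
    then have "norm (x + (a, 0) - (y + (a, 0))) \<le> L * norm (\<Phi> t (x + (a, 0)) - \<Phi> t (y + (a, 0)))"
      using \<Phi> t unfolding isotopy_core_def by blast
    then show ?thesis by (simp del: add_Pair)
  qed
  moreover have "\<delta> \<le> dens (\<lambda>x. \<Phi> t (x + (a, 0)) - (a, 0)) x" if t: "t \<in> {0..1}" and x: "x \<in> strip" for t x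
  proof -
    have "x + (a, 0) \<in> strip" using x by simp
    then have "\<delta> \<le> dens (\<Phi> t) (x + (a, 0))" using \<Phi> t unfolding isotopy_core_def by blast
    then show ?thesis using partials_translate(3)[of "\<lambda>x. \<Phi> t (x + (a, 0)) - (a, 0)" "\<Phi> t" a x] x by simp
  qed
  moreover have "\<Phi> 0 (x + (a, 0)) - (a, 0) = x" if x: "x \<in> strip" for x
  proof -
    have "x + (a, 0) \<in> strip" using x by simp
    then have "\<Phi> 0 (x + (a, 0)) = x + (a, 0)" using \<Phi> unfolding isotopy_core_def by blast
    then show ?thesis by simp
  qed
  ultimately show ?thesis unfolding isotopy_core_def by blast
qed

lemma Cr_bounded_0: "K \<ge> 0 \<Longrightarrow> Cr_bounded r K (\<lambda>x. 0)"
proof (induction r)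
  case (Suc r)
  have "((\<lambda>x. 0) has_derivative (\<lambda>(u, v). u *\<^sub>R 0 + v *\<^sub>R 0)) (at x within strip)" for x
    by (rule has_derivative_eq_rhs[OF has_derivative_const]) auto
  then show ?case using Suc unfolding Cr_bounded.simps(2) by (auto intro!: exI[of _ "\<lambda>_. 0"])
qed (simp add: Cr_bounded.simps)

text \<open>Serves on the exceptional orbits; the side conditions ensure that the constants of the
  good orbits fit here too.\<close>

lemma isotopy_core_id:
  assumes "K \<ge> 0" "L \<ge> 1" "\<delta> \<le> 1"
  shows "isotopy_core K L \<delta> (\<lambda>t x. x)"
proof -
  have "Cr_path (\<lambda>t x. x - x) (\<lambda>t x. 0) K"
    by standard (auto intro: Cr_bounded_0 assms)
  moreover have "dens (\<lambda>x. x) x = 1" if "x \<in> strip" for x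
    using dq_eq[OF has_derivative_ident that] dp_eq[OF has_derivative_ident that]
    by (simp add: dens_def Jac_def mdet_def)
  moreover have "norm (x - y) \<le> L * norm (x - y)" for x y :: "real \<times> real"
    using mult_right_mono[OF assms(2), of "norm (x - y)"] by simp
  ultimately show ?thesis
    unfolding isotopy_core_def using assms(3) by (auto simp: bij_betw_id[unfolded id_def])
qed

text \<open>The inverse is the identity plus a displacement with Lipschitz constant 2 K, whence 2 K
  + 1. Each entry of its Jacobian matrix is at most K + 1, so the matrix has norm at most 4 (K + 1)
  and determinant at most 2 (4 (K + 1))^2 = 32 (K + 1)^2 in absolute value; the reciprocal bounds
  the density from below.\<close>

lemma isotopy_coreI:
  fixes \<Phi> :: "real \<Rightarrow> real \<times> real \<Rightarrow> real \<times> real"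
  assumes K: "K \<ge> 0" and 0: "\<And>x. x \<in> strip \<Longrightarrow> \<Phi> 0 x = x"
    and d: "\<And>t. t \<in> {0..1} \<Longrightarrow> diffeo_strip (\<Phi> t)"
    and C: "\<And>t. t \<in> {0..1} \<Longrightarrow> Cr_bounded 3 K (\<lambda>x. \<Phi> t x - x)"
    and I: "\<And>t. t \<in> {0..1} \<Longrightarrow> Cr_bounded 3 K (\<lambda>x. inv_into strip (\<Phi> t) x - x)"
    and v: "\<And>t. t \<in> {0..1} \<Longrightarrow> \<exists>v. (\<forall>x\<in>strip. ((\<lambda>s. \<Phi> s x) has_vector_derivative v x) (at t within {0..1})) \<and> Cr_bounded 3 K v"
  shows "isotopy_core K (2 * K + 1) (1 / (32 * (K + 1) * (K + 1))) \<Phi>"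
proof -
  obtain V where V: "\<And>t x. t \<in> {0..1} \<Longrightarrow> x \<in> strip \<Longrightarrow> ((\<lambda>s. \<Phi> s x) has_vector_derivative V t x) (at t within {0..1})"
    "\<And>t. t \<in> {0..1} \<Longrightarrow> Cr_bounded 3 K (V t)"
    using v by metis
  interpret p: Cr_path "\<lambda>t x. \<Phi> t x - x" V K
  proof
    fix t :: real assume t: "t \<in> {0..1}"
    show "Cr_bounded 3 K (\<lambda>x. \<Phi> t x - x)" by (rule C[OF t])
    show "Cr_bounded 2 K (V t)" by (rule Cr_bounded_mono[OF _ V(2)[OF t]]) simp
    fix x assume x: "x \<in> strip"
    from has_vector_derivative_diff[OF V(1)[OF t x] has_vector_derivative_const]
    show "((\<lambda>s. \<Phi> s x - x) has_vector_derivative V t x) (at t within {0..1})" by simp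
  qed
  have bij: "bij_betw (\<Phi> t) strip strip" if "t \<in> {0..1}" for t using d[OF that] by (simp add: diffeo_strip_def)
  have ct: "continuous_on {0..1} (\<lambda>t. \<Phi> t x)" if "x \<in> strip" for x
    using V(1)[OF _ that] by (intro continuous_on_vector_derivative) auto
  \<comment> \<open>Excludes an interchange of the edges: r times the height is continuous in time,
    never 0 since the image stays on an edge, and positive at time 0.\<close>
  have snd_const: "snd (\<Phi> t x) = r" if t: "t \<in> {0..1}" and x: "x \<in> strip" and r: "snd x = r" "r = 1 \<or> r = -1" for t x r
  proof -
    have "0 < r * snd (\<Phi> t x)"
    proof (rule continuous_nonzero_pos[OF _ _ _ t])
      show "continuous_on {0..1} (\<lambda>t. r * snd (\<Phi> t x))" by (intro continuous_intros ct x)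
      show "r * snd (\<Phi> s x) \<noteq> 0" if "s \<in> {0..1}" for s
        using snd_boundary[OF d[OF that] x] r by auto
      show "0 < r * snd (\<Phi> 0 x)" using 0[OF x] r by auto
    qed
    then show ?thesis using snd_boundary[OF d[OF t] x] r by auto
  qed
  have bdry: "(snd (\<Phi> t x) = 1 \<longleftrightarrow> snd x = 1) \<and> (snd (\<Phi> t x) = -1 \<longleftrightarrow> snd x = -1)"
    if t: "t \<in> {0..1}" and x: "x \<in> strip" for t x
    using snd_boundary[OF d[OF t] x] snd_const[OF t x] by (cases "snd x = 1"; cases "snd x = -1") auto
  have inv_lip: "norm (x - y) \<le> (2 * K + 1) * norm (\<Phi> t x - \<Phi> t y)"
    if t: "t \<in> {0..1}" and x: "x \<in> strip" and y: "y \<in> strip" for t x y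
  proof -
    let ?i = "\<lambda>x. inv_into strip (\<Phi> t) x - x"
    note D = Cr_bounded_Suc_D[OF I[OF t, unfolded numeral_3_eq_3]]
    have m: "\<Phi> t x \<in> strip" "\<Phi> t y \<in> strip" using bij[OF t] x y by (auto simp: bij_betw_def)
    have "norm (?i (\<Phi> t x) - ?i (\<Phi> t y)) \<le> 2 * K * norm (\<Phi> t x - \<Phi> t y)"
      by (rule pdiff_lipschitz[OF D(1) Cr_bounded_norm[OF D(2)] Cr_bounded_norm[OF D(3)] m])
    then have "norm ((x - y) - (\<Phi> t x - \<Phi> t y)) \<le> 2 * K * norm (\<Phi> t x - \<Phi> t y)"
      by (simp add: bij_inv_strip(3)[OF bij[OF t]] x y algebra_simps)
    then show ?thesis
      using norm_triangle_ineq[of "(x - y) - (\<Phi> t x - \<Phi> t y)" "\<Phi> t x - \<Phi> t y"] by (simp add: algebra_simps)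
  qed
  define D where "D = 32 * (K + 1) * (K + 1)"
  have D: "D > 0" using K by (simp add: D_def)
  have det: "1 / D \<le> \<bar>dens (\<Phi> t) x\<bar>" if t: "t \<in> {0..1}" and x: "x \<in> strip" for t x
  proof -
    let ?g = "inv_into strip (\<Phi> t)"
    have m: "\<Phi> t x \<in> strip" using bij[OF t] x by (auto simp: bij_betw_def)
    note E = Cr_bounded_Suc_D[OF I[OF t, unfolded numeral_3_eq_3]]
    note J = displacement_partials[OF E(1) m]
    have c: "((\<lambda>y. ?g (\<Phi> t y)) has_derivative (\<lambda>h. mapp (Jac ?g (\<Phi> t x)) (mapp (Jac (\<Phi> t) x) h))) (at x within strip)"
      by (rule has_derivative_in_compose2[OF displacement_partials(3)[OF E(1)] _ x displacement_partials(3)[OF p.e_D(1)[OF t] x]])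
        (use bij[OF t] in \<open>auto simp: bij_betw_def\<close>)
    have inv: "y = ?g (\<Phi> t y)" if "y \<in> strip" for y
      using bij_inv_strip(3)[OF bij[OF t] that] by simp
    have "((\<lambda>y. y) has_derivative (\<lambda>h. mapp (mmul (Jac ?g (\<Phi> t x)) (Jac (\<Phi> t) x)) h)) (at x within strip)"
      unfolding mapp_mmul by (rule has_derivative_transform[OF x inv c])
    from dq_eq[OF this x] dp_eq[OF this x] dq_eq[OF has_derivative_ident x] dp_eq[OF has_derivative_ident x]
    have 1: "mapp (mmul (Jac ?g (\<Phi> t x)) (Jac (\<Phi> t) x)) (1, 0) = (1, 0)"
      "mapp (mmul (Jac ?g (\<Phi> t x)) (Jac (\<Phi> t) x)) (0, 1) = (0, 1)" by simp_all
    have "mdet M = 1" if "mapp M (1, 0) = (1, 0)" "mapp M (0, 1) = (0, 1)" for M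
      using that by (cases M) (simp add: mapp_def mdet_def)
    from this[OF 1] have prod: "mdet (Jac ?g (\<Phi> t x)) * dens (\<Phi> t) x = 1" by (simp add: mdet_mmul dens_def)
    have n: "norm (Jac ?g (\<Phi> t x)) \<le> 4 * (K + 1)"
    proof -
      have q: "norm (dq ?g (\<Phi> t x)) \<le> K + 1" "norm (dp ?g (\<Phi> t x)) \<le> K + 1"
        unfolding J using Cr_bounded_norm[OF E(2) m] Cr_bounded_norm[OF E(3) m]
        by (auto intro!: order_trans[OF norm_triangle_ineq] simp: norm_Pair)
      have "norm (Jac ?g (\<Phi> t x)) \<le> (K + 1) + (K + 1) + (K + 1) + (K + 1)"
        unfolding Jac_def
        by (rule order_trans[OF mat2_norm(5)]) (intro add_mono order_trans[OF fst_snd_norm(1)] order_trans[OF fst_snd_norm(2)] q)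
      then show ?thesis by simp
    qed
    have "\<bar>mdet (Jac ?g (\<Phi> t x))\<bar> \<le> 2 * norm (Jac ?g (\<Phi> t x)) * norm (Jac ?g (\<Phi> t x))" by (rule abs_mdet_le)
    also have "\<dots> \<le> 2 * (4 * (K + 1)) * (4 * (K + 1))" using n K by (intro mult_mono) auto
    also have "\<dots> = D" by (simp add: D_def algebra_simps)
    finally have le: "\<bar>mdet (Jac ?g (\<Phi> t x))\<bar> \<le> D" .
    have "1 = \<bar>mdet (Jac ?g (\<Phi> t x))\<bar> * \<bar>dens (\<Phi> t) x\<bar>" using prod by (simp add: abs_mult[symmetric])
    also have "\<dots> \<le> D * \<bar>dens (\<Phi> t) x\<bar>" using le by (intro mult_right_mono) auto
    finally show ?thesis using D by (simp add: pos_divide_le_eq mult.commute)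
  qed
  \<comment> \<open>The bound on the inverse controls only the absolute value. The sign follows from
    continuity in time, available through \<open>time_lip_d1\<close>, and the value 1 at time
    0.\<close>
  have "dens (\<Phi> t) x > 0" if t: "t \<in> {0..1}" and x: "x \<in> strip" for t x
  proof (rule continuous_nonzero_pos[OF _ _ _ t])
    have lc: "continuous_on {0..1} h" if "\<And>s t. s \<in> {0..1} \<Longrightarrow> t \<in> {0..1} \<Longrightarrow> norm (h s - h t) \<le> 2 * K * \<bar>s - t\<bar>"
      for h :: "real \<Rightarrow> real \<times> real"
      using K that by (intro lipschitz_on_continuous_on[of "2 * K"] lipschitz_onI) (auto simp: dist_norm)
    let ?e = "\<lambda>t x. \<Phi> t x - x"
    have 1: "continuous_on {0..1} (\<lambda>t. dq (?e t) x)" "continuous_on {0..1} (\<lambda>t. dp (?e t) x)"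
      by (rule lc, rule p.time_lip_d1[OF _ _ x]; assumption)+
    have "continuous_on {0..1} (\<lambda>t. (1 + fst (dq (?e t) x)) * (1 + snd (dp (?e t) x)) - fst (dp (?e t) x) * snd (dq (?e t) x))"
      by (intro continuous_intros 1)
    then show "continuous_on {0..1} (\<lambda>t. dens (\<Phi> t) x)"
      by (rule continuous_on_eq) (simp add: dens_displacement[OF p.e_D(1) x])
    show "dens (\<Phi> s) x \<noteq> 0" if "s \<in> {0..1}" for s using det[OF that x] D by auto
    have "(\<Phi> 0 has_derivative (\<lambda>h. h)) (at x within strip)"
      by (rule has_derivative_transform[OF x 0 has_derivative_ident])
    from dq_eq[OF this x] dp_eq[OF this x] show "dens (\<Phi> 0) x > 0"
      by (simp add: dens_def Jac_def mdet_def)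
  qed
  then have det': "1 / D \<le> dens (\<Phi> t) x" if "t \<in> {0..1}" "x \<in> strip" for t x
    using det[OF that] that by fastforce
  show ?thesis
    unfolding isotopy_core_def D_def[symmetric]
    using p.Cr_path_axioms bij bdry inv_lip det' 0 by blast
qed

section \<open>Measurability of the flow\<close>

text \<open>A countable base of the real factor suffices: for each rational interval, the union of
  all open sets V whose product with the interval lies in the open preimage is again open, so
  countably many rectangles exhaust it.\<close>

lemma continuous_measurable_pair:
  fixes f :: "real \<times> 'a::topological_space \<Rightarrow> 'b::topological_space"
  assumes f: "continuous_on UNIV f" and N: "sets N = sets borel"
  shows "f \<in> (borel :: real measure) \<Otimes>\<^sub>M N \<rightarrow>\<^sub>M borel"
proof (rule borel_measurableI)
  fix S :: "'b set" assume "open S"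
  then have O: "open (f -` S)" using f by (simp add: continuous_on_open_vimage)
  have spN: "space N = UNIV" using sets_eq_imp_space_eq[OF N] by simp
  define W where "W r s = \<Union>{V. open V \<and> {of_rat r<..<of_rat s :: real} \<times> V \<subseteq> f -` S}" for r s :: rat
  have W: "open (W r s)" for r s unfolding W_def by auto
  have "f -` S = (\<Union>rs. {of_rat (fst rs)<..<of_rat (snd rs) :: real} \<times> W (fst rs) (snd rs))"
  proof (intro equalityI subsetI)
    fix z assume "z \<in> f -` S"
    then obtain A B where AB: "open A" "open B" "z \<in> A \<times> B" "A \<times> B \<subseteq> f -` S"
      by (rule open_prod_elim[OF O])
    have "fst z \<in> A" using AB(3) by (simp add: mem_Times_iff)
    then obtain e where e: "e > 0" "ball (fst z) e \<subseteq> A" by (rule openE[OF AB(1)])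
    obtain r where r: "fst z - e < of_rat r" "of_rat r < fst z" using of_rat_dense[of "fst z - e" "fst z"] e by auto
    obtain s where s: "fst z < of_rat s" "of_rat s < fst z + e" using of_rat_dense[of "fst z" "fst z + e"] e by auto
    have "{of_rat r<..<of_rat s} \<subseteq> ball (fst z) e" using r s by (auto simp: dist_real_def)
    then have "{of_rat r<..<of_rat s} \<times> B \<subseteq> A \<times> B" using e(2) by (intro Sigma_mono) auto
    then have "{of_rat r<..<of_rat s} \<times> B \<subseteq> f -` S" using AB(4) by (rule order_trans)
    moreover have "snd z \<in> B" using AB(3) by (simp add: mem_Times_iff)
    ultimately have "snd z \<in> W r s" unfolding W_def using AB(2) by blast
    then have "z \<in> {of_rat (fst (r, s))<..<of_rat (snd (r, s))} \<times> W (fst (r, s)) (snd (r, s))"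
      using r s by (simp add: mem_Times_iff)
    then show "z \<in> (\<Union>rs. {of_rat (fst rs)<..<of_rat (snd rs) :: real} \<times> W (fst rs) (snd rs))" by blast
  next
    fix z assume "z \<in> (\<Union>rs. {of_rat (fst rs)<..<of_rat (snd rs) :: real} \<times> W (fst rs) (snd rs))"
    then show "z \<in> f -` S" unfolding W_def by (auto simp: mem_Times_iff)
  qed
  moreover have "{of_rat (fst rs)<..<of_rat (snd rs) :: real} \<times> W (fst rs) (snd rs) \<in> sets (borel \<Otimes>\<^sub>M N)" for rs
    by (intro pair_measureI) (auto simp: N W)
  then have "(\<Union>rs. {of_rat (fst rs)<..<of_rat (snd rs) :: real} \<times> W (fst rs) (snd rs)) \<in> sets (borel \<Otimes>\<^sub>M N)"
    by (intro sets.countable_UN image_subsetI)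
  ultimately show "f -` S \<inter> space (borel \<Otimes>\<^sub>M N) \<in> sets (borel \<Otimes>\<^sub>M N)"
    by (simp add: space_pair_measure spN)
qed

context ergodic_flow begin

lemma space_M: "space M = UNIV"
  using sets_eq_imp_space_eq[OF sets_M] by simp

lemma flow_measurable: "(\<lambda>z. \<tau> (fst z) (snd z)) \<in> borel \<Otimes>\<^sub>M M \<rightarrow>\<^sub>M M"
  using continuous_measurable_pair[OF flow_continuous sets_M]
  by (simp add: case_prod_beta' measurable_cong_sets[OF refl sets_M])

lemma flow_inverse: "\<tau> (- a) (\<tau> a \<omega>) = \<omega>" "\<tau> a (\<tau> (- a) \<omega>) = \<omega>"
  using flow_add[of "- a" a \<omega>] flow_add[of a "- a" \<omega>] flow_0 by auto

lemma flow_measurable_at: "\<tau> a \<in> M \<rightarrow>\<^sub>M M"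
  using measurable_compose[OF measurable_Pair1'[of a borel M] flow_measurable] by simp

lemma emeasure_flow_vimage:
  assumes A: "A \<in> sets M"
  shows "emeasure M (\<tau> a -` A) = emeasure M A"
proof -
  have "\<tau> a -` A = \<tau> (- a) ` A"
    by (auto simp: flow_inverse image_iff) (metis flow_inverse(1))
  then show ?thesis using invariant[OF A, of "- a"] by (simp add: emeasure_eq_measure)
qed

text \<open>\<open>G\<close> consists of the \<omega> whose orbit spends Lebesgue-null time in
  \<open>N\<close>. Fubini and invariance of the measure give it full measure, translation
  invariance of Lebesgue measure makes it flow-invariant, and an orbit that never left
  \<open>N\<close> would spend infinite time there.\<close>

lemma invariant_good_set:
  assumes N: "N \<in> null_sets M"
  shows "\<exists>G\<in>sets M. (AE \<omega> in M. \<omega> \<in> G) \<and> (\<forall>a \<omega>. \<tau> a \<omega> \<in> G \<longleftrightarrow> \<omega> \<in> G) \<and> (\<forall>\<omega>\<in>G. \<exists>a. \<tau> a \<omega> \<notin> N)"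
proof -
  have Nm [measurable]: "N \<in> sets M" using N by auto
  define I where "I \<omega> = (\<integral>\<^sup>+ q. indicator N (\<tau> q \<omega>) \<partial>lborel)" for \<omega>
  interpret pair_sigma_finite lborel M ..
  have meas: "(\<lambda>z. indicator N (\<tau> (fst z) (snd z)) :: ennreal) \<in> borel_measurable (lborel \<Otimes>\<^sub>M M)"
    using measurable_compose[OF flow_measurable borel_measurable_indicator[OF Nm]] by (simp cong: measurable_cong_sets)
  then have meas': "(\<lambda>z. indicator N (\<tau> (snd z) (fst z)) :: ennreal) \<in> borel_measurable (M \<Otimes>\<^sub>M lborel)"
    using measurable_compose[OF measurable_pair_swap' meas] by (simp add: case_prod_beta)
  have I [measurable]: "I \<in> borel_measurable M"
    unfolding I_def using lborel.borel_measurable_nn_integral[of "\<lambda>\<omega> q. indicator N (\<tau> q \<omega>)" M] meas'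
    by (simp add: case_prod_beta')
  define G where "G = {\<omega> \<in> space M. I \<omega> = 0}"
  have "G \<in> sets M" unfolding G_def by measurable
  moreover have "AE \<omega> in M. \<omega> \<in> G"
  proof -
    have "(\<integral>\<^sup>+ \<omega>. I \<omega> \<partial>M) = (\<integral>\<^sup>+ q. (\<integral>\<^sup>+ \<omega>. indicator N (\<tau> q \<omega>) \<partial>M) \<partial>lborel)"
      unfolding I_def using Fubini[of "\<lambda>z. indicator N (\<tau> (fst z) (snd z))"] meas by simp
    also have "\<dots> = (\<integral>\<^sup>+ q. 0 \<partial>(lborel :: real measure))"
    proof (rule nn_integral_cong)
      fix q :: real
      have "(\<integral>\<^sup>+ \<omega>. indicator N (\<tau> q \<omega>) \<partial>M) = (\<integral>\<^sup>+ \<omega>. indicator (\<tau> q -` N) \<omega> \<partial>M)"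
        by (simp add: indicator_def)
      also have "\<dots> = emeasure M (\<tau> q -` N)"
        using measurable_sets[OF flow_measurable_at Nm, of q] by (simp add: space_M)
      also have "\<dots> = 0" using emeasure_flow_vimage[OF Nm] N by auto
      finally show "(\<integral>\<^sup>+ \<omega>. indicator N (\<tau> q \<omega>) \<partial>M) = 0" .
    qed
    finally have "AE \<omega> in M. I \<omega> = 0" by (simp add: nn_integral_0_iff_AE)
    then show ?thesis unfolding G_def by (auto simp: space_M)
  qed
  moreover have "\<tau> a \<omega> \<in> G \<longleftrightarrow> \<omega> \<in> G" for a \<omega>
  proof -
    have m: "(\<lambda>q. indicator N (\<tau> q \<omega>) :: ennreal) \<in> borel_measurable borel"
      using measurable_compose[OF measurable_Pair2'[of \<omega> M borel] measurable_compose[OF flow_measurable borel_measurable_indicator[OF Nm]]]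
      by (simp add: space_M)
    have "I (\<tau> a \<omega>) = (\<integral>\<^sup>+ q. indicator N (\<tau> (a + q) \<omega>) \<partial>lborel)"
      unfolding I_def by (simp add: flow_add add.commute)
    also have "\<dots> = (\<integral>\<^sup>+ q. indicator N (\<tau> q \<omega>) \<partial>distr lborel borel ((+) a))"
      using m by (subst nn_integral_distr) auto
    also have "\<dots> = I \<omega>" unfolding I_def lborel_distr_plus ..
    finally show ?thesis by (simp add: G_def space_M)
  qed
  moreover have "\<exists>a. \<tau> a \<omega> \<notin> N" if "\<omega> \<in> G" for \<omega>
  proof (rule ccontr)
    assume "\<not> (\<exists>a. \<tau> a \<omega> \<notin> N)"
    then have "I \<omega> = \<infinity>" unfolding I_def by (simp add: indicator_def)
    then show False using that by (simp add: G_def)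
  qed
  ultimately show ?thesis by blast
qed

lemma rmap_measurable:
  assumes "profile M f"
  shows "(\<lambda>z. rmap \<tau> f (fst z) (snd z)) \<in> M \<Otimes>\<^sub>M strip_borel \<rightarrow>\<^sub>M strip_borel"
proof -
  let ?N = "M \<Otimes>\<^sub>M strip_borel"
  note [measurable] = borel_measurable_fst_snd[OF snd_borel[of M]]
  have sp: "snd z \<in> strip" if "z \<in> space ?N" for z
    using that by (auto simp: space_pair_measure space_strip_borel)
  have "(\<lambda>z. \<tau> (fst (snd z)) (fst z)) \<in> ?N \<rightarrow>\<^sub>M M"
    using measurable_compose[OF measurable_Pair[OF borel_measurable_fst_snd(1)[OF snd_borel[of M]] measurable_fst[of M strip_borel]] flow_measurable]
    by simp
  moreover have "(\<lambda>z. snd (snd z)) \<in> ?N \<rightarrow>\<^sub>M restrict_space borel {-1..1}"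
  proof (rule measurable_restrict_space2)
    show "(\<lambda>z. snd (snd z)) \<in> space ?N \<rightarrow> {-1..1}"
    proof
      fix z assume "z \<in> space ?N"
      then show "snd (snd z) \<in> {-1..1}" using sp[of z] by (cases z; cases "snd z") (auto simp: strip_iff)
    qed
  qed measurable
  ultimately have "(\<lambda>z. (\<tau> (fst (snd z)) (fst z), snd (snd z))) \<in> ?N \<rightarrow>\<^sub>M M \<Otimes>\<^sub>M restrict_space borel {-1..1}"
    by (rule measurable_Pair)
  from measurable_compose[OF this assms[unfolded profile_def]]
  have f: "(\<lambda>z. f (\<tau> (fst (snd z)) (fst z), snd (snd z))) \<in> ?N \<rightarrow>\<^sub>M strip_borel" by simp
  then have "(\<lambda>z. f (\<tau> (fst (snd z)) (fst z), snd (snd z))) \<in> borel_measurable ?N"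
    and fs: "\<And>z. z \<in> space ?N \<Longrightarrow> f (\<tau> (fst (snd z)) (fst z), snd (snd z)) \<in> strip"
    by (simp_all add: measurable_strip_borel_iff)
  note [measurable] = borel_measurable_fst_snd[OF this(1)]
  have "(\<lambda>z. rmap \<tau> f (fst z) (snd z)) \<in> borel_measurable ?N"
    unfolding rmap_def case_prod_beta by measurable
  moreover have "rmap \<tau> f (fst z) (snd z) \<in> strip" if "z \<in> space ?N" for z
    using fs[OF that] by (auto simp: rmap_def case_prod_beta strip_def mem_Times_iff)
  ultimately show ?thesis by (simp add: measurable_strip_borel_iff)
qed

lemma rmap_translate: "rmap \<tau> f (\<tau> a \<omega>) x = rmap \<tau> f \<omega> (x + (a, 0)) - (a, 0)"
  by (cases x) (simp add: rmap_def flow_add[symmetric] add.commute)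

lemma jmeas_restrict:
  assumes G: "G \<in> sets M" and f: "profile M f"
  shows "jmeas M (\<lambda>\<omega>. if \<omega> \<in> G then rmap \<tau> f \<omega> else (\<lambda>x. x))"
proof -
  have "(\<lambda>z. if fst z \<in> G then rmap \<tau> f (fst z) (snd z) else snd z) \<in> M \<Otimes>\<^sub>M strip_borel \<rightarrow>\<^sub>M strip_borel"
    by (rule measurable_If[OF rmap_measurable[OF f] measurable_snd])
      (use G in \<open>auto intro!: measurable_sets_Collect[OF measurable_fst] simp: space_M\<close>)
  then show ?thesis unfolding jmeas_def by (rule measurable_cong[THEN iffD1, rotated]) simp
qed

end

section \<open>The factorisation\<close>

text \<open>The input of \<open>positive_monotone_shear\<close> with its constants hidden, so that
  finitely many factors can be treated alike.\<close>

definition (in ergodic_flow) twist_factor :: "('w \<Rightarrow> real \<times> real \<Rightarrow> real \<times> real) \<Rightarrow> bool" where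
  "twist_factor g \<longleftrightarrow> (\<exists>J \<delta>. UD g J \<and> jmeas M g \<and> equivariant \<tau> g \<and> displ_bounded g \<and>
     \<delta> > 0 \<and> (\<forall>\<omega>. \<forall>x\<in>strip. \<delta> \<le> fst (J \<omega> x)) \<and> (AE \<omega> in M. area_preserving (g \<omega>)))"

lemma (in ergodic_flow) isotopy_twist_factors:
  assumes C3: "C3_isotopy F v K L \<delta>"
    and jm: "\<And>t. t \<in> {0..1} \<Longrightarrow> jmeas M (\<lambda>\<omega>. F \<omega> t)"
    and eq: "\<And>t. t \<in> {0..1} \<Longrightarrow> equivariant \<tau> (\<lambda>\<omega>. F \<omega> t)"
    and ap: "AE \<omega> in M. area_preserving (F \<omega> 1)"
  shows "\<exists>n \<psi>. (\<forall>j\<le>n. twist_factor (\<psi> j)) \<and>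
     (\<forall>\<omega>. \<forall>x\<in>strip. F \<omega> 1 x = fold (\<lambda>j. \<psi> j \<omega>) [0..<Suc n] x)"
proof -
  interpret C3_isotopy F v K L \<delta> by (rule C3)
  have T_jm: "jmeas M (\<lambda>\<omega>. T \<omega> t)" if t: "t \<in> {0..1}" for t
  proof (rule jmeas_rearr[OF jm[OF t]])
    show "continuous_on strip (dens (F \<omega> t))" for \<omega> by (rule BL_continuous[OF BL_dens t])
    have "continuous_on strip (\<lambda>x. fst (e \<omega> t x) * (1 + snd (dp (e \<omega> t) x)))" for \<omega>
      by (rule BL_continuous[OF BL_mult[OF BL_e(1) BL_add[OF BL_const BL_e(6)]] t])
    then show "continuous_on strip (\<lambda>x. fst (F \<omega> t x - x) * snd (dp (F \<omega> t) x))" for \<omega>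
      by (rule continuous_on_eq) (simp add: F_partials[OF t] e_def add.commute)
    show "T \<omega> t x \<in> strip" if "x \<in> strip" for \<omega> x using UD_D(6)[OF UD_T_at[OF t] that] .
  qed
  have T_eq: "equivariant \<tau> (\<lambda>\<omega>. T \<omega> t)" if t: "t \<in> {0..1}" for t
    by (rule equivariant_rearr[OF eq[OF t]])
  have A_jm: "jmeas M (\<lambda>\<omega>. A \<omega> t)" if t: "t \<in> {0..1}" for t
    unfolding A_def[abs_def]
    by (rule jmeas_comp[OF jm[OF t] jmeas_inv[OF T_jm[OF t] T_bij[OF t] UD_continuous[OF UD_T_at[OF t]]]])
  have A_eq: "equivariant \<tau> (\<lambda>\<omega>. A \<omega> t)" if t: "t \<in> {0..1}" for t
    unfolding A_def[abs_def]
    by (rule equivariant_comp[OF eq[OF t] equivariant_inv[OF T_eq[OF t] T_bij[OF t]] bij_inv_strip(1)[OF T_bij[OF t]]])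
  have A_bij: "bij_betw (A \<omega> t) strip strip" if t: "t \<in> {0..1}" for \<omega> t
    using UD_D(1)[OF UD_A[OF t]] .
  have S_jm: "jmeas M (\<lambda>\<omega>. step \<omega> s t)" if s: "s \<in> {0..1}" and t: "t \<in> {0..1}" for s t
    unfolding step_def[abs_def]
    by (rule jmeas_comp[OF A_jm[OF s] jmeas_inv[OF A_jm[OF t] A_bij[OF t] UD_continuous[OF UD_A[OF t]]]])
  have S_eq: "equivariant \<tau> (\<lambda>\<omega>. step \<omega> s t)" if s: "s \<in> {0..1}" and t: "t \<in> {0..1}" for s t
    unfolding step_def[abs_def]
    by (rule equivariant_comp[OF A_eq[OF s] equivariant_inv[OF A_eq[OF t] A_bij[OF t]] bij_inv_strip(1)[OF A_bij[OF t]]])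
  obtain C where C: "\<forall>\<omega>. \<forall>s\<in>{0..1}. \<forall>t\<in>{0..1}. \<forall>y\<in>strip. 1 - C * \<bar>s - t\<bar> \<le> fst (Jstep \<omega> s t y)"
    using Jstep_bound by blast
  \<comment> \<open>Makes C / n at most 1/2, so each increment has upper left entry at least 1/2;
    the summand 1 ensures n > 0.\<close>
  obtain n :: nat where n: "2 * \<bar>C\<bar> + 1 < real n" using reals_Archimedean2 by blast
  then have n0: "real n > 0" by linarith
  \<comment> \<open>Index 0 is the triangular map at time 1, applied first; index j > 0 is the
    increment from time (j - 1) / n to j / n. The truncated subtraction matters only at j = 0, which
    is caught by the case distinction.\<close>
  define \<psi> where "\<psi> j = (\<lambda>\<omega>. if j = 0 then T \<omega> 1 else step \<omega> (real j / real n) (real (j - 1) / real n))" for j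
  have one: "1 \<in> {0..1::real}" and zero: "0 \<in> {0..1::real}" by auto
  have "twist_factor (\<psi> j)" if j: "j \<le> n" for j
  proof (cases "j = 0")
    case True
    have "AE \<omega> in M. area_preserving (T \<omega> 1)"
      using ap by (rule AE_mp) (intro AE_I2 impI T_area_preserving)
    then show ?thesis
      unfolding twist_factor_def \<psi>_def using True UD_T_at[OF one] T_jm[OF one] T_eq[OF one] displ_T[OF one] \<delta>_pos JT_11[OF one]
      by (intro exI[of _ "\<lambda>\<omega>. JT \<omega> 1"] exI[of _ \<delta>]) simp
  next
    case False
    define s t where "s = real j / real n" and "t = real (j - 1) / real n"
    have st: "s \<in> {0..1}" "t \<in> {0..1}" using j n0 by (auto simp: s_def t_def)
    have "s - t = 1 / real n" using False by (simp add: s_def t_def of_nat_diff diff_divide_distrib[symmetric])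
    then have "C * \<bar>s - t\<bar> = C / real n" by simp
    also have "\<dots> \<le> 1 / 2" using n n0 by (simp add: pos_divide_le_eq)
    finally have Cst: "C * \<bar>s - t\<bar> \<le> 1 / 2" .
    have "1 / 2 \<le> fst (Jstep \<omega> s t y)" if "y \<in> strip" for \<omega> y
    proof -
      have "1 - C * \<bar>s - t\<bar> \<le> fst (Jstep \<omega> s t y)" using C st that by blast
      then show ?thesis using Cst by linarith
    qed
    moreover have "\<psi> j = (\<lambda>\<omega>. step \<omega> s t)" using False by (simp add: \<psi>_def s_def t_def)
    ultimately show ?thesis
      unfolding twist_factor_def
      using UD_step[OF st] S_jm[OF st] S_eq[OF st] displ_step[OF st] step_area_preserving[OF st]
      by (intro exI[of _ "\<lambda>\<omega>. Jstep \<omega> s t"] exI[of _ "1 / 2 :: real"]) simp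
  qed
  moreover have "F \<omega> 1 x = fold (\<lambda>j. \<psi> j \<omega>) [0..<Suc n] x" if x: "x \<in> strip" for \<omega> x
  proof -
    have Tx: "T \<omega> 1 x \<in> strip" using UD_D(6)[OF UD_T_at[OF one] x] .
    \<comment> \<open>Telescoping: each increment cancels the inverse of the previous value of the
      path.\<close>
    have "fold (\<lambda>j. \<psi> j \<omega>) [0..<Suc m] x = A \<omega> (real m / real n) (T \<omega> 1 x)" if "m \<le> n" for m
      using that
    proof (induction m)
      case 0
      then show ?case by (simp add: \<psi>_def A_0[OF Tx])
    next
      case (Suc m)
      have t: "real m / real n \<in> {0..1}" using Suc.prems n0 by auto
      have "fold (\<lambda>j. \<psi> j \<omega>) [0..<Suc (Suc m)] x = \<psi> (Suc m) \<omega> (A \<omega> (real m / real n) (T \<omega> 1 x))"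
        using Suc by simp
      then show ?case
        using bij_inv_strip(3)[OF A_bij[OF t] Tx, of \<omega>] by (simp add: \<psi>_def step_def del: upt_Suc)
    qed
    from this[of n] show ?thesis using F_eq_A_T[OF one x] n0 by simp
  qed
  ultimately show ?thesis by blast
qed

text \<open>Each even factor undoes the shear contained in the odd factor after it. Factor 0 is
  stated separately, with its own start \<open>x\<close> and target \<open>y\<close>, since it may
  also have to apply the given map.\<close>

lemma fold_interleave:
  assumes neg: "\<And>j y. 0 < j \<Longrightarrow> j \<le> n \<Longrightarrow> y \<in> strip \<Longrightarrow> R (2 * j) y = shear (- k) y"
    and neg0: "R 0 x = shear (- k) y"
    and pos: "\<And>j y. j \<le> n \<Longrightarrow> y \<in> strip \<Longrightarrow> R (2 * j + 1) y = \<psi> j (shear k y)"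
    and \<psi>: "\<And>j y. j \<le> n \<Longrightarrow> y \<in> strip \<Longrightarrow> \<psi> j y \<in> strip" and y: "y \<in> strip"
  shows "fold R [0..<Suc (2 * n + 1)] x = fold \<psi> [0..<Suc n] y"
proof -
  have "fold R [0..<Suc (2 * m + 1)] x = fold \<psi> [0..<Suc m] y \<and> fold \<psi> [0..<Suc m] y \<in> strip"
    if "m \<le> n" for m
    using that
  proof (induction m)
    case 0
    then show ?case using neg0 pos[of 0 "shear (- k) y"] \<psi>[of 0 y] y by (simp add: shear_shear)
  next
    case (Suc m)
    let ?z = "fold \<psi> [0..<Suc m] y"
    have z: "fold R [0..<Suc (2 * m + 1)] x = ?z" "?z \<in> strip" using Suc by auto
    have "fold R [0..<Suc (2 * Suc m + 1)] x = R (2 * Suc m + 1) (R (2 * Suc m) (fold R [0..<Suc (2 * m + 1)] x))"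
      by simp
    also have "\<dots> = R (2 * Suc m + 1) (shear (- k) ?z)"
      unfolding z(1) using neg[of "Suc m" ?z] z(2) Suc.prems by simp
    also have "\<dots> = \<psi> (Suc m) ?z"
      using pos[of "Suc m" "shear (- k) ?z"] z(2) Suc.prems by (simp add: shear_shear)
    also have "\<dots> = fold \<psi> [0..<Suc (Suc m)] y" by simp
    finally show ?case using \<psi>[of "Suc m" ?z] z(2) Suc.prems by simp
  qed
  then show ?thesis by blast
qed

lemma uniform_threshold:
  fixes P :: "nat \<Rightarrow> real \<Rightarrow> bool"
  assumes "\<And>j. j \<le> n \<Longrightarrow> \<exists>k0. \<forall>k\<ge>k0. P j k"
  shows "\<exists>k0. \<forall>k\<ge>k0. \<forall>j\<le>n. P j k"
proof -
  have "\<forall>\<^sub>F k in at_top. \<forall>j\<in>{..n}. P j k"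
    using assms by (intro eventually_ball_finite) (auto simp: eventually_at_top_linorder)
  then show ?thesis by (auto simp: eventually_at_top_linorder)
qed

text \<open>Every \<psi> contributes a negative factor, the inverse shear, followed by a positive
  one, so n + 1 of them fill the positions 0 to N = 2 n + 1. One k large enough for all of them is
  chosen.\<close>

lemma (in ergodic_flow) monotone_factorisation:
  assumes f: "profile M f" and G: "G \<in> sets M" "AE \<omega> in M. \<omega> \<in> G" "\<And>a \<omega>. \<tau> a \<omega> \<in> G \<longleftrightarrow> \<omega> \<in> G"
    and \<psi>: "\<And>j. j \<le> n \<Longrightarrow> twist_factor (\<psi> j)"
    and good: "\<And>\<omega> x. \<omega> \<in> G \<Longrightarrow> x \<in> strip \<Longrightarrow> fold (\<lambda>j. \<psi> j \<omega>) [0..<Suc n] x = rmap \<tau> f \<omega> x"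
    and bad: "\<And>\<omega> x. \<omega> \<notin> G \<Longrightarrow> x \<in> strip \<Longrightarrow> fold (\<lambda>j. \<psi> j \<omega>) [0..<Suc n] x = x"
  shows "\<exists>(N::nat) fs.
         (\<forall>j\<le>N. regular_rmap M \<tau> (fs j) \<and>
            (if even j then negative_monotone M \<tau> (fs j) else positive_monotone M \<tau> (fs j))) \<and>
         (\<forall>\<omega>. \<forall>x\<in>strip. rmap \<tau> f \<omega> x = fold (\<lambda>j. rmap \<tau> (fs j) \<omega>) [0..<Suc N] x)"
proof -
  let ?h = "\<lambda>j k. prof (\<lambda>\<omega> x. \<psi> j \<omega> (shear k x))"
  have "\<exists>k0. \<forall>k\<ge>k0. positive_monotone M \<tau> (?h j k) \<and> regular_rmap M \<tau> (?h j k) \<and>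
      (\<forall>\<omega>. \<forall>x\<in>strip. rmap \<tau> (?h j k) \<omega> x = \<psi> j \<omega> (shear k x))" if j: "j \<le> n" for j
  proof -
    obtain J \<delta> where "UD (\<psi> j) J" "jmeas M (\<psi> j)" "equivariant \<tau> (\<psi> j)" "displ_bounded (\<psi> j)" "\<delta> > 0"
      "\<forall>\<omega>. \<forall>x\<in>strip. \<delta> \<le> fst (J \<omega> x)" "AE \<omega> in M. area_preserving (\<psi> j \<omega>)"
      using \<psi>[OF j] unfolding twist_factor_def by blast
    then show ?thesis by (intro positive_monotone_shear[where g = "\<psi> j"]) auto
  qed
  then have "\<exists>k0. \<forall>k\<ge>k0. \<forall>j\<le>n. positive_monotone M \<tau> (?h j k) \<and> regular_rmap M \<tau> (?h j k) \<and>
      (\<forall>\<omega>. \<forall>x\<in>strip. rmap \<tau> (?h j k) \<omega> x = \<psi> j \<omega> (shear k x))"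
    by (rule uniform_threshold)
  then obtain k1 where k1: "\<forall>k\<ge>k1. \<forall>j\<le>n. positive_monotone M \<tau> (?h j k) \<and> regular_rmap M \<tau> (?h j k) \<and>
      (\<forall>\<omega>. \<forall>x\<in>strip. rmap \<tau> (?h j k) \<omega> x = \<psi> j \<omega> (shear k x))" by blast
  obtain k2 where k2: "\<forall>k\<ge>k2. \<forall>f. profile M f \<longrightarrow> (AE \<omega> in M. \<forall>x\<in>strip. rmap \<tau> f \<omega> x = shear (- k) x) \<longrightarrow>
     negative_monotone M \<tau> f \<and> regular_rmap M \<tau> f"
    using negative_monotone_shear by blast
  define k where "k = max k1 k2"
  have kk: "k1 \<le> k" "k2 \<le> k" by (simp_all add: k_def)
  have P: "positive_monotone M \<tau> (?h j k)" "regular_rmap M \<tau> (?h j k)"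
    "x \<in> strip \<Longrightarrow> rmap \<tau> (?h j k) \<omega> x = \<psi> j \<omega> (shear k x)" if "j \<le> n" for j \<omega> x
    using k1[THEN spec, THEN mp, OF kk(1), THEN spec, THEN mp, OF that] by blast+
  have Nk: "negative_monotone M \<tau> f" "regular_rmap M \<tau> f"
    if "profile M f" "AE \<omega> in M. \<forall>x\<in>strip. rmap \<tau> f \<omega> x = shear (- k) x" for f
    using k2[THEN spec, THEN mp, OF kk(2), THEN spec, THEN mp, OF that(1), THEN mp, OF that(2)] by blast+
  define g where "g = prof (\<lambda>\<omega> :: 'w. shear (- k))"
  have g: "profile M g" "x \<in> strip \<Longrightarrow> rmap \<tau> g \<omega> x = shear (- k) x" for x \<omega>
    unfolding g_def by (rule profile_prof[OF shear_jmeas]) (rule rmap_prof[OF shear_equivariant])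
  \<comment> \<open>The exceptional orbits are absorbed into the first factor, since all the other factors cancel there.\<close>
  define g0 where "g0 = (\<lambda>z. if fst z \<in> G then g z else shear (- k) (f z))"
  have g0: "profile M g0"
  proof -
    have "(\<lambda>z. shear (- k) (f z)) \<in> M \<Otimes>\<^sub>M restrict_space borel {-1..1} \<rightarrow>\<^sub>M strip_borel"
    proof -
      have "(\<lambda>z. z) \<in> strip_borel \<rightarrow>\<^sub>M strip_borel" by simp
      from jmeasD[OF shear_jmeas[of "count_space UNIV :: unit measure" "- k"] _ this, of "\<lambda>_. ()"]
      have "shear (- k) \<in> strip_borel \<rightarrow>\<^sub>M strip_borel" by simp
      from measurable_compose[OF f[unfolded profile_def] this] show ?thesis .
    qed
    moreover have "{z \<in> space (M \<Otimes>\<^sub>M restrict_space borel {-1..1::real}). fst z \<in> G} \<in> sets (M \<Otimes>\<^sub>M restrict_space borel {-1..1::real})"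
      using measurable_sets[OF measurable_fst G(1), of "restrict_space borel {-1..1::real}"]
      by (simp add: vimage_def Int_def conj_commute)
    ultimately show ?thesis
      unfolding profile_def g0_def using g(1)[unfolded profile_def] by (intro measurable_If)
  qed
  \<comment> \<open>\<open>rmap\<close> evaluates the profile at the moving point of the orbit; by
    invariance of \<open>G\<close> the same branch of \<open>g0\<close> is used along all of
    it.\<close>
  have g0_good: "rmap \<tau> g0 \<omega> x = shear (- k) x" if "\<omega> \<in> G" "x \<in> strip" for \<omega> x
  proof -
    have "rmap \<tau> g0 \<omega> x = rmap \<tau> g \<omega> x"
      by (cases x) (simp add: rmap_def g0_def G(3) that)
    then show ?thesis using g(2)[OF that(2)] by simp
  qed
  have g0_bad: "rmap \<tau> g0 \<omega> x = shear (- k) (rmap \<tau> f \<omega> x)" if "\<omega> \<notin> G" for \<omega> x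
    by (cases x) (simp add: rmap_def g0_def G(3) that shear_def case_prod_beta)
  have g0_AE: "AE \<omega> in M. \<forall>x\<in>strip. rmap \<tau> g0 \<omega> x = shear (- k) x"
    using G(2) by (rule AE_mp) (intro AE_I2 impI ballI g0_good)
  define fs where "fs i = (if i = 0 then g0 else if even i then g else ?h (i div 2) k)" for i :: nat
  have "regular_rmap M \<tau> (fs j) \<and> (if even j then negative_monotone M \<tau> (fs j) else positive_monotone M \<tau> (fs j))"
    if j: "j \<le> 2 * n + 1" for j
  proof (cases "even j")
    case True
    have "fs j = g0 \<or> fs j = g" using True by (simp add: fs_def)
    moreover have "AE \<omega> in M. \<forall>x\<in>strip. rmap \<tau> g \<omega> x = shear (- k) x" using g(2) by (intro AE_I2) blast
    ultimately show ?thesis using True Nk[OF g0 g0_AE] Nk[OF g(1)] by auto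
  next
    case False
    then have "fs j = ?h (j div 2) k" "j div 2 \<le> n" using j by (auto simp: fs_def)
    then show ?thesis using False P(1,2)[of "j div 2"] by simp
  qed
  moreover have "rmap \<tau> f \<omega> x = fold (\<lambda>j. rmap \<tau> (fs j) \<omega>) [0..<Suc (2 * n + 1)] x" if x: "x \<in> strip" for \<omega> x
  proof -
    have rx: "rmap \<tau> f \<omega> x \<in> strip"
    proof -
      have "(\<lambda>z. rmap \<tau> f (fst z) (snd z)) (\<omega>, x) \<in> space strip_borel"
        by (rule measurable_space[OF rmap_measurable[OF f]]) (simp add: space_pair_measure space_M space_strip_borel x)
      then show ?thesis by (simp add: space_strip_borel)
    qed
    \<comment> \<open>The point to which the \<psi> are effectively applied: on an exceptional orbit
      factor 0 has already performed the given map.\<close>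
    define y where "y = (if \<omega> \<in> G then x else rmap \<tau> f \<omega> x)"
    have y: "y \<in> strip" using x rx by (simp add: y_def)
    have "fold (\<lambda>j. rmap \<tau> (fs j) \<omega>) [0..<Suc (2 * n + 1)] x = fold (\<lambda>j. \<psi> j \<omega>) [0..<Suc n] y"
    proof (rule fold_interleave[OF _ _ _ _ y])
      show "rmap \<tau> (fs (2 * j)) \<omega> z = shear (- k) z" if "0 < j" "j \<le> n" "z \<in> strip" for j z
        using that g(2) by (simp add: fs_def)
      show "rmap \<tau> (fs 0) \<omega> x = shear (- k) y"
        using g0_good[OF _ x, of \<omega>] g0_bad[of \<omega> x] by (simp add: fs_def y_def)
      show "rmap \<tau> (fs (2 * j + 1)) \<omega> z = \<psi> j \<omega> (shear k z)" if "j \<le> n" "z \<in> strip" for j z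
        using P(3)[OF that] by (simp add: fs_def)
      show "\<psi> j \<omega> z \<in> strip" if jz: "j \<le> n" "z \<in> strip" for j z
      proof -
        obtain J where "UD (\<psi> j) J" using \<psi>[OF jz(1)] unfolding twist_factor_def by blast
        from UD_D(6)[OF this jz(2)] show ?thesis .
      qed
    qed
    also have "\<dots> = rmap \<tau> f \<omega> x" using good[OF _ x] bad[OF _ rx] by (simp add: y_def)
    finally show ?thesis by simp
  qed
  ultimately show ?thesis by blast
qed

theorem theorem2:
  shows "\<exists>r0::nat. \<forall>r\<ge>r0.
    \<forall>(M :: 'w::metric_space measure) (\<tau> :: real \<Rightarrow> 'w \<Rightarrow> 'w) (f :: 'w \<times> real \<Rightarrow> real \<times> real).
      ergodic_flow M \<tau> \<longrightarrow> ap_random_twist M \<tau> f \<longrightarrow> regular_rmap M \<tau> f \<longrightarrow>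
      isotopic_to_id r M \<tau> f \<longrightarrow>
      (\<exists>(N::nat) (fs :: nat \<Rightarrow> 'w \<times> real \<Rightarrow> real \<times> real).
         (\<forall>j\<le>N. regular_rmap M \<tau> (fs j) \<and>
            (if even j then negative_monotone M \<tau> (fs j) else positive_monotone M \<tau> (fs j))) \<and>
         (\<forall>\<omega>. \<forall>x\<in>strip.
            rmap \<tau> f \<omega> x = fold (\<lambda>j. rmap \<tau> (fs j) \<omega>) [0..<Suc N] x))"
proof (rule exI[of _ "3::nat"], intro allI impI)
  \<comment> \<open>The threshold 3: the Jacobian matrix of the triangular map contains second
    derivatives, and their spatial Lipschitz bounds need third ones.\<close>
  fix r :: nat and M :: "'w measure" and \<tau> :: "real \<Rightarrow> 'w \<Rightarrow> 'w" and f :: "'w \<times> real \<Rightarrow> real \<times> real"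
  assume r: "3 \<le> r" and flow: "ergodic_flow M \<tau>" and twist: "ap_random_twist M \<tau> f"
    and iso: "isotopic_to_id r M \<tau> f"
  interpret ergodic_flow M \<tau> by (rule flow)
  obtain ft K0 where ft: "\<And>t. t \<in> {0..1} \<Longrightarrow> profile M (ft t)"
    and ft01: "AE \<omega> in M. \<forall>x\<in>strip. rmap \<tau> (ft 0) \<omega> x = x \<and> rmap \<tau> (ft 1) \<omega> x = rmap \<tau> f \<omega> x"
    and ftd: "AE \<omega> in M. \<forall>t\<in>{0..1}. diffeo_strip (rmap \<tau> (ft t) \<omega>)"
    and ftC: "AE \<omega> in M. \<forall>t\<in>{0..1}.
           Cr_bounded r K0 (\<lambda>x. rmap \<tau> (ft t) \<omega> x - x) \<and>
           Cr_bounded r K0 (\<lambda>x. inv_into strip (rmap \<tau> (ft t) \<omega>) x - x) \<and>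
           (\<exists>v. (\<forall>x\<in>strip. ((\<lambda>s. rmap \<tau> (ft s) \<omega> x) has_vector_derivative v x) (at t within {0..1})) \<and>
                Cr_bounded r K0 v)"
    using iso unfolding isotopic_to_id_def by blast
  define K where "K = max 0 K0"
  define L where "L = 2 * K + 1"
  define \<delta> where "\<delta> = 1 / (32 * (K + 1) * (K + 1))"
  have K: "K \<ge> 0" by (simp add: K_def)
  define good where "good \<omega> \<longleftrightarrow> isotopy_core K L \<delta> (\<lambda>t. rmap \<tau> (ft t) \<omega>) \<and>
      (\<forall>x\<in>strip. rmap \<tau> (ft 1) \<omega> x = rmap \<tau> f \<omega> x)" for \<omega>
  have "AE \<omega> in M. good \<omega>"
    using ft01 ftd ftC
  proof eventually_elim
    case (elim \<omega>)
    have mono: "Cr_bounded 3 K h" if "Cr_bounded r K0 h" for h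
    proof -
      have "(0, 0) \<in> strip" by (simp add: strip_iff)
      then have "0 \<le> K0" using order_trans[OF norm_ge_zero Cr_bounded_norm[OF that]] by blast
      then show ?thesis using Cr_bounded_mono[OF r that] by (simp add: K_def)
    qed
    have "isotopy_core K L \<delta> (\<lambda>t. rmap \<tau> (ft t) \<omega>)"
      unfolding L_def \<delta>_def
    proof (rule isotopy_coreI[OF K])
      show "rmap \<tau> (ft 0) \<omega> x = x" if "x \<in> strip" for x using elim(1) that by blast
      fix t :: real assume t: "t \<in> {0..1}"
      show "diffeo_strip (rmap \<tau> (ft t) \<omega>)" using elim(2) t by blast
      have C: "Cr_bounded r K0 (\<lambda>x. rmap \<tau> (ft t) \<omega> x - x)"
        "Cr_bounded r K0 (\<lambda>x. inv_into strip (rmap \<tau> (ft t) \<omega>) x - x)"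
        "\<exists>v. (\<forall>x\<in>strip. ((\<lambda>s. rmap \<tau> (ft s) \<omega> x) has_vector_derivative v x) (at t within {0..1})) \<and> Cr_bounded r K0 v"
        using elim(3) t by blast+
      show "Cr_bounded 3 K (\<lambda>x. rmap \<tau> (ft t) \<omega> x - x)" by (rule mono[OF C(1)])
      show "Cr_bounded 3 K (\<lambda>x. inv_into strip (rmap \<tau> (ft t) \<omega>) x - x)" by (rule mono[OF C(2)])
      show "\<exists>v. (\<forall>x\<in>strip. ((\<lambda>s. rmap \<tau> (ft s) \<omega> x) has_vector_derivative v x) (at t within {0..1})) \<and> Cr_bounded 3 K v"
        using C(3) mono by blast
    qed
    then show ?case using elim(1) by (simp add: good_def)
  qed
  then obtain N where N: "N \<in> null_sets M" "{\<omega> \<in> space M. \<not> good \<omega>} \<subseteq> N"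
    by (auto simp: eventually_ae_filter)
  obtain G where G: "G \<in> sets M" "AE \<omega> in M. \<omega> \<in> G" "\<And>a \<omega>. \<tau> a \<omega> \<in> G \<longleftrightarrow> \<omega> \<in> G" "\<And>\<omega>. \<omega> \<in> G \<Longrightarrow> \<exists>a. \<tau> a \<omega> \<notin> N"
    using invariant_good_set[OF N(1)] by blast
  \<comment> \<open>Some point of the orbit avoids the null set, and \<open>good\<close> is carried
    back from it by translation; so on \<open>G\<close> it holds without exception.\<close>
  have good: "good \<omega>" if mem: "\<omega> \<in> G" for \<omega>
  proof -
    obtain a where "\<tau> a \<omega> \<notin> N" using G(4)[OF mem] by blast
    then have g: "good (\<tau> a \<omega>)" using N(2) space_M by blast
    have tr: "rmap \<tau> h \<omega> x = rmap \<tau> h (\<tau> a \<omega>) (x + (- a, 0)) - (- a, 0)" for h x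
      using rmap_translate[of h "- a" "\<tau> a \<omega>" x] by (simp add: flow_inverse)
    have "isotopy_core K L \<delta> (\<lambda>t x. rmap \<tau> (ft t) (\<tau> a \<omega>) (x + (- a, 0)) - (- a, 0))"
      using g unfolding good_def by (intro isotopy_core_translate) blast
    then have "isotopy_core K L \<delta> (\<lambda>t. rmap \<tau> (ft t) \<omega>)"
      unfolding tr[symmetric] .
    moreover have "rmap \<tau> (ft 1) \<omega> x = rmap \<tau> f \<omega> x" if x: "x \<in> strip" for x
    proof -
      have "x + (- a, 0) \<in> strip" using x by simp
      then have "rmap \<tau> (ft 1) (\<tau> a \<omega>) (x + (- a, 0)) = rmap \<tau> f (\<tau> a \<omega>) (x + (- a, 0))"
        using g unfolding good_def by blast
      then show ?thesis unfolding tr[of "ft 1"] tr[of f] by simp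
    qed
    ultimately show ?thesis by (simp add: good_def)
  qed
  \<comment> \<open>Measurability of \<open>G\<close> keeps \<open>F\<close> jointly measurable, its
    invariance keeps \<open>F\<close> equivariant, and the identity path satisfies the same
    bounds.\<close>
  define F where "F = (\<lambda>\<omega> t. if \<omega> \<in> G then rmap \<tau> (ft t) \<omega> else (\<lambda>x. x))"
  have \<delta>: "\<delta> > 0" "\<delta> \<le> 1"
  proof -
    have "1 * 1 \<le> (K + 1) * (K + 1)" using K by (intro mult_mono) auto
    then have "1 \<le> 32 * ((K + 1) * (K + 1))" by linarith
    then have "1 \<le> 32 * (K + 1) * (K + 1)" by (simp only: mult.assoc)
    then show "\<delta> > 0" "\<delta> \<le> 1" unfolding \<delta>_def by simp_all
  qed
  have core: "isotopy_core K L \<delta> (F \<omega>)" for \<omega>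
  proof (cases "\<omega> \<in> G")
    case True
    then show ?thesis using good[OF True] by (simp add: F_def good_def)
  next
    case False
    then show ?thesis using isotopy_core_id[of K L \<delta>] K \<delta> by (simp add: F_def L_def)
  qed
  then have "\<forall>\<omega>. \<exists>v. Cr_path (\<lambda>t x. F \<omega> t x - x) v K" unfolding isotopy_core_def by blast
  from choice[OF this]
  obtain v where v: "\<forall>\<omega>. Cr_path (\<lambda>t x. F \<omega> t x - x) (v \<omega>) K" by (rule exE)
  have C3: "C3_isotopy F v K L \<delta>"
  proof (rule C3_isotopy.intro)
    show "Cr_path (\<lambda>t x. F \<omega> t x - x) (v \<omega>) K" for \<omega> using v by (rule spec)
    note c = core[unfolded isotopy_core_def]
    fix \<omega> and t :: real and x :: "real \<times> real" assume t: "t \<in> {0..1}" and x: "x \<in> strip"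
    show "(snd (F \<omega> t x) = 1 \<longleftrightarrow> snd x = 1) \<and> (snd (F \<omega> t x) = -1 \<longleftrightarrow> snd x = -1)"
      using c[of \<omega>] t x by blast
    show "\<delta> \<le> dens (F \<omega> t) x" using c[of \<omega>] t x by blast
    show "norm (x - y) \<le> L * norm (F \<omega> t x - F \<omega> t y)" if "y \<in> strip" for y
      using c[of \<omega>] t x that by blast
  next
    show "bij_betw (F \<omega> t) strip strip" if "t \<in> {0..1}" for \<omega> t
      using core[of \<omega>] that unfolding isotopy_core_def by blast
    show "F \<omega> 0 x = x" if "x \<in> strip" for \<omega> x
      using core[of \<omega>] that unfolding isotopy_core_def by blast
  qed (rule \<delta>(1))
  have jm: "jmeas M (\<lambda>\<omega>. F \<omega> t)" if "t \<in> {0..1}" for t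
    unfolding F_def by (rule jmeas_restrict[OF G(1) ft[OF that]])
  have eq: "equivariant \<tau> (\<lambda>\<omega>. F \<omega> t)" for t
    by (auto simp: equivariant_def F_def G(3) rmap_translate)
  have F1: "F \<omega> 1 x = rmap \<tau> f \<omega> x" if "\<omega> \<in> G" "x \<in> strip" for \<omega> x
    using good[OF that(1)] that by (simp add: F_def good_def)
  have prof_f: "profile M f" and ap_f: "AE \<omega> in M. area_preserving (rmap \<tau> f \<omega>)"
    using twist unfolding ap_random_twist_def by auto
  have "AE \<omega> in M. area_preserving (F \<omega> 1)"
    using ap_f G(2)
  proof eventually_elim
    case (elim \<omega>)
    show ?case by (rule area_preserving_cong[OF elim(1)]) (simp add: F1[OF elim(2)])
  qed
  from isotopy_twist_factors[OF C3 jm eq this]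
  obtain n \<psi> where \<psi>: "\<And>j. j \<le> n \<Longrightarrow> twist_factor (\<psi> j)"
    "\<And>\<omega> x. x \<in> strip \<Longrightarrow> F \<omega> 1 x = fold (\<lambda>j. \<psi> j \<omega>) [0..<Suc n] x" by blast
  show "\<exists>(N::nat) (fs :: nat \<Rightarrow> 'w \<times> real \<Rightarrow> real \<times> real).
         (\<forall>j\<le>N. regular_rmap M \<tau> (fs j) \<and>
            (if even j then negative_monotone M \<tau> (fs j) else positive_monotone M \<tau> (fs j))) \<and>
         (\<forall>\<omega>. \<forall>x\<in>strip.
            rmap \<tau> f \<omega> x = fold (\<lambda>j. rmap \<tau> (fs j) \<omega>) [0..<Suc N] x)"
  proof (rule monotone_factorisation[OF prof_f G(1,2)])
    show "\<tau> a \<omega> \<in> G \<longleftrightarrow> \<omega> \<in> G" for a \<omega> by (rule G(3))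
    show "twist_factor (\<psi> j)" if "j \<le> n" for j by (rule \<psi>(1)[OF that])
    show "fold (\<lambda>j. \<psi> j \<omega>) [0..<Suc n] x = rmap \<tau> f \<omega> x" if "\<omega> \<in> G" "x \<in> strip" for \<omega> x
      using \<psi>(2)[OF that(2), of \<omega>] F1[OF that] by simp
    show "fold (\<lambda>j. \<psi> j \<omega>) [0..<Suc n] x = x" if "\<omega> \<notin> G" "x \<in> strip" for \<omega> x
      using \<psi>(2)[OF that(2), of \<omega>] that(1) by (simp add: F_def)
  qed
qed

end
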